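(* Let $H$ be the minimal Schr\"odinger operator in $L^2(\mathbb{R}^3)$ associated with distinct points $x_1,\dots,x_m\in\mathbb{R}^3$ and let $\Pi=\{\mathbb{C}^m,\Gamma_0,\Gamma_1\}$ be the boundary triplet for $H^*$ described in the context. Then: (i) the corresponding Weyl function $M(\cdot)$ is $$M(z)=\Bigl(\tfrac{i\sqrt z}{4\pi}\delta_{jk}+\widetilde G_{\sqrt z}(x_j-x_k)\Bigr)_{j,k=1}^m,\qquad z\in\mathbb{C}_+,$$ where $\widetilde G_{\sqrt z}(x)=\frac{e^{i\sqrt z|x|}}{4\pi|x|}$ for $x\neq0$, $\widetilde G_{\sqrt z}(0)=0$, and $\delta_{jk}$ is the Kronecker symbol; (ii) the corresponding $\gamma$-field is given, for $\{a_j\}_{j=1}^m\in\mathbb{C}^m$ and $z\in\rho(H_0)=\mathbb{C}\setminus[0,\infty)$, by $$\gamma(z)\{a_j\}_{j=1}^m=\sum_{j=1}^ma_j\frac{e^{i\sqrt z\,r_j}}{4\pi r_j}.$$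
   Context: Let $m\in\mathbb{N}$, $x_1,\dots,x_m\in\mathbb{R}^3$ distinct, $r_j=r_j(x)=|x-x_j|$. $H=-\Delta$ in $L^2(\mathbb{R}^3)$ with $\operatorname{dom}(H)=\{f\in W^{2,2}(\mathbb{R}^3):f(x_j)=0,\ j=1,\dots,m\}$, and $$\operatorname{dom}(H^* )=\Bigl\{f=\sum_{j=1}^m\bigl(\xi_{0j}\tfrac{e^{-r_j}}{r_j}+\xi_{1j}e^{-r_j}\bigr)+f_H:\ \{\xi_{0j}\},\{\xi_{1j}\}\in\mathbb{C}^m,\ f_H\in\operatorname{dom}(H)\Bigr\}.$$ For $f\in\operatorname{dom}(H^* )$: $\Gamma_0f=4\pi\{\lim_{x\to x_j}f(x)|x-x_j|\}_{j=1}^m=4\pi\{\xi_{0j}\}_{j=1}^m$, $\Gamma_1f=\{\lim_{x\to x_j}(f(x)-\tfrac{\xi_{0j}}{|x-x_j|})\}_{j=1}^m$; $\{\mathbb{C}^m,\Gamma_0,\Gamma_1\}$ is a boundary triplet for $H^*$, and $H_0:=H^*\upharpoonright\ker(\Gamma_0)$ is the free Hamiltonian $-\Delta$ on $W^{2,2}(\mathbb{R}^3)$. With $\mathfrak N_z=\ker(H^*-z)$, the Weyl function is the matrix-valued function on $\rho(H_0)$ defined by $M(z)\Gamma_0f_z=\Gamma_1f_z$ for $f_z\in\mathfrak N_z$, and the $\gamma$-field is $\gamma(z)=(\Gamma_0\upharpoonright\mathfrak N_z)^{-1}:\mathbb{C}^m\to\mathfrak N_z$. $\sqrt{\cdot}$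 is the branch of the square root with cut along $[0,\infty)$ with $\sqrt1=1$ (on the upper side of the cut), so $\operatorname{Im}\sqrt z>0$ off $[0,\infty)$. $\mathbb{C}_+$ is the open upper half-plane. *)

theory Defs
  imports "HOL-Analysis.Analysis"
begin

section \<open>The Hilbert space $L^2(R^3)$\<close>

definition sq_integrable :: "(real^3 \<Rightarrow> complex) \<Rightarrow> bool" where
  "sq_integrable u \<longleftrightarrow>
     u \<in> borel_measurable borel \<and> integrable lborel (\<lambda>y. (cmod (u y))\<^sup>2)"

definition ae_equal :: "(real^3 \<Rightarrow> complex) \<Rightarrow> (real^3 \<Rightarrow> complex) \<Rightarrow> bool" where
  "ae_equal u v \<longleftrightarrow> sq_integrable u \<and> sq_integrable v \<and> (AE y in lborel. u y = v y)"

lemma sq_integrable_zero [simp]: "sq_integrable (\<lambda>_. 0)"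
  by (simp add: sq_integrable_def)

lemma sq_integrable_scale:
  assumes "sq_integrable u"
  shows "sq_integrable (\<lambda>y. c * u y)"
proof -
  have [measurable]: "u \<in> borel_measurable borel"
    using assms by (simp add: sq_integrable_def)
  show ?thesis
    using assms by (simp add: sq_integrable_def norm_mult power_mult_distrib)
qed

lemma sq_integrable_add:
  assumes "sq_integrable u" "sq_integrable v"
  shows "sq_integrable (\<lambda>y. u y + v y)"
proof -
  have [measurable]: "u \<in> borel_measurable borel" "v \<in> borel_measurable borel"
    using assms by (simp_all add: sq_integrable_def)
  have bound: "(cmod (a + b))\<^sup>2 \<le> 2 * (cmod a)\<^sup>2 + 2 * (cmod b)\<^sup>2" for a b :: complex
  proof -
    have "(cmod (a + b))\<^sup>2 \<le> (cmod a + cmod b)\<^sup>2"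
      by (intro power_mono norm_triangle_ineq) simp
    also have "\<dots> \<le> 2 * (cmod a)\<^sup>2 + 2 * (cmod b)\<^sup>2"
      using sum_squares_bound[of "cmod a" "cmod b"] by (simp add: power2_sum)
    finally show ?thesis .
  qed
  have "integrable lborel (\<lambda>y. 2 * (cmod (u y))\<^sup>2 + 2 * (cmod (v y))\<^sup>2)"
    using assms by (simp add: sq_integrable_def)
  then have "integrable lborel (\<lambda>y. (cmod (u y + v y))\<^sup>2)"
    by (rule Bochner_Integration.integrable_bound) (use bound in auto)
  then show ?thesis
    by (simp add: sq_integrable_def)
qed

lemma sq_integrable_uminus: "sq_integrable u \<Longrightarrow> sq_integrable (\<lambda>y. - u y)"
  using sq_integrable_scale[of u "-1"] by simp

lemma sq_integrable_diff:
  "sq_integrable u \<Longrightarrow> sq_integrable v \<Longrightarrow> sq_integrable (\<lambda>y. u y - v y)"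
  using sq_integrable_add[of u "\<lambda>y. - v y"] by (simp add: sq_integrable_uminus)

quotient_type l2 = "real^3 \<Rightarrow> complex" / partial: ae_equal
proof (rule part_equivpI)
  show "\<exists>u. ae_equal u u"
    by (rule exI[of _ "\<lambda>_. 0"]) (simp add: ae_equal_def)
  show "symp ae_equal"
    by (auto simp: symp_def ae_equal_def)
  show "transp ae_equal"
    by (auto simp: transp_def ae_equal_def elim: eventually_elim2)
qed

instantiation l2 :: ab_group_add
begin

lift_definition zero_l2 :: l2 is "\<lambda>_. 0"
  by (simp add: ae_equal_def)

lift_definition plus_l2 :: "l2 \<Rightarrow> l2 \<Rightarrow> l2" is "\<lambda>u v y. u y + v y"
  by (auto simp: ae_equal_def sq_integrable_add elim: eventually_elim2)

lift_definition uminus_l2 :: "l2 \<Rightarrow> l2" is "\<lambda>u y. - u y"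
  by (auto simp: ae_equal_def sq_integrable_uminus)

lift_definition minus_l2 :: "l2 \<Rightarrow> l2 \<Rightarrow> l2" is "\<lambda>u v y. u y - v y"
  by (auto simp: ae_equal_def sq_integrable_diff elim: eventually_elim2)

instance
  by standard
    (transfer; simp add: ae_equal_def sq_integrable_add sq_integrable_diff
       sq_integrable_uminus algebra_simps)+

end

lift_definition scale_l2 :: "complex \<Rightarrow> l2 \<Rightarrow> l2" (infixr "*\<^sub>C" 75) is "\<lambda>c u y. c * u y"
  by (auto simp: ae_equal_def sq_integrable_scale)

lift_definition inner_l2 :: "l2 \<Rightarrow> l2 \<Rightarrow> complex"
  is "\<lambda>u v. integral\<^sup>L lborel (\<lambda>y. u y * cnj (v y))"
  by (rule integral_cong_AE) (auto simp: ae_equal_def sq_integrable_def elim: eventually_elim2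
      intro!: borel_measurable_times borel_measurable_continuous_on[of cnj] continuous_intros)

definition norm_l2 :: "l2 \<Rightarrow> real" where
  "norm_l2 f = sqrt (Re (inner_l2 f f))"

text \<open>\<open>represents f u\<close>: the function \<open>u\<close> is square integrable and belongs to the class \<open>f\<close>.\<close>

lift_definition represents :: "l2 \<Rightarrow> (real^3 \<Rightarrow> complex) \<Rightarrow> bool" is ae_equal
  by (auto simp: ae_equal_def fun_eq_iff elim: eventually_elim2)


section \<open>The Sobolev space $W^{2,2}(R^3)$ and the Laplacian\<close>

definition pderiv_at :: "3 \<Rightarrow> (real^3 \<Rightarrow> complex) \<Rightarrow> real^3 \<Rightarrow> complex" where
  "pderiv_at i u y = frechet_derivative u (at y) (axis i 1)"

text \<open>Smoothness: all iterated partial derivatives exist and are differentiable everywhere.\<close>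

definition test_function :: "(real^3 \<Rightarrow> complex) \<Rightarrow> bool" where
  "test_function \<phi> \<longleftrightarrow>
     (\<forall>is. foldr pderiv_at is \<phi> differentiable_on UNIV) \<and>
     compact (closure {y. \<phi> y \<noteq> 0})"

definition weak_pderiv :: "3 \<Rightarrow> l2 \<Rightarrow> l2 \<Rightarrow> bool" where
  "weak_pderiv i f g \<longleftrightarrow>
     (\<forall>u v \<phi>. represents f u \<longrightarrow> represents g v \<longrightarrow> test_function \<phi> \<longrightarrow>
        integral\<^sup>L lborel (\<lambda>y. u y * pderiv_at i \<phi> y) = - integral\<^sup>L lborel (\<lambda>y. v y * \<phi> y))"

definition W22 :: "l2 set" where
  "W22 = {f. \<forall>i. \<exists>g. weak_pderiv i f g \<and> (\<forall>j. \<exists>h. weak_pderiv j g h)}"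

text \<open>Weak derivatives are unique, so the definite description is meaningful on \<open>W22\<close>.\<close>

definition weak_D :: "3 \<Rightarrow> l2 \<Rightarrow> l2" where
  "weak_D i f = (THE g. weak_pderiv i f g)"

definition laplacian :: "l2 \<Rightarrow> l2" where
  "laplacian f = (\<Sum>i\<in>UNIV. weak_D i (weak_D i f))"


section \<open>Operators in $L^2$, Weyl functions and $\gamma$-fields\<close>

text \<open>Unbounded operators are identified with their graphs.\<close>

type_synonym l2_operator = "(l2 \<times> l2) set"

definition adjoint_op :: "l2_operator \<Rightarrow> l2_operator" where
  "adjoint_op T = {(g, h). \<forall>(f, k)\<in>T. inner_l2 k g = inner_l2 f h}"

definition resolvent_set :: "l2_operator \<Rightarrow> complex set" where
  "resolvent_set T =
     {z. (\<forall>g. \<exists>!f. (f, g + z *\<^sub>C f) \<in> T) \<and>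
         (\<exists>C. \<forall>(f, h)\<in>T. norm_l2 f \<le> C * norm_l2 (h - z *\<^sub>C f))}"

definition defect_space :: "l2_operator \<Rightarrow> complex \<Rightarrow> l2 set" where
  "defect_space T z = {f. (f, z *\<^sub>C f) \<in> T}"

text \<open>For a boundary triplet $(C^m, \Gamma_0, \Gamma_1)$ of an operator \<open>T\<close> (in the application
  \<open>T\<close> is the adjoint of the minimal operator): the restriction of \<open>T\<close> to the kernel of
  \<open>\<Gamma>\<^sub>0\<close>, the $\gamma$-field and the Weyl function. The last two are determined
  uniquely for \<open>z\<close> in the resolvent set of the restriction.\<close>

definition ker_restriction :: "l2_operator \<Rightarrow> (l2 \<Rightarrow> complex^'m) \<Rightarrow> l2_operator" where
  "ker_restriction T G0 = {(f, h) \<in> T. G0 f = 0}"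

definition gamma_field ::
    "l2_operator \<Rightarrow> (l2 \<Rightarrow> complex^'m) \<Rightarrow> complex \<Rightarrow> complex^'m \<Rightarrow> l2" where
  "gamma_field T G0 z = the_inv_into (defect_space T z) G0"

definition weyl_function ::
    "l2_operator \<Rightarrow> (l2 \<Rightarrow> complex^'m) \<Rightarrow> (l2 \<Rightarrow> complex^'m) \<Rightarrow> complex \<Rightarrow> complex^'m^'m" where
  "weyl_function T G0 G1 z = (THE M. \<forall>f\<in>defect_space T z. M *v G0 f = G1 f)"


section \<open>The Schroedinger operator with point interactions\<close>

text \<open>The condition $f(x_j) = 0$ refers to the continuous representative of $f \in W^{2,2}(R^3)$.\<close>

definition dom_H :: "('m \<Rightarrow> real^3) \<Rightarrow> l2 set" where
  "dom_H x = {f \<in> W22. \<exists>u. represents f u \<and> continuous_on UNIV u \<and> (\<forall>j. u (x j) = 0)}"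

definition H_min :: "('m \<Rightarrow> real^3) \<Rightarrow> l2_operator" where
  "H_min x = {(f, - laplacian f) |f. f \<in> dom_H x}"

definition H_adj :: "('m \<Rightarrow> real^3) \<Rightarrow> l2_operator" where
  "H_adj x = adjoint_op (H_min x)"

text \<open>Elements of the domain of \<open>H_adj x\<close> have a representative that is continuous away from the
  points $x_j$. Two such representatives differ at most at the points $x_j$, which does not
  affect the limits below.\<close>

definition cont_rep :: "('m \<Rightarrow> real^3) \<Rightarrow> l2 \<Rightarrow> real^3 \<Rightarrow> complex" where
  "cont_rep x f = (SOME u. represents f u \<and> continuous_on (- range x) u)"

text \<open>\<open>sing_coeff x f $ j\<close> is the coefficient $\xi_{0j} = \lim_{y \to x_j} f(y) |y - x_j|$.\<close>

definition sing_coeff :: "('m::finite \<Rightarrow> real^3) \<Rightarrow> l2 \<Rightarrow> complex^'m" where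
  "sing_coeff x f =
     (\<chi> j. Lim (at (x j)) (\<lambda>y. cont_rep x f y * of_real (norm (y - x j))))"

definition Gamma0 :: "('m::finite \<Rightarrow> real^3) \<Rightarrow> l2 \<Rightarrow> complex^'m" where
  "Gamma0 x f = (4 * pi) *\<^sub>R sing_coeff x f"

definition Gamma1 :: "('m::finite \<Rightarrow> real^3) \<Rightarrow> l2 \<Rightarrow> complex^'m" where
  "Gamma1 x f =
     (\<chi> j. Lim (at (x j)) (\<lambda>y. cont_rep x f y - sing_coeff x f $ j / of_real (norm (y - x j))))"

definition H_zero :: "('m::finite \<Rightarrow> real^3) \<Rightarrow> l2_operator" where
  "H_zero x = ker_restriction (H_adj x) (Gamma0 x)"

text \<open>The branch of the square root with cut along $[0,\infty)$, continuous from above on the cut;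
  \<open>csqrt\<close> is a different branch.\<close>

definition sqrt_cut :: "complex \<Rightarrow> complex" where
  "sqrt_cut z = of_real (sqrt (cmod z)) * exp (\<i> * of_real (Arg2pi z / 2))"

definition G_tilde :: "complex \<Rightarrow> real^3 \<Rightarrow> complex" where
  "G_tilde k y = (if y = 0 then 0
     else exp (\<i> * k * of_real (norm y)) / (4 * of_real pi * of_real (norm y)))"

end

(* Let G_k(y) = exp(i k |y|) / (4 pi |y|) with Im k > 0 and z = k^2. The proof avoids the Fourier
   transform: everything is derived from the identity G_k * (-Laplace - z) phi = phi for test
   functions phi, which is obtained by replacing |y| with sqrt(|y|^2 + e^2) in G_k, integrating by
   parts and letting e tend to 0. By Fubini the identity passes to W^{2,2}; hence G_k * w lies in the
   domain of the adjoint for every w in L^2, with (H^* - z)(G_k * w) = w, and G_k(. - x_j) lies in the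
   kernel of H^* - z. Conversely, an element f of this kernel is orthogonal to all test functions phi
   such that (conjugate of G_k) * phi vanishes at all x_j. These are finitely many linear conditions,
   so f is a linear combination of the functions G_k(. - x_j). This gives the defect spaces, on which
   the boundary values can be read off, and it identifies the resolvent of the restriction to the
   kernel of Gamma0 with convolution by G_k. Cut-off plane waves show that [0, oo) is in the spectrum. *)

theory Submission
  imports Defs "HOL-Real_Asymp.Real_Asymp"
begin

section \<open>Integrals of radial functions\<close>

text \<open>Elements of L^2 are classes, while boundary values are pointwise limits, so a
  representative of known regularity is needed wherever a value is taken. Convolution with G_k
  supplies it: G_k is in L^2, so G_k * w is continuous for every w in L^2, which does the work of
  the Sobolev embedding. G_k is also in L^1, which makes the convolution bounded on L^2. Both facts
  rest on dimension three, where the weight r^2 of polar coordinates absorbs the singularities 1/r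
  and 1/r^2, and on Im k > 0, which gives exponential decay. The smoothing by e keeps the kernel
  smooth on all of R^3, so integrating by parts produces no boundary terms. Instead the equation for
  the kernel acquires an error e^2 (3 rho^-5 + ...) with rho^2 = |y|^2 + e^2. In the variable y / e
  this error has a fixed profile: it concentrates at 0 with mass 4 pi, and this is the constant in
  the denominator of G_k. The diagonal of M is the constant term i k / (4 pi) in the expansion of
  exp(i k r) / (4 pi r) at r = 0.\<close>

text \<open>Both measures assign to \<open>{..<a}\<close> the volume of a ball of radius
  \<open>a\<close>. Half lines are closed under intersection, generate the Borel sets, and countably
  many of them of finite measure cover the line. This gives polar coordinates for radial integrands
  from the volume of balls alone.\<close>

lemma distr_norm_lborel:
  "distr (lborel :: (real^3) measure) borel norm = density lborel (\<lambda>r. ennreal (4 * pi * r\<^sup>2 * indicator {0..} r))"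
    (is "?N = ?M")
proof (rule measure_eqI_generator_eq_countable)
  let ?E = "range (\<lambda>a::real. {..<a})"
  show "Int_stable ?E"
  proof -
    have "{..<a} \<inter> {..<b} = {..<min a b}" for a b :: real by auto
    then show ?thesis by (auto simp: Int_stable_def)
  qed
  have "sets borel = sigma_sets UNIV ?E"
    by (subst borel_Iio) (simp add: sets_measure_of)
  then show "sets ?N = sigma_sets UNIV ?E" "sets ?M = sigma_sets UNIV ?E"
    by simp_all
  have N: "emeasure ?N {..<a} = ennreal (4 / 3 * pi * (max 0 a) ^ 3)" for a
  proof -
    have "emeasure ?N {..<a} = emeasure lborel (ball (0::real^3) a)"
      by (subst emeasure_distr) (auto intro!: arg_cong[where f="emeasure lborel"] simp: ball_def)
    also have "\<dots> = ennreal (4 / 3 * pi * (max 0 a) ^ 3)"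
    proof (cases "a \<ge> 0")
      case True
      then show ?thesis
        using emeasure_ball[of a "0::real^3"] by (simp add: unit_ball_vol_3 max_def)
    next
      case False
      then have "ball (0::real^3) a = {}" by auto
      then show ?thesis unfolding \<open>ball (0::real^3) a = {}\<close> using False by (simp add: max_def)
    qed
    finally show ?thesis .
  qed
  have M: "emeasure ?M {..<a} = ennreal (4 / 3 * pi * (max 0 a) ^ 3)" for a
  proof -
    have "emeasure ?M {..<a} = (\<integral>\<^sup>+r. ennreal (4 * pi * r\<^sup>2) * indicator {0..max 0 a} r \<partial>lborel)"
    proof (subst emeasure_density; simp?)
      have "AE x in lborel. x \<noteq> a" by (rule AE_lborel_singleton)
      then show "(\<integral>\<^sup>+x. ennreal (4 * pi * x\<^sup>2 * indicator {0..} x) * indicator {..<a} x \<partial>lborel) =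
        (\<integral>\<^sup>+r. ennreal (4 * pi * r\<^sup>2) * indicator {0..max 0 a} r \<partial>lborel)"
        by (intro nn_integral_cong_AE)
          (auto elim!: eventually_mono split: split_indicator simp: max_def)
    qed
    also have "\<dots> = ennreal (4 / 3 * pi * (max 0 a) ^ 3 - 4 / 3 * pi * 0 ^ 3)"
      by (rule nn_integral_FTC_Icc)
        (auto intro!: derivative_eq_intros simp: power2_eq_square)
    finally show ?thesis by simp
  qed
  show "\<And>X. X \<in> ?E \<Longrightarrow> emeasure ?N X = emeasure ?M X"
    using N M by auto
  show "(\<Union>i\<in>\<nat>. {..<i::real}) = UNIV"
    by (auto intro: reals_Archimedean2 simp: Nats_def)
  show "\<And>a. a \<in> (\<lambda>a. {..<a}) ` \<nat> \<Longrightarrow> emeasure ?N a \<noteq> \<infinity>"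
    using N by auto
  show "countable ((\<lambda>a. {..<a::real}) ` \<nat>)"
    by (auto simp: Nats_def)
qed auto

lemma nn_integral_radial:
  fixes F :: "real \<Rightarrow> ennreal"
  assumes [measurable]: "F \<in> borel_measurable borel"
  shows "(\<integral>\<^sup>+y. F (norm (y::real^3)) \<partial>lborel) =
    (\<integral>\<^sup>+r. ennreal (4 * pi * r\<^sup>2) * F r * indicator {0..} r \<partial>lborel)"
proof -
  have "(\<integral>\<^sup>+y. F (norm (y::real^3)) \<partial>lborel) = (\<integral>\<^sup>+r. F r \<partial>distr (lborel :: (real^3) measure) borel norm)"
    by (subst nn_integral_distr) auto
  also have "\<dots> = (\<integral>\<^sup>+r. ennreal (4 * pi * r\<^sup>2) * F r * indicator {0..} r \<partial>lborel)"
    unfolding distr_norm_lborel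
    by (subst nn_integral_density) (auto intro!: nn_integral_cong split: split_indicator)
  finally show ?thesis .
qed

text \<open>The integrand \<open>f\<close> may be singular at 0, whereas \<open>p\<close> is its
  product with the density, extended to 0 so that it has the antiderivative \<open>F\<close>.
  Agreement for \<open>r > 0\<close> suffices because a point is a null set.\<close>

lemma nn_integral_radial_FTC:
  fixes f p F :: "real \<Rightarrow> real"
  assumes [measurable]: "f \<in> borel_measurable borel" "p \<in> borel_measurable borel"
    and p: "\<And>r. 0 < r \<Longrightarrow> 4 * pi * r\<^sup>2 * f r = p r"
    and F: "\<And>r. 0 \<le> r \<Longrightarrow> (F has_real_derivative p r) (at r)"
    and nonneg: "\<And>r. 0 \<le> r \<Longrightarrow> 0 \<le> f r" "\<And>r. 0 \<le> r \<Longrightarrow> 0 \<le> p r"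
    and lim: "(F \<longlongrightarrow> T) at_top"
  shows "(\<integral>\<^sup>+y. ennreal (f (norm (y::real^3))) \<partial>lborel) = ennreal (T - F 0)"
proof -
  have "(\<integral>\<^sup>+y. ennreal (f (norm (y::real^3))) \<partial>lborel) =
      (\<integral>\<^sup>+r. ennreal (4 * pi * r\<^sup>2) * ennreal (f r) * indicator {0..} r \<partial>lborel)"
    by (rule nn_integral_radial) simp
  also have "\<dots> = (\<integral>\<^sup>+r. ennreal (p r) * indicator {0..} r \<partial>lborel)"
  proof (rule nn_integral_cong_AE)
    have "AE r::real in lborel. r \<noteq> 0" by (rule AE_lborel_singleton)
    then show "AE r in lborel. ennreal (4 * pi * r\<^sup>2) * ennreal (f r) * indicator {0..} r
        = ennreal (p r) * indicator {0..} r"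
      by eventually_elim (auto split: split_indicator simp: nonneg ennreal_mult[symmetric] p)
  qed
  also have "\<dots> = ennreal (T - F 0)"
    using nonneg by (intro nn_integral_FTC_atLeast F lim) auto
  finally show ?thesis .
qed

section \<open>Integrability of exponential and rational kernels on R^3\<close>

lemma integrable_exp_div_norm_sq:
  fixes c :: real
  assumes "c > 0"
  shows "integrable lborel (\<lambda>y::real^3. exp (- c * norm y) / (norm y)\<^sup>2)"
proof -
  have lim: "((\<lambda>r. - 4 * pi * exp (- c * r) / c) \<longlongrightarrow> 0) at_top"
    using assms by real_asymp
  have "(\<integral>\<^sup>+y. ennreal (exp (- c * norm (y::real^3)) / (norm y)\<^sup>2) \<partial>lborel) =
      ennreal (0 - (- 4 * pi * exp (- c * 0) / c))"
    by (rule nn_integral_radial_FTC[where f="\<lambda>r. exp (- c * r) / r\<^sup>2" and p="\<lambda>r. 4 * pi * exp (- c * r)"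
          and F="\<lambda>r. - 4 * pi * exp (- c * r) / c"])
      (use assms lim in \<open>auto intro!: derivative_eq_intros\<close>)
  then show ?thesis
    by (intro integrableI_nonneg) auto
qed

text \<open>Half of the decay rate is traded for a factor \<open>r\<close>, by
  \<open>t \<le> exp t\<close> at \<open>t = c * r / 2\<close>. Starting from exp(-c r) / r^2,
  integrability thus passes to exp(-c r) / r and then to exp(-c r).\<close>

lemma mult_exp_neg_le:
  fixes c r :: real
  assumes "c > 0" "r \<ge> 0"
  shows "r * exp (- c * r) \<le> exp (- (c / 2) * r) * (2 / c)"
proof -
  have "c / 2 * r \<le> exp (c / 2 * r)"
    using exp_ge_add_one_self[of "c / 2 * r"] by linarith
  then have "r \<le> (2 / c) * exp (c / 2 * r)"
    using assms by (simp add: field_simps)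
  then have "r * exp (- c * r) \<le> (2 / c) * exp (c / 2 * r) * exp (- c * r)"
    by (intro mult_right_mono) auto
  also have "\<dots> = exp (- (c / 2) * r) * (2 / c)"
    by (simp add: exp_add[symmetric] mult.assoc)
  finally show ?thesis .
qed

lemma integrable_exp_div_norm:
  fixes c :: real
  assumes "c > 0"
  shows "integrable lborel (\<lambda>y::real^3. exp (- c * norm y) / norm y)"
proof -
  have bound: "exp (- c * norm y) / norm y \<le> exp (- (c / 2) * norm y) / (norm y)\<^sup>2 * (2 / c)" for y :: "real^3"
  proof (cases "y = 0")
    case False
    have "exp (- c * norm y) / norm y = norm y * exp (- c * norm y) / (norm y)\<^sup>2"
      using False by (simp add: power2_eq_square)
    also have "\<dots> \<le> exp (- (c / 2) * norm y) * (2 / c) / (norm y)\<^sup>2"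
      by (intro divide_right_mono mult_exp_neg_le assms) auto
    finally show ?thesis by (simp add: mult_ac)
  qed auto
  have "integrable lborel (\<lambda>y::real^3. exp (- (c / 2) * norm y) / (norm y)\<^sup>2 * (2 / c))"
    by (intro integrable_mult_left integrable_exp_div_norm_sq) (use assms in simp)
  then show ?thesis
    by (rule Bochner_Integration.integrable_bound) (use bound assms in \<open>auto intro!: AE_I2\<close>)
qed

lemma integrable_exp_norm:
  fixes c :: real
  assumes "c > 0"
  shows "integrable lborel (\<lambda>y::real^3. exp (- c * norm y))"
proof -
  have "integrable lborel (\<lambda>y::real^3. exp (- (c / 2) * norm y) / norm y * (2 / c))"
    by (intro integrable_mult_left integrable_exp_div_norm) (use assms in simp)
  then show ?thesis
  proof (rule Bochner_Integration.integrable_bound)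
    have "AE y::real^3 in lborel. y \<noteq> 0" by (rule AE_lborel_singleton)
    then show "AE y::real^3 in lborel. norm (exp (- c * norm y)) \<le>
        norm (exp (- (c / 2) * norm y) / norm y * (2 / c))"
    proof eventually_elim
      case (elim y)
      have "exp (- c * norm y) = norm y * exp (- c * norm y) / norm y"
        using elim by simp
      also have "\<dots> \<le> exp (- (c / 2) * norm y) * (2 / c) / norm y"
        by (intro divide_right_mono mult_exp_neg_le assms) auto
      finally show ?case using assms by (simp add: mult_ac)
    qed
  qed auto
qed

text \<open>The integrand is rho^-4 for rho = sqrt(1 + |y|^2). It dominates the lower-order terms of
  the error in \<open>G_tilde_fundamental\<close>.\<close>

lemma integrable_inverse_quartic:
  "integrable lborel (\<lambda>y::real^3. 1 / (1 + (norm y)\<^sup>2)\<^sup>2)"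
proof -
  have "(\<integral>\<^sup>+y. ennreal (1 / (1 + (norm (y::real^3))\<^sup>2)\<^sup>2) \<partial>lborel) =
      ennreal (2 * pi * (pi / 2) - 2 * pi * (arctan 0 - 0 / (1 + 0\<^sup>2)))"
  proof (rule nn_integral_radial_FTC[where f="\<lambda>r. 1 / (1 + r\<^sup>2)\<^sup>2" and p="\<lambda>r. 4 * pi * r\<^sup>2 * (1 / (1 + r\<^sup>2)\<^sup>2)"
          and F="\<lambda>r. 2 * pi * (arctan r - r / (1 + r\<^sup>2))"])
    have "((\<lambda>r::real. r / (1 + r\<^sup>2)) \<longlongrightarrow> 0) at_top" by real_asymp
    then have "((\<lambda>r. 2 * pi * (arctan r - r / (1 + r\<^sup>2))) \<longlongrightarrow> 2 * pi * (pi / 2 - 0)) at_top"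
      by (intro tendsto_intros tendsto_arctan_at_top)
    then show "((\<lambda>r. 2 * pi * (arctan r - r / (1 + r\<^sup>2))) \<longlongrightarrow> 2 * pi * (pi / 2)) at_top"
      by simp
    fix r :: real
    have [simp]: "1 + r\<^sup>2 \<noteq> 0" by (smt (verit) zero_le_power2)
    have "1 / (1 + r\<^sup>2) - (1 * (1 + r\<^sup>2) - r * (2 * r)) / ((1 + r\<^sup>2) * (1 + r\<^sup>2)) = 2 * r\<^sup>2 * (1 / (1 + r\<^sup>2)\<^sup>2)"
      by (simp add: divide_simps) (simp add: power2_eq_square algebra_simps)
    then show "((\<lambda>r. 2 * pi * (arctan r - r / (1 + r\<^sup>2))) has_real_derivative 4 * pi * r\<^sup>2 * (1 / (1 + r\<^sup>2)\<^sup>2)) (at r)"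
      by (auto intro!: derivative_eq_intros simp: inverse_eq_divide)
  qed auto
  then show ?thesis
    by (intro integrableI_nonneg) auto
qed

text \<open>Three times this kernel is minus the Laplacian of the smoothed Coulomb potential 1 /
  sqrt(1 + |y|^2). It is the leading profile of the error left by the smoothing of the Green
  function.\<close>

lemma integral_mollifier_kernel:
  "integrable lborel (\<lambda>y::real^3. 1 / sqrt (1 + (norm y)\<^sup>2) ^ 5)"
  "integral\<^sup>L lborel (\<lambda>y::real^3. 1 / sqrt (1 + (norm y)\<^sup>2) ^ 5) = 4 * pi / 3"
proof -
  have eq: "(\<integral>\<^sup>+y. ennreal (1 / sqrt (1 + (norm (y::real^3))\<^sup>2) ^ 5) \<partial>lborel) =
      ennreal (4 * pi / 3 * 1 - 4 * pi / 3 * (0 / sqrt (1 + 0\<^sup>2)) ^ 3)"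
  proof (rule nn_integral_radial_FTC[where f="\<lambda>r. 1 / sqrt (1 + r\<^sup>2) ^ 5" and p="\<lambda>r. 4 * pi * r\<^sup>2 * (1 / sqrt (1 + r\<^sup>2) ^ 5)"
          and F="\<lambda>r. 4 * pi / 3 * (r / sqrt (1 + r\<^sup>2)) ^ 3"])
    have "((\<lambda>r::real. (r / sqrt (1 + r\<^sup>2)) ^ 3) \<longlongrightarrow> 1) at_top" by real_asymp
    then show "((\<lambda>r. 4 * pi / 3 * (r / sqrt (1 + r\<^sup>2)) ^ 3) \<longlongrightarrow> 4 * pi / 3 * 1) at_top"
      by (intro tendsto_intros)
    fix r :: real
    define s where "s = sqrt (1 + r\<^sup>2)"
    have s: "s > 0" "s * s = 1 + r\<^sup>2"
      by (auto simp: s_def intro: add_pos_nonneg)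
    have s': "r * r = s * s - 1"
      using s by (simp add: power2_eq_square)
    have "((\<lambda>r. sqrt (1 + r\<^sup>2)) has_real_derivative r / s) (at r)"
      using s by (auto intro!: derivative_eq_intros simp: s_def inverse_eq_divide)
    then have "((\<lambda>r. r / sqrt (1 + r\<^sup>2)) has_real_derivative (1 * s - r * (r / s)) / (s * s)) (at r)"
      by (rule DERIV_cong[OF DERIV_divide[OF DERIV_ident]]) (use s in \<open>auto simp: s_def\<close>)
    also have "(1 * s - r * (r / s)) / (s * s) = 1 / s ^ 3"
      using s(1) s' by (simp add: field_simps power3_eq_cube)
    finally have D: "((\<lambda>r. (r / sqrt (1 + r\<^sup>2)) ^ 3) has_real_derivative 3 * (r / s)\<^sup>2 * (1 / s ^ 3)) (at r)"
      by (rule DERIV_cong[OF DERIV_power]) (simp add: s_def)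
    have eq: "4 * pi * r\<^sup>2 * (1 / s ^ 5) = 4 * pi / 3 * (3 * (r / s)\<^sup>2 * (1 / s ^ 3))"
      using s by (simp add: power_divide field_simps flip: power_add)
    show "((\<lambda>r. 4 * pi / 3 * (r / sqrt (1 + r\<^sup>2)) ^ 3) has_real_derivative 4 * pi * r\<^sup>2 * (1 / sqrt (1 + r\<^sup>2) ^ 5)) (at r)"
      by (rule DERIV_cong[OF DERIV_cmult[OF D]]) (subst eq[symmetric], simp add: s_def)
  qed auto
  then show "integrable lborel (\<lambda>y::real^3. 1 / sqrt (1 + (norm y)\<^sup>2) ^ 5)"
    by (intro integrableI_nonneg) auto
  show "integral\<^sup>L lborel (\<lambda>y::real^3. 1 / sqrt (1 + (norm y)\<^sup>2) ^ 5) = 4 * pi / 3"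
    by (subst integral_eq_nn_integral) (auto simp: eq)
qed

section \<open>Smooth functions and test functions\<close>

text \<open>This is the smoothness clause of \<open>test_function\<close>, isolated so that it can
  be established by closure properties.\<close>

definition smooth_fun :: "(real^3 \<Rightarrow> complex) \<Rightarrow> bool" where
  "smooth_fun u \<longleftrightarrow> (\<forall>is. foldr pderiv_at is u differentiable_on UNIV)"

lemma smooth_fun_iff:
  "smooth_fun u \<longleftrightarrow> (\<forall>y. u differentiable (at y)) \<and> (\<forall>i. smooth_fun (pderiv_at i u))"
proof safe
  assume u: "smooth_fun u"
  then show "u differentiable (at y)" for y
    unfolding smooth_fun_def by (auto simp: differentiable_on_def dest!: spec[of _ "[]"])
  show "smooth_fun (pderiv_at i u)" for i
    unfolding smooth_fun_def
  proof
    fix "is"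
    show "foldr pderiv_at is (pderiv_at i u) differentiable_on UNIV"
      using u[unfolded smooth_fun_def, rule_format, of "is @ [i]"] by simp
  qed
next
  assume u: "\<forall>y. u differentiable (at y)" "\<forall>i. smooth_fun (pderiv_at i u)"
  show "smooth_fun u"
    unfolding smooth_fun_def
  proof
    fix "is"
    show "foldr pderiv_at is u differentiable_on UNIV"
      using u by (cases "is" rule: rev_cases) (auto simp: smooth_fun_def differentiable_on_def)
  qed
qed

text \<open>Smoothness is a greatest fixed point: it suffices to exhibit a set of differentiable
  functions that is closed under partial derivatives. This spares inductions over lists of
  directions.\<close>

lemma smooth_fun_coinduct:
  assumes "u \<in> S" and S: "\<And>v. v \<in> S \<Longrightarrow> (\<forall>y. v differentiable (at y)) \<and> (\<forall>i. pderiv_at i v \<in> S)"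
  shows "smooth_fun u"
proof -
  have "foldr pderiv_at is u \<in> S" for "is"
    by (induction "is") (use assms in auto)
  then show ?thesis
    using S unfolding smooth_fun_def differentiable_on_def by blast
qed

lemma smooth_fun_differentiable: "smooth_fun u \<Longrightarrow> u differentiable (at y)"
  by (simp add: smooth_fun_iff[of u])

lemma smooth_fun_pderiv: "smooth_fun u \<Longrightarrow> smooth_fun (pderiv_at i u)"
  by (subst (asm) smooth_fun_iff) auto

lemma smooth_fun_continuous: "smooth_fun u \<Longrightarrow> continuous_on UNIV u"
  by (simp add: continuous_at_imp_continuous_on differentiable_imp_continuous_within smooth_fun_differentiable)

lemma pderiv_at_eqI: "(u has_derivative D) (at y) \<Longrightarrow> pderiv_at i u y = D (axis i 1)"
  unfolding pderiv_at_def by (drule frechet_derivative_at) simp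

lemma pderiv_at_add:
  "u differentiable (at y) \<Longrightarrow> v differentiable (at y) \<Longrightarrow>
    pderiv_at i (\<lambda>y. u y + v y) y = pderiv_at i u y + pderiv_at i v y"
  unfolding frechet_derivative_works
  by (subst pderiv_at_eqI, rule has_derivative_add, assumption, assumption) (simp add: pderiv_at_def)

lemma pderiv_at_mult:
  "u differentiable (at y) \<Longrightarrow> v differentiable (at y) \<Longrightarrow>
    pderiv_at i (\<lambda>y. u y * v y) y = u y * pderiv_at i v y + pderiv_at i u y * v y"
  unfolding frechet_derivative_works
  by (subst pderiv_at_eqI, rule has_derivative_mult, assumption, assumption) (simp add: pderiv_at_def)

lemma pderiv_at_const [simp]: "pderiv_at i (\<lambda>y. c) = (\<lambda>y. 0)"
  by (rule ext) (simp add: pderiv_at_eqI[OF has_derivative_const])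

lemma pderiv_at_cmult:
  assumes "u differentiable (at y)"
  shows "pderiv_at i (\<lambda>y. c * u y) y = c * pderiv_at i u y"
  using pderiv_at_mult[of "\<lambda>_. c" y u i] assms by simp

lemma has_derivative_affine_compose:
  assumes "u differentiable (at (b + c *\<^sub>R y))"
  shows "((\<lambda>y. u (b + c *\<^sub>R y)) has_derivative (\<lambda>h. frechet_derivative u (at (b + c *\<^sub>R y)) (c *\<^sub>R h))) (at y)"
  by (rule has_derivative_compose[where f="\<lambda>y. b + c *\<^sub>R y" and g=u])
    (use assms in \<open>auto intro!: derivative_eq_intros simp: frechet_derivative_works[symmetric]\<close>)

lemma pderiv_at_affine_compose:
  assumes "u differentiable (at (b + c *\<^sub>R y))"
  shows "pderiv_at i (\<lambda>y. u (b + c *\<^sub>R y)) y = of_real c * pderiv_at i u (b + c *\<^sub>R y)"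
proof -
  interpret linear "frechet_derivative u (at (b + c *\<^sub>R y))"
    using assms by (simp add: linear_frechet_derivative)
  show ?thesis
    by (subst pderiv_at_eqI[OF has_derivative_affine_compose[OF assms]])
      (simp only: pderiv_at_def scaleR scaleR_conv_of_real[where 'a=complex])
qed

text \<open>The sums of products of functions from a set; if the partial derivatives of the functions
  in \<open>A\<close> are of this form, then iterating shows that all these functions are smooth.\<close>

inductive_set fun_algebra :: "(real^3 \<Rightarrow> complex) set \<Rightarrow> (real^3 \<Rightarrow> complex) set"
  for A where
  base: "u \<in> A \<Longrightarrow> u \<in> fun_algebra A"
| add: "u \<in> fun_algebra A \<Longrightarrow> v \<in> fun_algebra A \<Longrightarrow> (\<lambda>y. u y + v y) \<in> fun_algebra A"
| mult: "u \<in> fun_algebra A \<Longrightarrow> v \<in> fun_algebra A \<Longrightarrow> (\<lambda>y. u y * v y) \<in> fun_algebra A"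

lemma smooth_fun_algebra:
  assumes A: "\<And>a y. a \<in> A \<Longrightarrow> a differentiable (at y)"
    "\<And>a i. a \<in> A \<Longrightarrow> pderiv_at i a \<in> fun_algebra A"
    and "u \<in> fun_algebra A"
  shows "smooth_fun u"
proof (rule smooth_fun_coinduct[where S="fun_algebra A"])
  show "(\<forall>y. v differentiable (at y)) \<and> (\<forall>i. pderiv_at i v \<in> fun_algebra A)" if "v \<in> fun_algebra A" for v
    using that
  proof induction
    case (base u)
    then show ?case using A by auto
  next
    case (add u v)
    have "pderiv_at i (\<lambda>y. u y + v y) = (\<lambda>y. pderiv_at i u y + pderiv_at i v y)" for i
      using add by (intro ext pderiv_at_add) auto
    moreover have "(\<lambda>y. pderiv_at i u y + pderiv_at i v y) \<in> fun_algebra A" for i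
      by (intro fun_algebra.add) (use add in auto)
    ultimately show ?case using add by auto
  next
    case (mult u v)
    have "pderiv_at i (\<lambda>y. u y * v y) = (\<lambda>y. u y * pderiv_at i v y + pderiv_at i u y * v y)" for i
      using mult by (intro ext pderiv_at_mult) auto
    moreover have "(\<lambda>y. u y * pderiv_at i v y + pderiv_at i u y * v y) \<in> fun_algebra A" for i
      by (intro fun_algebra.add fun_algebra.mult) (use mult in auto)
    ultimately show ?case using mult by auto
  qed
qed fact

lemma smooth_fun_const [simp]: "smooth_fun (\<lambda>_. c)"
  by (rule smooth_fun_coinduct[where S="range (\<lambda>c _. c)"]) auto

lemma smooth_fun_add: "smooth_fun u \<Longrightarrow> smooth_fun v \<Longrightarrow> smooth_fun (\<lambda>y. u y + v y)"
  by (rule smooth_fun_algebra[where A="Collect smooth_fun"])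
    (auto intro: fun_algebra.intros smooth_fun_differentiable smooth_fun_pderiv)

lemma smooth_fun_mult: "smooth_fun u \<Longrightarrow> smooth_fun v \<Longrightarrow> smooth_fun (\<lambda>y. u y * v y)"
  by (rule smooth_fun_algebra[where A="Collect smooth_fun"])
    (auto intro: fun_algebra.intros smooth_fun_differentiable smooth_fun_pderiv)

lemma smooth_fun_prod:
  "(\<And>j. j \<in> J \<Longrightarrow> smooth_fun (u j)) \<Longrightarrow> smooth_fun (\<lambda>y. \<Prod>j\<in>J. u j y)"
  by (induction J rule: infinite_finite_induct) (auto intro: smooth_fun_mult)

lemma smooth_fun_affine_compose:
  assumes "smooth_fun u"
  shows "smooth_fun (\<lambda>y. u (b + c *\<^sub>R y))"
proof (rule smooth_fun_coinduct[where S="{\<lambda>y. a * u (b + c *\<^sub>R y) | a u. smooth_fun u}"])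
  show "(\<lambda>y. u (b + c *\<^sub>R y)) \<in> {\<lambda>y. a * u (b + c *\<^sub>R y) | a u. smooth_fun u}"
    using assms by (auto intro!: exI[of _ 1] exI[of _ u])
  fix v assume "v \<in> {\<lambda>y. a * u (b + c *\<^sub>R y) | a u. smooth_fun u}"
  then obtain a u where v: "v = (\<lambda>y. a * u (b + c *\<^sub>R y))" and u: "smooth_fun u" by auto
  have diff: "(\<lambda>y. u (b + c *\<^sub>R y)) differentiable (at y)" for y
    using has_derivative_affine_compose smooth_fun_differentiable[OF u] differentiableI by blast
  have "pderiv_at i v = (\<lambda>y. (a * of_real c) * pderiv_at i u (b + c *\<^sub>R y))" for i
    unfolding v
    by (rule ext) (simp add: pderiv_at_cmult[OF diff] pderiv_at_affine_compose smooth_fun_differentiable[OF u])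
  moreover have "v differentiable (at y)" for y
    unfolding v by (intro differentiable_mult differentiable_const diff)
  ultimately show "(\<forall>y. v differentiable (at y)) \<and> (\<forall>i. pderiv_at i v \<in> {\<lambda>y. a * u (b + c *\<^sub>R y) | a u. smooth_fun u})"
    using smooth_fun_pderiv[OF u] by blast
qed

lemma has_derivative_exp_complex:
  fixes u :: "real^3 \<Rightarrow> complex"
  assumes "(u has_derivative D) (at y)"
  shows "((\<lambda>y. exp (u y)) has_derivative (\<lambda>h. exp (u y) * D h)) (at y)"
  using has_derivative_compose[OF assms, of exp "\<lambda>h. exp (u y) * h"] DERIV_exp[of "u y"]
  by (simp add: has_field_derivative_def)

text \<open>A partial derivative of an exponential is the same exponential times a smooth function,
  so it stays in the algebra generated by the smooth functions and their exponentials.\<close>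

lemma smooth_fun_exp:
  assumes "smooth_fun u"
  shows "smooth_fun (\<lambda>y. exp (u y))"
proof (rule smooth_fun_algebra[where A="Collect smooth_fun \<union> {\<lambda>y. exp (u y) | u. smooth_fun u}"])
  let ?A = "Collect smooth_fun \<union> {\<lambda>y. exp (u y) | u. smooth_fun u}"
  show "(\<lambda>y. exp (u y)) \<in> fun_algebra ?A"
    using assms by (intro fun_algebra.base) auto
  have D: "((\<lambda>y. exp (v y)) has_derivative (\<lambda>h. exp (v y) * frechet_derivative v (at y) h)) (at y)"
    if "smooth_fun v" for v y
    using smooth_fun_differentiable[OF that] unfolding frechet_derivative_works
    by (rule has_derivative_exp_complex)
  then show "a differentiable (at y)" if "a \<in> ?A" for a y
    using that by (auto intro: smooth_fun_differentiable differentiableI)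
  show "pderiv_at i a \<in> fun_algebra ?A" if a: "a \<in> ?A" for a i
  proof (cases "smooth_fun a")
    case True
    then show ?thesis by (intro fun_algebra.base) (auto intro: smooth_fun_pderiv)
  next
    case False
    then obtain v where v: "a = (\<lambda>y. exp (v y))" "smooth_fun v" using a by auto
    have "pderiv_at i a = (\<lambda>y. exp (v y) * pderiv_at i v y)"
      unfolding v by (rule ext, subst pderiv_at_eqI[OF D[OF v(2)]]) (simp add: pderiv_at_def)
    then show ?thesis
      using v(2) smooth_fun_pderiv[OF v(2), of i] by (auto intro!: fun_algebra.mult intro: fun_algebra.base)
  qed
qed

lemma has_derivative_coord: "((\<lambda>y::real^3. y $ j) has_derivative (\<lambda>h. h $ j)) F"
  by (rule bounded_linear_imp_has_derivative[OF bounded_linear_vec_nth])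

lemma smooth_fun_coord: "smooth_fun (\<lambda>y. of_real (a * y $ j))"
proof (subst smooth_fun_iff, intro conjI allI)
  have D: "((\<lambda>y::real^3. complex_of_real (a * y $ j)) has_derivative (\<lambda>h. of_real (a * h $ j))) (at y)" for y
    by (auto intro!: derivative_eq_intros has_derivative_coord)
  then show "(\<lambda>y::real^3. complex_of_real (a * y $ j)) differentiable (at y)" for y
    by (rule differentiableI)
  have "pderiv_at i (\<lambda>y::real^3. complex_of_real (a * y $ j)) = (\<lambda>y. of_real (a * axis i 1 $ j))" for i
    by (rule ext, subst pderiv_at_eqI[OF D]) simp
  then show "smooth_fun (pderiv_at i (\<lambda>y::real^3. complex_of_real (a * y $ j)))" for i
    by simp
qed

section \<open>Smooth bump functions\<close>

text \<open>For \<open>n = 0\<close> this is the standard function that is flat at 0. The powers of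
  \<open>t\<close> in the denominator make the family closed under differentiation, up to linear
  combinations.\<close>

definition flat_exp :: "nat \<Rightarrow> real \<Rightarrow> real" where
  "flat_exp n t = (if t \<le> 0 then 0 else exp (- (1 / t)) / t ^ n)"

lemma flat_exp_tendsto_0: "(flat_exp n \<longlongrightarrow> 0) (at 0)"
proof (rule filterlim_split_at)
  show "(flat_exp n \<longlongrightarrow> 0) (at_left 0)"
    by (rule Lim_transform_eventually[OF tendsto_const])
      (auto simp: eventually_at_filter flat_exp_def)
  have "((\<lambda>t::real. inverse t ^ n / exp (inverse t)) \<longlongrightarrow> 0) (at_right 0)"
    by (rule filterlim_compose[OF tendsto_power_div_exp_0 filterlim_inverse_at_top_right])
  then show "(flat_exp n \<longlongrightarrow> 0) (at_right 0)"
    by (rule Lim_transform_eventually)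
      (auto simp: eventually_at_filter flat_exp_def exp_minus field_simps)
qed

lemma DERIV_flat_exp:
  "(flat_exp n has_real_derivative (- real n * flat_exp (n + 1) t + flat_exp (n + 2) t)) (at t)"
proof -
  consider "t < 0" | "t = 0" | "t > 0" by linarith
  then show ?thesis
  proof cases
    case 1
    have "((\<lambda>_. 0) has_real_derivative 0) (at t)" by simp
    moreover have "\<forall>\<^sub>F x in nhds t. flat_exp n x = 0"
      using eventually_nhds_in_open[of "{..<0}" t] 1 by (auto elim!: eventually_mono simp: flat_exp_def)
    ultimately have "(flat_exp n has_real_derivative 0) (at t)"
      by (subst DERIV_cong_ev[OF refl _ refl])
    then show ?thesis using 1 by (simp add: flat_exp_def)
  next
    case 2
    \<comment> \<open>The difference quotient at 0 is \<open>flat_exp (n + 1)\<close>, so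
      differentiability at 0 is the limit already proved for the next exponent.\<close>
    have "((\<lambda>h. (flat_exp n (0 + h) - flat_exp n 0) / h) \<longlongrightarrow> 0) (at 0)"
      by (rule Lim_transform_eventually[OF flat_exp_tendsto_0[of "n + 1"]])
        (auto simp: eventually_at_filter flat_exp_def)
    then show ?thesis using 2 by (simp add: DERIV_def flat_exp_def)
  next
    case 3
    have "((\<lambda>t. exp (- (1 / t)) / t ^ n) has_real_derivative
        (exp (- (1 / t)) * (1 / t\<^sup>2) * t ^ n - exp (- (1 / t)) * (real n * t ^ (n - 1))) / (t ^ n * t ^ n)) (at t)"
      using 3 by (auto intro!: derivative_eq_intros simp: power2_eq_square)
    also have "(exp (- (1 / t)) * (1 / t\<^sup>2) * t ^ n - exp (- (1 / t)) * (real n * t ^ (n - 1))) / (t ^ n * t ^ n)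
        = - real n * flat_exp (n + 1) t + flat_exp (n + 2) t"
      using 3 by (cases n) (auto simp: flat_exp_def field_simps power2_eq_square)
    finally have "((\<lambda>t. exp (- (1 / t)) / t ^ n) has_real_derivative - real n * flat_exp (n + 1) t + flat_exp (n + 2) t) (at t)" .
    moreover have "\<forall>\<^sub>F x in nhds t. flat_exp n x = exp (- (1 / x)) / x ^ n"
      using eventually_nhds_in_open[of "{0<..}" t] 3 by (auto elim!: eventually_mono simp: flat_exp_def)
    ultimately show ?thesis
      by (subst DERIV_cong_ev[OF refl _ refl])
  qed
qed

lemma smooth_fun_flat_exp: "smooth_fun (\<lambda>y. of_real (flat_exp n (a * y $ j + b)))"
proof (rule smooth_fun_algebra[where A="range (\<lambda>c _. c) \<union> range (\<lambda>n y. of_real (flat_exp n (a * y $ j + b)))"])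
  let ?A = "range (\<lambda>c _. c) \<union> range (\<lambda>n (y::real^3). complex_of_real (flat_exp n (a * y $ j + b)))"
  show "(\<lambda>y. of_real (flat_exp n (a * y $ j + b))) \<in> fun_algebra ?A"
    by (intro fun_algebra.base) auto
  have D: "((\<lambda>y::real^3. complex_of_real (flat_exp n (a * y $ j + b))) has_derivative
      (\<lambda>h. of_real ((a * h $ j) * (- real n * flat_exp (n + 1) (a * y $ j + b) + flat_exp (n + 2) (a * y $ j + b))))) (at y)"
    for n y
  proof -
    have "((\<lambda>y::real^3. a * y $ j + b) has_derivative (\<lambda>h. a * h $ j)) (at y)"
      by (auto intro!: derivative_eq_intros has_derivative_coord)
    from DERIV_compose_FDERIV[OF DERIV_flat_exp this] show ?thesis
      by (rule has_derivative_of_real)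
  qed
  then show "u differentiable (at y)" if "u \<in> ?A" for u y
    using that by (auto intro: differentiableI)
  have "(\<lambda>y. of_real (a * axis i 1 $ j * - real n) * of_real (flat_exp (n + 1) (a * y $ j + b))
      + of_real (a * axis i 1 $ j) * of_real (flat_exp (n + 2) (a * y $ j + b))) \<in> fun_algebra ?A" for n i
    by (intro fun_algebra.add fun_algebra.mult) (auto intro: fun_algebra.base)
  moreover have "pderiv_at i (\<lambda>y. complex_of_real (flat_exp n (a * y $ j + b))) =
     (\<lambda>y. of_real (a * axis i 1 $ j * - real n) * of_real (flat_exp (n + 1) (a * y $ j + b))
      + of_real (a * axis i 1 $ j) * of_real (flat_exp (n + 2) (a * y $ j + b)))" for n i
    by (rule ext, subst pderiv_at_eqI[OF D]) (simp add: algebra_simps)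
  ultimately have E: "pderiv_at i (\<lambda>y. complex_of_real (flat_exp n (a * y $ j + b))) \<in> fun_algebra ?A" for n i
    by simp
  show "pderiv_at i u \<in> fun_algebra ?A" if "u \<in> ?A" for u i
    using that E by (auto intro: fun_algebra.base)
qed

text \<open>The bump lives on a box rather than a ball because boxes are closed under intersection
  and generate the Borel sets, as the fundamental lemma below requires.\<close>

definition box_bump :: "real^3 \<Rightarrow> real^3 \<Rightarrow> real^3 \<Rightarrow> real" where
  "box_bump a b y = (\<Prod>j\<in>UNIV. flat_exp 0 (y $ j - a $ j) * flat_exp 0 (b $ j - y $ j))"

lemma smooth_fun_box_bump: "smooth_fun (\<lambda>y. of_real (box_bump a b y))"
proof -
  have "smooth_fun (\<lambda>y. \<Prod>j\<in>UNIV. of_real (flat_exp 0 (1 * y $ j + - a $ j)) * of_real (flat_exp 0 ((-1) * y $ j + b $ j)))"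
    by (intro smooth_fun_prod smooth_fun_mult smooth_fun_flat_exp)
  then show ?thesis
    by (simp add: box_bump_def)
qed

lemma box_bump_nonneg: "box_bump a b y \<ge> 0"
  by (auto simp: box_bump_def flat_exp_def intro!: prod_nonneg)

lemma box_bump_pos_iff: "box_bump a b y > 0 \<longleftrightarrow> y \<in> box a b"
proof -
  have "box_bump a b y > 0 \<longleftrightarrow> box_bump a b y \<noteq> 0"
    using box_bump_nonneg[of a b y] by linarith
  also have "\<dots> \<longleftrightarrow> y \<in> box a b"
  proof -
    have "flat_exp 0 t = 0 \<longleftrightarrow> \<not> 0 < t" for t by (auto simp: flat_exp_def)
    then show ?thesis by (auto simp: box_bump_def mem_box_cart)
  qed
  finally show ?thesis .
qed

lemma box_bump_eq_0: "y \<notin> box a b \<Longrightarrow> box_bump a b y = 0"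
  using box_bump_pos_iff[of a b y] box_bump_nonneg[of a b y] by linarith

section \<open>Test functions\<close>

text \<open>Vanishing outside a ball passes through sums, derivatives and substitutions more easily
  than compactness of the closed support. The two agree because the closure of a bounded set is
  compact in R^3.\<close>

lemma test_function_iff: "test_function \<phi> \<longleftrightarrow> smooth_fun \<phi> \<and> (\<exists>R. \<forall>y. norm y > R \<longrightarrow> \<phi> y = 0)"
proof
  assume t: "test_function \<phi>"
  then have "bounded (closure {y. \<phi> y \<noteq> 0})"
    by (auto simp: test_function_def intro: compact_imp_bounded)
  then obtain R where R: "\<forall>y\<in>closure {y. \<phi> y \<noteq> 0}. norm y \<le> R"
    by (auto simp: bounded_iff)
  have "\<phi> y = 0" if "norm y > R" for y
    using R[rule_format, of y] that closure_subset[of "{y. \<phi> y \<noteq> 0}"] by auto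
  with t show "smooth_fun \<phi> \<and> (\<exists>R. \<forall>y. norm y > R \<longrightarrow> \<phi> y = 0)"
    by (auto simp: test_function_def smooth_fun_def)
next
  assume R: "smooth_fun \<phi> \<and> (\<exists>R. \<forall>y. norm y > R \<longrightarrow> \<phi> y = 0)"
  then obtain R where R': "\<And>y. norm y > R \<Longrightarrow> \<phi> y = 0" by blast
  have "{y. \<phi> y \<noteq> 0} \<subseteq> cball 0 R"
    using R' by (force simp: not_less)
  then have "bounded {y. \<phi> y \<noteq> 0}"
    using bounded_cball bounded_subset by blast
  then show "test_function \<phi>"
    using R by (auto simp: test_function_def smooth_fun_def compact_closure)
qed

lemma test_function_smooth: "test_function \<phi> \<Longrightarrow> smooth_fun \<phi>"
  by (simp add: test_function_iff)

lemma test_function_support: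
  assumes "test_function \<phi>" obtains R where "\<And>y. norm y > R \<Longrightarrow> \<phi> y = 0"
  using assms unfolding test_function_iff by blast

lemma pderiv_at_eq_0:
  assumes "\<And>y. norm y > R \<Longrightarrow> u y = 0" "norm y > R"
  shows "pderiv_at i u y = 0"
proof -
  have "(u has_derivative (\<lambda>_. 0)) (at y)"
  proof (rule has_derivative_transform_within_open)
    show "((\<lambda>_. 0) has_derivative (\<lambda>_. 0)) (at y)" by simp
    show "open (- cball (0::real^3) R)" by auto
    show "y \<in> - cball 0 R" using assms(2) by auto
    show "0 = u x" if "x \<in> - cball 0 R" for x using assms(1)[of x] that by (simp add: not_le)
  qed
  then show ?thesis by (simp add: pderiv_at_eqI)
qed

lemma test_function_pderiv:
  assumes "test_function \<phi>" shows "test_function (pderiv_at i \<phi>)"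
proof -
  obtain R where "\<And>y. norm y > R \<Longrightarrow> \<phi> y = 0" using assms by (metis test_function_support)
  then have "\<forall>y. norm y > R \<longrightarrow> pderiv_at i \<phi> y = 0" using pderiv_at_eq_0[of R \<phi>] by blast
  then show ?thesis
    using assms by (auto simp: test_function_iff intro: smooth_fun_pderiv)
qed

lemma test_function_mult:
  assumes "smooth_fun u" "test_function \<phi>" shows "test_function (\<lambda>y. u y * \<phi> y)"
  using assms by (auto simp: test_function_iff intro: smooth_fun_mult)

lemma test_function_cmult: "test_function \<phi> \<Longrightarrow> test_function (\<lambda>y. c * \<phi> y)"
  by (rule test_function_mult) auto

lemma test_function_add:
  assumes "test_function \<phi>" "test_function \<psi>" shows "test_function (\<lambda>y. \<phi> y + \<psi> y)"
proof -
  obtain R where R: "\<And>y. norm y > R \<Longrightarrow> \<phi> y = 0" using assms(1) by (metis test_function_support)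
  obtain R' where R': "\<And>y. norm y > R' \<Longrightarrow> \<psi> y = 0" using assms(2) by (metis test_function_support)
  have "\<forall>y. norm y > max R R' \<longrightarrow> \<phi> y + \<psi> y = 0" using R R' by simp
  then show ?thesis using assms unfolding test_function_iff by (blast intro: smooth_fun_add)
qed

lemma test_function_affine_compose:
  assumes "test_function \<phi>" "c > 0"
  shows "test_function (\<lambda>y. \<phi> (b + c *\<^sub>R y))"
proof -
  obtain R where R: "\<And>y. norm y > R \<Longrightarrow> \<phi> y = 0" using assms(1) by (metis test_function_support)
  have "\<phi> (b + c *\<^sub>R y) = 0" if "norm y > (R + norm b) / c" for y
  proof (rule R)
    have "R + norm b < norm (c *\<^sub>R y)" using that assms(2) by (simp add: field_simps)
    then show "R < norm (b + c *\<^sub>R y)" using norm_diff_ineq[of "c *\<^sub>R y" b] by (simp add: add.commute)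
  qed
  then show ?thesis using assms by (auto simp: test_function_iff intro: smooth_fun_affine_compose)
qed

lemma integrable_continuous_support:
  fixes f :: "real^3 \<Rightarrow> 'b::{banach, second_countable_topology}"
  assumes "continuous_on UNIV f" "\<And>y. norm y > R \<Longrightarrow> f y = 0"
  shows "integrable lborel f"
proof -
  have "f = (\<lambda>y. indicator (cball 0 R) y *\<^sub>R f y)"
    using assms(2) by (auto simp: fun_eq_iff indicator_def not_le)
  moreover have "integrable lborel (\<lambda>y. indicator (cball 0 R) y *\<^sub>R f y)"
    by (rule borel_integrable_compact) (auto intro: continuous_on_subset[OF assms(1)])
  ultimately show ?thesis by simp
qed

lemma bounded_continuous_support:
  fixes f :: "real^3 \<Rightarrow> complex"
  assumes "continuous_on UNIV f" "\<And>y. norm y > R \<Longrightarrow> f y = 0"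
  obtains B where "B \<ge> 0" "\<And>y. norm (f y) \<le> B"
proof -
  have "bounded (f ` cball 0 R)"
    by (intro compact_imp_bounded compact_continuous_image continuous_on_subset[OF assms(1)]) auto
  then obtain B where B: "\<forall>y\<in>cball 0 R. norm (f y) \<le> B" by (auto simp: bounded_iff)
  have "norm (f y) \<le> max 0 B" for y
    using B assms(2)[of y] by (cases "norm y \<le> R") (auto simp: le_max_iff_disj)
  then show ?thesis by (intro that[of "max 0 B"]) auto
qed

lemma test_function_continuous: "test_function \<phi> \<Longrightarrow> continuous_on UNIV \<phi>"
  by (simp add: smooth_fun_continuous test_function_smooth)

lemma test_function_measurable [measurable_dest]: "test_function \<phi> \<Longrightarrow> \<phi> \<in> borel_measurable borel"
  by (intro borel_measurable_continuous_onI test_function_continuous)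

lemma test_function_bounded:
  assumes "test_function \<phi>" obtains B where "B \<ge> 0" "\<And>y. norm (\<phi> y) \<le> B"
  using assms by (metis test_function_support bounded_continuous_support test_function_continuous)

lemma test_function_integrable: "test_function \<phi> \<Longrightarrow> integrable lborel \<phi>"
  by (metis test_function_support integrable_continuous_support test_function_continuous)

lemma test_function_sq_integrable:
  assumes "test_function \<phi>" shows "sq_integrable \<phi>"
proof -
  obtain R where "\<And>y. norm y > R \<Longrightarrow> \<phi> y = 0" using assms by (metis test_function_support)
  then have "integrable lborel (\<lambda>y. (cmod (\<phi> y))\<^sup>2)"
    by (intro integrable_continuous_support[where R=R] continuous_intros test_function_continuous assms) auto
  then show ?thesis using assms by (auto simp: sq_integrable_def intro: test_function_measurable)
qed

section \<open>Affine substitutions in Lebesgue integrals\<close>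

lemma lborel_integral_affine:
  fixes f :: "real^3 \<Rightarrow> 'b::{banach, second_countable_topology}"
  assumes [measurable]: "f \<in> borel_measurable borel" and "c \<noteq> 0"
  shows "integral\<^sup>L lborel f = \<bar>c\<bar> ^ 3 *\<^sub>R (LBINT y. f (b + c *\<^sub>R y))"
proof -
  have "integral\<^sup>L lborel f = integral\<^sup>L (density (distr lborel borel (\<lambda>x. b + c *\<^sub>R x)) (\<lambda>_. ennreal (\<bar>c\<bar> ^ 3))) f"
    using lborel_affine[OF assms(2), of b] by (simp add: ennreal_power)
  also have "\<dots> = \<bar>c\<bar> ^ 3 *\<^sub>R (LBINT y. f (b + c *\<^sub>R y))"
    by (subst integral_density) (auto simp: integral_distr)
  finally show ?thesis .
qed

lemma lborel_nn_integral_affine: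
  fixes f :: "real^3 \<Rightarrow> ennreal"
  assumes [measurable]: "f \<in> borel_measurable borel" and "c \<noteq> 0"
  shows "(\<integral>\<^sup>+y. f y \<partial>lborel) = ennreal (\<bar>c\<bar> ^ 3) * (\<integral>\<^sup>+y. f (b + c *\<^sub>R y) \<partial>lborel)"
proof -
  have "(\<integral>\<^sup>+y. f y \<partial>lborel) = (\<integral>\<^sup>+y. f y \<partial>density (distr lborel borel (\<lambda>x. b + c *\<^sub>R x)) (\<lambda>_. ennreal (\<bar>c\<bar> ^ 3)))"
    using lborel_affine[OF assms(2), of b] by (simp add: ennreal_power)
  also have "\<dots> = ennreal (\<bar>c\<bar> ^ 3) * (\<integral>\<^sup>+y. f (b + c *\<^sub>R y) \<partial>lborel)"
    by (subst nn_integral_density) (auto simp: nn_integral_distr nn_integral_cmult)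
  finally show ?thesis .
qed

lemma lborel_integrable_affine:
  fixes f :: "real^3 \<Rightarrow> 'b::{banach, second_countable_topology}"
  assumes f: "integrable lborel f" and "c \<noteq> 0"
  shows "integrable lborel (\<lambda>y. f (b + c *\<^sub>R y))"
proof -
  have [measurable]: "f \<in> borel_measurable borel" using f by auto
  have "integrable (density (distr lborel borel (\<lambda>x. b + c *\<^sub>R x)) (\<lambda>_. ennreal (\<bar>c\<bar> ^ 3))) f"
    using lborel_affine[OF assms(2), of b] f by (simp add: ennreal_power)
  then have "integrable lborel (\<lambda>y. \<bar>c\<bar> ^ 3 *\<^sub>R f (b + c *\<^sub>R y))"
    by (subst (asm) integrable_density) (auto simp: integrable_distr_eq)
  then have "integrable lborel (\<lambda>y. inverse (\<bar>c\<bar> ^ 3) *\<^sub>R (\<bar>c\<bar> ^ 3 *\<^sub>R f (b + c *\<^sub>R y)))"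
    by (rule integrable_scaleR_right)
  then show ?thesis using assms(2) by simp
qed

lemma lborel_integral_translate:
  fixes f :: "real^3 \<Rightarrow> 'b::{banach, second_countable_topology}"
  assumes "f \<in> borel_measurable borel"
  shows "(LBINT y. f (b + y)) = integral\<^sup>L lborel f"
  using lborel_integral_affine[OF assms, of 1 b] by simp

section \<open>Integration by parts\<close>

text \<open>By translation invariance every difference quotient of \<open>w\<close> has integral 0.
  The mean value inequality bounds the quotients by the supremum \<open>B\<close> of the derivative,
  so the limit passes under the integral.\<close>

lemma integral_pderiv_eq_0:
  assumes dw: "\<And>y. w differentiable (at y)"
    and cont: "continuous_on UNIV (pderiv_at i w)"
    and supp: "\<And>y. norm y > R \<Longrightarrow> w y = 0"
  shows "integral\<^sup>L lborel (pderiv_at i w) = 0"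
proof -
  define e :: "real^3" where "e = axis i 1"
  have e: "norm e = 1" by (simp add: e_def)
  define h where "h n = 1 / real (Suc n)" for n
  have h: "0 < h n" "h n \<le> 1" for n by (auto simp: h_def)
  have h0: "h \<longlonglongrightarrow> 0" unfolding h_def by real_asymp
  define q where "q n y = (w (h n *\<^sub>R e + y) - w y) / of_real (h n)" for n y
  have contw: "continuous_on UNIV w"
    by (simp add: continuous_at_imp_continuous_on differentiable_imp_continuous_within dw)
  obtain B where B: "B \<ge> 0" "\<And>y. norm (pderiv_at i w y) \<le> B"
    using bounded_continuous_support[OF cont, of R] pderiv_at_eq_0[of R w] supp by blast
  have intw: "integrable lborel w"
    by (rule integrable_continuous_support[OF contw supp])
  have q0: "integral\<^sup>L lborel (q n) = 0" for n
    unfolding q_def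
    using intw lborel_integrable_affine[OF intw, of 1 "h n *\<^sub>R e"]
    by (simp add: lborel_integral_translate borel_measurable_continuous_onI[OF contw])
  have D: "((\<lambda>t. w (y + t *\<^sub>R e)) has_derivative (\<lambda>s. of_real s * pderiv_at i w (y + t *\<^sub>R e))) (at t)" for y t
  proof -
    interpret linear "frechet_derivative w (at (y + t *\<^sub>R e))"
      using dw by (simp add: linear_frechet_derivative)
    have "((\<lambda>t. w (y + t *\<^sub>R e)) has_derivative (\<lambda>s. frechet_derivative w (at (y + t *\<^sub>R e)) (s *\<^sub>R e))) (at t)"
      by (rule has_derivative_compose[where f="\<lambda>t. y + t *\<^sub>R e" and g=w])
        (use dw in \<open>auto intro!: derivative_eq_intros simp: frechet_derivative_works[symmetric]\<close>)
    then show ?thesis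
      by (simp only: scaleR pderiv_at_def e_def[symmetric] scaleR_conv_of_real[where 'a=complex])
  qed
  have "(\<lambda>n. integral\<^sup>L lborel (q n)) \<longlonglongrightarrow> integral\<^sup>L lborel (pderiv_at i w)"
  \<comment> \<open>The step widths \<open>h n\<close> are at most 1, so all quotients vanish
    outside the ball of radius \<open>R + 1\<close>.\<close>
  proof (rule integral_dominated_convergence[where w="\<lambda>y. B * indicator (cball 0 (R + 1)) y"])
    show "pderiv_at i w \<in> borel_measurable lborel"
      using cont by (simp add: borel_measurable_continuous_onI)
    have [measurable]: "w \<in> borel_measurable borel"
      using contw by (rule borel_measurable_continuous_onI)
    show "q n \<in> borel_measurable lborel" for n
      unfolding q_def by measurable
    show "integrable lborel (\<lambda>y::real^3. B * indicator (cball 0 (R + 1)) y)"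
      using emeasure_bounded_finite[OF bounded_cball, of "0::real^3" "R + 1"]
      by (intro integrable_mult_right integrable_real_indicator) auto
    show "AE y in lborel. (\<lambda>n. q n y) \<longlonglongrightarrow> pderiv_at i w y"
    proof (rule AE_I2)
      fix y
      have "((\<lambda>s. norm (w (y + s *\<^sub>R e) - w y - of_real s * pderiv_at i w y) / norm s) \<longlongrightarrow> 0) (at 0)"
        using D[of y 0] by (simp add: has_derivative_at)
      moreover have "filterlim h (at 0) sequentially"
        using h h0 by (auto simp: filterlim_at less_imp_neq[symmetric])
      ultimately have "(\<lambda>n. norm (w (y + h n *\<^sub>R e) - w y - of_real (h n) * pderiv_at i w y) / norm (h n)) \<longlonglongrightarrow> 0"
        by (rule filterlim_compose)
      moreover have "norm (w (y + h n *\<^sub>R e) - w y - of_real (h n) * pderiv_at i w y) / norm (h n) =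
          norm (q n y - pderiv_at i w y)" for n
      proof -
        have "q n y - pderiv_at i w y = (w (y + h n *\<^sub>R e) - w y - of_real (h n) * pderiv_at i w y) / of_real (h n)"
          using h(1)[of n] by (simp add: q_def field_simps)
        then show ?thesis by (simp add: norm_divide)
      qed
      ultimately show "(\<lambda>n. q n y) \<longlonglongrightarrow> pderiv_at i w y"
        by (simp add: tendsto_norm_zero_iff LIM_zero_iff)
    qed
    show "AE y in lborel. norm (q n y) \<le> B * indicator (cball 0 (R + 1)) y" for n
    proof (rule AE_I2)
      fix y
      show "norm (q n y) \<le> B * indicator (cball 0 (R + 1)) y"
      proof (cases "norm y \<le> R + 1")
        case True
        have "norm (w (y + h n *\<^sub>R e) - w (y + 0 *\<^sub>R e)) \<le> B * norm (h n - 0)"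
        proof (rule differentiable_bound[where S=UNIV and f'="\<lambda>t s. of_real s * pderiv_at i w (y + t *\<^sub>R e)"])
          show "onorm (\<lambda>s. of_real s * pderiv_at i w (y + t *\<^sub>R e)) \<le> B" for t
            using B by (intro onorm_le) (auto simp: norm_mult mult.commute[of B] intro!: mult_left_mono)
        qed (use D in auto)
        then have "norm (q n y) \<le> B"
          using h(1)[of n] by (simp add: q_def norm_divide divide_le_eq add.commute)
        then show ?thesis using True by (simp add: indicator_def)
      next
        case False
        have "norm (h n *\<^sub>R e + y) \<ge> norm y - h n"
          using norm_diff_ineq[of y "h n *\<^sub>R e"] e h(1)[of n] by (simp add: add.commute)
        then have "norm (h n *\<^sub>R e + y) > R" using False h(2)[of n] by linarith
        then have "q n y = 0" using False by (simp add: q_def supp)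
        then show ?thesis using B by simp
      qed
    qed
  qed
  then show ?thesis
    using q0 by (simp add: LIMSEQ_const_iff)
qed

lemma integration_by_parts:
  assumes diff: "\<And>y. u differentiable (at y)"
    and cont: "continuous_on UNIV (pderiv_at i u)"
    and \<phi>: "test_function \<phi>"
  shows "(LBINT y. u y * pderiv_at i \<phi> y) = - (LBINT y. pderiv_at i u y * \<phi> y)"
proof -
  obtain R where R: "\<And>y. norm y > R \<Longrightarrow> \<phi> y = 0" using \<phi> by (metis test_function_support)
  have contu: "continuous_on UNIV u"
    by (simp add: continuous_at_imp_continuous_on differentiable_imp_continuous_within diff)
  have eq: "pderiv_at i (\<lambda>y. u y * \<phi> y) = (\<lambda>y. u y * pderiv_at i \<phi> y + pderiv_at i u y * \<phi> y)"
    using diff \<phi> by (intro ext pderiv_at_mult) (auto intro: smooth_fun_differentiable test_function_smooth)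
  have cont\<phi>: "continuous_on UNIV \<phi>" "continuous_on UNIV (pderiv_at i \<phi>)"
    using \<phi> by (auto intro: test_function_continuous test_function_pderiv)
  have "integral\<^sup>L lborel (pderiv_at i (\<lambda>y. u y * \<phi> y)) = 0"
  proof (rule integral_pderiv_eq_0)
    show "(\<lambda>y. u y * \<phi> y) differentiable (at y)" for y
      using diff \<phi> by (intro differentiable_mult) (auto intro: smooth_fun_differentiable test_function_smooth)
    show "continuous_on UNIV (pderiv_at i (\<lambda>y. u y * \<phi> y))"
      unfolding eq by (intro continuous_intros contu cont cont\<phi>)
    show "u y * \<phi> y = 0" if "norm y > R" for y using R that by simp
  qed
  moreover have "integrable lborel (\<lambda>y. u y * pderiv_at i \<phi> y)" "integrable lborel (\<lambda>y. pderiv_at i u y * \<phi> y)"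
    by (rule integrable_continuous_support[where R=R], intro continuous_intros contu cont cont\<phi>,
        simp add: R pderiv_at_eq_0[where R=R])+
  ultimately show ?thesis
    unfolding eq by (simp add: eq_neg_iff_add_eq_0)
qed

section \<open>The fundamental lemma of the calculus of variations\<close>

text \<open>For \<open>c = - n\<close> and a nonnegative bump these functions increase, as
  \<open>n\<close> grows, to the indicator of the set where the bump is positive. This is how
  indicators of boxes are reached by test functions.\<close>

lemma exp_test_function:
  assumes "test_function \<phi>"
  shows "test_function (\<lambda>y. 1 - exp (c * \<phi> y))"
proof -
  have "smooth_fun (\<lambda>y. 1 + (-1) * exp (c * \<phi> y))"
    using assms by (intro smooth_fun_add smooth_fun_mult smooth_fun_const smooth_fun_exp test_function_smooth)
  moreover obtain R where R: "\<And>y. norm y > R \<Longrightarrow> \<phi> y = 0" using assms by (metis test_function_support)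
  then have "\<forall>y. norm y > R \<longrightarrow> 1 - exp (c * \<phi> y) = 0" by simp
  ultimately show ?thesis unfolding test_function_iff by auto
qed

lemma test_function_box_bump: "test_function (\<lambda>y. of_real (box_bump a b y))"
proof -
  obtain R where R: "box a b \<subseteq> ball 0 R"
    using bounded_subset_ballD[OF bounded_box] by blast
  have "box_bump a b y = 0" if "norm y > R" for y
    using R that by (intro box_bump_eq_0) force
  then show ?thesis by (auto simp: test_function_iff smooth_fun_box_bump)
qed

lemma complex_norm_mult_le: "norm (a * b :: complex) \<le> (norm a)\<^sup>2 + (norm b)\<^sup>2"
proof -
  have "2 * (norm a * norm b) \<le> (norm a)\<^sup>2 + (norm b)\<^sup>2"
    using sum_squares_bound[of "norm a" "norm b"] by simp
  moreover have "0 \<le> norm a * norm b" by simp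
  ultimately show ?thesis unfolding norm_mult by linarith
qed

lemma sq_integrable_mult_integrable:
  assumes "sq_integrable u" "sq_integrable v"
  shows "integrable lborel (\<lambda>y. u y * v y)"
proof -
  have [measurable]: "u \<in> borel_measurable borel" "v \<in> borel_measurable borel"
    using assms by (auto simp: sq_integrable_def)
  have "integrable lborel (\<lambda>y. (cmod (u y))\<^sup>2 + (cmod (v y))\<^sup>2)"
    using assms by (simp add: sq_integrable_def)
  then show ?thesis
    by (rule Bochner_Integration.integrable_bound) (auto intro!: AE_I2 complex_norm_mult_le order_trans[OF _ abs_ge_self])
qed

lemma sq_integrable_indicator_box: "sq_integrable (\<lambda>y. indicator (box a b) y)"
proof -
  have "(\<lambda>y. (cmod (indicator (box a b) y))\<^sup>2) = indicator (box a b)"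
    by (auto simp: fun_eq_iff indicator_def)
  then show ?thesis
    using emeasure_bounded_finite[OF bounded_box, of a b]
    by (auto simp: sq_integrable_def intro!: integrable_real_indicator)
qed

text \<open>Dominated convergence along 1 - exp(-n bump) shows that the integral of \<open>w\<close>
  over every box vanishes. Since boxes form an intersection-stable generator, this extends to all
  Borel sets, and a function whose integrals over all Borel sets vanish is zero almost
  everywhere.\<close>

theorem fundamental_lemma_calculus_of_variations:
  assumes w: "sq_integrable w"
    and 0: "\<And>\<phi>. test_function \<phi> \<Longrightarrow> (LBINT y. w y * \<phi> y) = 0"
  shows "AE y in lborel. w y = 0"
proof -
  have [measurable]: "w \<in> borel_measurable borel" using w by (simp add: sq_integrable_def)
  have int_box: "integrable lborel (\<lambda>y. indicator (box a b) y *\<^sub>R w y)" for a b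
  proof -
    have "(\<lambda>y. indicator (box a b) y *\<^sub>R w y) = (\<lambda>y. indicator (box a b) y * w y)"
      by (auto simp: fun_eq_iff indicator_def)
    then show ?thesis
      using sq_integrable_mult_integrable[OF sq_integrable_indicator_box[of a b] w] by simp
  qed
  have box: "(LBINT y. indicator (box a b) y *\<^sub>R w y) = 0" for a b
  proof -
    define \<psi> where "\<psi> n y = 1 - exp (- of_nat n * complex_of_real (box_bump a b y))" for n y
    have \<psi>: "test_function (\<psi> n)" for n
      unfolding \<psi>_def by (intro exp_test_function test_function_box_bump)
    have \<psi>_real: "\<psi> n y = of_real (1 - exp (- real n * box_bump a b y))" for n y
      by (simp add: \<psi>_def exp_of_real[symmetric])
    have "(\<lambda>n. (LBINT y. w y * \<psi> n y)) \<longlonglongrightarrow> (LBINT y. indicator (box a b) y *\<^sub>R w y)"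
    proof (rule integral_dominated_convergence[where w="\<lambda>y. norm (indicator (box a b) y *\<^sub>R w y)"])
      show "(\<lambda>y. w y * \<psi> n y) \<in> borel_measurable lborel" for n
        using test_function_measurable[OF \<psi>[of n]] by simp
      show "AE y in lborel. (\<lambda>n. w y * \<psi> n y) \<longlonglongrightarrow> indicator (box a b) y *\<^sub>R w y"
      proof (rule AE_I2)
        fix y
        show "(\<lambda>n. w y * \<psi> n y) \<longlonglongrightarrow> indicator (box a b) y *\<^sub>R w y"
        proof (cases "y \<in> box a b")
          case True
          define t where "t = box_bump a b y"
          have t: "t > 0" using True by (simp add: t_def box_bump_pos_iff)
          have "(\<lambda>n. 1 - exp (- real n * t)) \<longlonglongrightarrow> 1" using t by real_asymp
          then have "(\<lambda>n. w y * of_real (1 - exp (- real n * t))) \<longlonglongrightarrow> w y * of_real 1"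
            by (intro tendsto_intros)
          then show ?thesis using True by (simp add: \<psi>_real t_def)
        next
          case False
          then show ?thesis by (simp add: \<psi>_real box_bump_eq_0)
        qed
      qed
      show "AE y in lborel. norm (w y * \<psi> n y) \<le> norm (indicator (box a b) y *\<^sub>R w y)" for n
      proof (rule AE_I2)
        fix y
        have "\<bar>1 - exp (- real n * box_bump a b y)\<bar> \<le> 1"
        proof -
          have "exp (- real n * box_bump a b y) \<le> 1" by (simp add: box_bump_nonneg)
          moreover have "exp (- real n * box_bump a b y) > 0" by simp
          ultimately show ?thesis by linarith
        qed
        then have "norm (\<psi> n y) \<le> 1" unfolding \<psi>_real norm_of_real .
        then show "norm (w y * \<psi> n y) \<le> norm (indicator (box a b) y *\<^sub>R w y)"
          using box_bump_eq_0[of y a b]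
          by (cases "y \<in> box a b") (auto simp: norm_mult mult_left_le \<psi>_def)
      qed
      show "integrable lborel (\<lambda>y. norm (indicator (box a b) y *\<^sub>R w y))"
        using int_box by (rule integrable_norm)
    qed auto
    then show ?thesis using 0[OF \<psi>] by (simp add: LIMSEQ_const_iff)
  qed
  \<comment> \<open>\<open>w\<close> itself is only square integrable. Its restriction to a box is
    integrable, which the passage to complements and countable unions requires; countably many boxes
    then exhaust the space.\<close>
  have "AE y in lborel. indicator (box (- (\<chi> i. real N)) (\<chi> i. real N)) y *\<^sub>R w y = 0" for N
  proof (rule sigma_finite_measure.density_zero[OF sigma_finite_lborel])
    define f where "f = (\<lambda>y. indicator (box (- (\<chi> i. real N)) (\<chi> i. real N)) y *\<^sub>R w y)"
    show "integrable lborel (\<lambda>y. indicator (box (- (\<chi> i. real N)) (\<chi> i. real N)) y *\<^sub>R w y)"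
      by (rule int_box)
    then have f: "integrable lborel f" by (simp add: f_def)
    let ?G = "range (\<lambda>(a, b). box a b :: (real^3) set)"
    have sets: "sets (lborel :: (real^3) measure) = sigma_sets UNIV ?G"
      by (simp add: borel_eq_box)
    fix A assume "A \<in> sets (lborel :: (real^3) measure)"
    then have A: "A \<in> sigma_sets UNIV ?G" by (simp only: sets)
    have st: "Int_stable ?G" by (auto simp: Int_stable_def box_Int_box)
    have sub: "?G \<subseteq> Pow UNIV" by simp
    show "(LINT y:A|lborel. indicator (box (- (\<chi> i. real N)) (\<chi> i. real N)) y *\<^sub>R w y) = 0"
      unfolding f_def[symmetric] using st sub A
    proof (induction rule: sigma_sets_induct_disjoint)
      case (basic A)
      then obtain a b where "A = box a b" by auto
      then obtain c d where "A \<inter> box (- (\<chi> i. real N)) (\<chi> i. real N) = box c d"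
        by (auto simp: box_Int_box)
      then have "indicator A y *\<^sub>R f y = indicator (box c d) y *\<^sub>R w y" for y
        by (auto simp: f_def indicator_def set_eq_iff)
      then show ?case using box[of c d] by (simp add: set_lebesgue_integral_def)
    next
      case (compl A)
      then have [measurable]: "A \<in> sets borel" by (simp add: sets[symmetric])
      have fi: "set_integrable lborel A f" "set_integrable lborel (UNIV - A) f"
        using f by (auto simp: set_integrable_def intro!: integrable_mult_indicator)
      have "(LINT y:A \<union> (UNIV - A)|lborel. f y) = (LINT y:A|lborel. f y) + (LINT y:UNIV - A|lborel. f y)"
        by (rule set_integral_Un) (use fi in auto)
      moreover have "(LINT y:A \<union> (UNIV - A)|lborel. f y) = 0"
        using box by (simp add: set_lebesgue_integral_def f_def)
      ultimately show ?case using compl by simp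
    next
      case (union A)
      then have m: "A i \<in> sets borel" for i by (auto simp: sets[symmetric])
      have "(LINT y:(\<Union>i. A i)|lborel. f y) = (\<Sum>i. (LINT y:(A i)|lborel. f y))"
      proof (rule lebesgue_integral_countable_add)
        show "set_integrable lborel (\<Union>i. A i) f"
          using f m by (auto simp: set_integrable_def intro!: integrable_mult_indicator)
      qed (use m union in \<open>auto simp: disjoint_family_on_def\<close>)
      then show ?case using union by simp
    qed (auto simp: set_lebesgue_integral_def)
  qed
  then have "AE y in lborel. \<forall>N. indicator (box (- (\<chi> i. real N)) (\<chi> i. real N)) y *\<^sub>R w y = 0"
    unfolding AE_all_countable by blast
  then show ?thesis
  proof eventually_elim
    case (elim y)
    obtain N where N: "norm y < real N" using reals_Archimedean2 by blast
    have "\<bar>y $ i\<bar> < real N" for i using component_le_norm_cart[of y i] N by simp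
    then have "y \<in> box (- (\<chi> i. real N)) (\<chi> i. real N)"
      by (auto simp: mem_box_cart abs_less_iff) (smt (verit))+
    with elim[rule_format, of N] show ?case by simp
  qed
qed

section \<open>Convolution with the Green function\<close>

lemma sq_integrable_affine:
  assumes "sq_integrable u" "c \<noteq> 0"
  shows "sq_integrable (\<lambda>y. u (b + c *\<^sub>R y))"
proof -
  have [measurable]: "u \<in> borel_measurable borel" using assms by (simp add: sq_integrable_def)
  show ?thesis
    using assms lborel_integrable_affine[of "\<lambda>y. (cmod (u y))\<^sup>2" c b] by (simp add: sq_integrable_def)
qed

lemma sq_integrable_translate: "sq_integrable u \<Longrightarrow> sq_integrable (\<lambda>y. u (y - b))"
  using sq_integrable_affine[of u 1 "- b"] by simp

lemma sq_integrable_reflect: "sq_integrable u \<Longrightarrow> sq_integrable (\<lambda>y. u (b - y))"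
  using sq_integrable_affine[of u "-1" b] by simp

text \<open>The case distinction in \<open>G_tilde\<close> is redundant, since division by zero yields zero.\<close>

lemma G_tilde_eq: "G_tilde k y = exp (\<i> * k * of_real (norm y)) / (4 * of_real pi * of_real (norm y))"
  by (simp add: G_tilde_def)

lemma norm_exp_ik: "norm (exp (\<i> * k * of_real r)) = exp (- Im k * r)"
  by (simp add: norm_exp_eq_Re)

lemma norm_G_tilde: "norm (G_tilde k y) = exp (- Im k * norm y) / (4 * pi * norm y)"
  unfolding G_tilde_eq norm_divide norm_exp_ik by (simp add: norm_mult)

lemma G_tilde_measurable [measurable]: "G_tilde k \<in> borel_measurable borel"
  unfolding G_tilde_eq[abs_def] by measurable

lemma G_tilde_minus [simp]: "G_tilde k (- y) = G_tilde k y"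
  by (simp add: G_tilde_def)

lemma G_tilde_commute: "G_tilde k (y - s) = G_tilde k (s - y)"
  using G_tilde_minus[of k "s - y"] by simp

lemma G_tilde_integrable:
  assumes "Im k > 0" shows "integrable lborel (G_tilde k)"
proof (rule Bochner_Integration.integrable_bound)
  show "integrable lborel (\<lambda>y::real^3. exp (- Im k * norm y) / norm y * (1 / (4 * pi)))"
    by (intro integrable_mult_left integrable_exp_div_norm assms)
qed (auto simp: norm_G_tilde mult_ac)

lemma G_tilde_sq_integrable:
  assumes "Im k > 0" shows "sq_integrable (G_tilde k)"
proof -
  have "(cmod (G_tilde k y))\<^sup>2 = exp (- (2 * Im k) * norm y) / (norm y)\<^sup>2 * (1 / (4 * pi)\<^sup>2)" for y
    by (simp add: norm_G_tilde power_divide power_mult_distrib exp_double[symmetric] mult_ac)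
  moreover have "integrable lborel (\<lambda>y::real^3. exp (- (2 * Im k) * norm y) / (norm y)\<^sup>2 * (1 / (4 * pi)\<^sup>2))"
    using assms by (intro integrable_mult_left integrable_exp_div_norm_sq) simp
  ultimately show ?thesis by (simp add: sq_integrable_def)
qed

section \<open>Convolution with the Green function as an operator on L^2\<close>

text \<open>On L^2 this is the resolvent of the free Hamiltonian at \<open>k\<^sup>2\<close>. For
  \<open>Im k > 0\<close> the integral pairs two square integrable functions, so the value is
  meaningful at every \<open>y\<close> and not only almost everywhere.\<close>

definition green_conv :: "complex \<Rightarrow> (real^3 \<Rightarrow> complex) \<Rightarrow> real^3 \<Rightarrow> complex" where
  "green_conv k u y = (LBINT s. G_tilde k (y - s) * u s)"

lemma integrable_green_conv:
  assumes "Im k > 0" "sq_integrable u"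
  shows "integrable lborel (\<lambda>s. G_tilde k (y - s) * u s)"
  by (intro sq_integrable_mult_integrable sq_integrable_reflect G_tilde_sq_integrable assms)

lemma green_conv_lincomb:
  assumes "Im k > 0" "sq_integrable u" "sq_integrable v"
  shows "green_conv k (\<lambda>y. a * u y + b * v y) y = a * green_conv k u y + b * green_conv k v y"
proof -
  have "green_conv k (\<lambda>y. a * u y + b * v y) y =
      (LBINT s. a * (G_tilde k (y - s) * u s) + b * (G_tilde k (y - s) * v s))"
    unfolding green_conv_def by (simp add: algebra_simps)
  also have "\<dots> = a * green_conv k u y + b * green_conv k v y"
    unfolding green_conv_def
    by (subst Bochner_Integration.integral_add) (auto intro!: integrable_green_conv assms)
  finally show ?thesis .
qed

lemma green_conv_cong_AE:
  assumes "sq_integrable u" "sq_integrable v" "AE y in lborel. u y = v y"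
  shows "green_conv k u = green_conv k v"
proof
  have [measurable]: "u \<in> borel_measurable borel" "v \<in> borel_measurable borel"
    using assms by (simp_all add: sq_integrable_def)
  show "green_conv k u y = green_conv k v y" for y
    unfolding green_conv_def using assms(3) by (intro integral_cong_AE) (auto elim: eventually_mono)
qed

lemma green_conv_measurable:
  assumes "sq_integrable u"
  shows "green_conv k u \<in> borel_measurable borel"
proof -
  have [measurable]: "u \<in> borel_measurable borel" using assms by (simp add: sq_integrable_def)
  show ?thesis unfolding green_conv_def[abs_def] by measurable
qed

lemma green_conv_swap:
  assumes [measurable]: "u \<in> borel_measurable borel"
  shows "green_conv k u y = (LBINT s. G_tilde k s * u (y - s))"
  unfolding green_conv_def
  by (subst lborel_integral_affine[where c="-1" and b=y]) simp_all

text \<open>The pairing with a convolution becomes an average, weighted by \<open>G_tilde k\<close>,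
  of pairings with translates. Hence identities that hold against all translates pass to the
  convolution. Fubini applies since the inner integrals are bounded uniformly in \<open>s\<close>
  and the weight is in L^1.\<close>

lemma integral_mult_green_conv:
  assumes k: "Im k > 0" and u: "sq_integrable u" and v: "sq_integrable v"
  shows "(LBINT y. u y * green_conv k v y) =
    (LBINT s. G_tilde k s * (LBINT y. u y * v (y - s)))"
proof -
  have [measurable]: "u \<in> borel_measurable borel" "v \<in> borel_measurable borel"
    using u v by (simp_all add: sq_integrable_def)
  define f where "f s y = G_tilde k s * (u y * v (y - s))" for s y
  have uv: "integrable lborel (\<lambda>y. u y * v (y - s))" for s
    by (intro sq_integrable_mult_integrable u sq_integrable_translate v)
  have bound: "(LBINT y. norm (u y * v (y - s))) \<le>
      (LBINT y. (cmod (u y))\<^sup>2) + (LBINT y. (cmod (v y))\<^sup>2)" for s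
  proof -
    have iv: "integrable lborel (\<lambda>y. (cmod (v (y - s)))\<^sup>2)"
      using sq_integrable_translate[OF v] by (simp add: sq_integrable_def)
    have iu: "integrable lborel (\<lambda>y. (cmod (u y))\<^sup>2)" using u by (simp add: sq_integrable_def)
    have "(LBINT y. norm (u y * v (y - s))) \<le>
        (LBINT y. (cmod (u y))\<^sup>2 + (cmod (v (y - s)))\<^sup>2)"
      using uv iu iv by (intro integral_mono) (auto intro: complex_norm_mult_le)
    also have "\<dots> = (LBINT y. (cmod (u y))\<^sup>2) + (LBINT y. (cmod (v (y - s)))\<^sup>2)"
      using iu iv by simp
    also have "(LBINT y. (cmod (v (y - s)))\<^sup>2) = (LBINT y. (cmod (v y))\<^sup>2)"
      using lborel_integral_translate[of "\<lambda>y. (cmod (v y))\<^sup>2" "- s"] by simp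
    finally show ?thesis .
  qed
  have "integrable (lborel \<Otimes>\<^sub>M lborel) (case_prod f)"
  proof (rule lborel_pair.Fubini_integrable)
    show "case_prod f \<in> borel_measurable (lborel \<Otimes>\<^sub>M lborel)"
      unfolding f_def by measurable
    show "AE s in lborel. integrable lborel (\<lambda>y. case_prod f (s, y))"
      using uv by (auto simp: f_def)
    show "integrable lborel (\<lambda>s. (LBINT y. norm (case_prod f (s, y))))"
    proof (rule Bochner_Integration.integrable_bound)
      show "integrable lborel (\<lambda>s. norm (G_tilde k s) *
          ((LBINT y. (cmod (u y))\<^sup>2) + (LBINT y. (cmod (v y))\<^sup>2)))"
        by (intro integrable_mult_left integrable_norm G_tilde_integrable k)
      show "(\<lambda>s. (LBINT y. norm (case_prod f (s, y)))) \<in> borel_measurable lborel"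
        unfolding f_def by measurable
      show "AE s in lborel. norm ((LBINT y. norm (case_prod f (s, y)))) \<le>
         norm (norm (G_tilde k s) *
          ((LBINT y. (cmod (u y))\<^sup>2) + (LBINT y. (cmod (v y))\<^sup>2)))"
      proof (rule AE_I2)
        fix s
        have "norm ((LBINT y. norm (case_prod f (s, y)))) =
            norm (G_tilde k s) * (LBINT y. norm (u y * v (y - s)))"
          by (simp add: f_def norm_mult[of "G_tilde k s"] del: norm_mult)
        also have "\<dots> \<le> norm (G_tilde k s) *
          ((LBINT y. (cmod (u y))\<^sup>2) + (LBINT y. (cmod (v y))\<^sup>2))"
          by (intro mult_left_mono bound) simp
        finally show "norm ((LBINT y. norm (case_prod f (s, y)))) \<le>
          norm (norm (G_tilde k s) *
          ((LBINT y. (cmod (u y))\<^sup>2) + (LBINT y. (cmod (v y))\<^sup>2)))"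
          by (rule order_trans) simp
      qed
    qed
  qed
  from lborel_pair.Fubini_integral[OF this]
  have "(\<integral>y. (\<integral>s. f s y \<partial>lborel) \<partial>lborel) = (\<integral>s. (\<integral>y. f s y \<partial>lborel) \<partial>lborel)" .
  moreover have "(\<integral>s. f s y \<partial>lborel) = u y * green_conv k v y" for y
  proof -
    have "(\<integral>s. f s y \<partial>lborel) = (\<integral>s. u y * (G_tilde k s * v (y - s)) \<partial>lborel)"
      by (simp add: f_def mult_ac)
    then show ?thesis by (simp add: green_conv_swap)
  qed
  moreover have "(\<integral>y. f s y \<partial>lborel) = G_tilde k s * (\<integral>y. u y * v (y - s) \<partial>lborel)" for s
    by (simp add: f_def)
  ultimately show ?thesis by simp
qed

text \<open>The pairing is bilinear, without conjugation. The kernel is even, and replacing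
  \<open>s\<close> by \<open>- s\<close> in the formula above exchanges the roles of
  \<open>u\<close> and \<open>v\<close>.\<close>

lemma green_conv_symmetric:
  assumes k: "Im k > 0" and u: "sq_integrable u" and v: "sq_integrable v"
  shows "(LBINT y. u y * green_conv k v y) = (LBINT y. green_conv k u y * v y)"
proof -
  have [measurable]: "u \<in> borel_measurable borel" "v \<in> borel_measurable borel"
    using u v by (simp_all add: sq_integrable_def)
  have "(\<integral>y. u y * v (y - - s) \<partial>lborel) = (\<integral>y. v y * u (y - s) \<partial>lborel)" for s
    using lborel_integral_translate[of "\<lambda>y. u y * v (y + s)" "- s"] by (simp add: mult.commute add.commute)
  moreover have "(\<integral>s. G_tilde k s * (\<integral>y. u y * v (y - s) \<partial>lborel) \<partial>lborel) =
     (\<integral>s. G_tilde k (0 + (-1) *\<^sub>R s) * (\<integral>y. u y * v (y - (0 + (-1) *\<^sub>R s)) \<partial>lborel) \<partial>lborel)"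
    by (subst lborel_integral_affine[where c="-1" and b=0]) simp_all
  ultimately have "(\<integral>s. G_tilde k s * (\<integral>y. u y * v (y - s) \<partial>lborel) \<partial>lborel) =
     (\<integral>s. G_tilde k s * (\<integral>y. v y * u (y - s) \<partial>lborel) \<partial>lborel)"
    by simp
  then show ?thesis
    unfolding integral_mult_green_conv[OF k u v] using integral_mult_green_conv[OF k v u]
    by (simp add: mult.commute)
qed

text \<open>Young's inequality for L^1 and L^2. The modulus of the kernel is split into two square
  roots, and Cauchy-Schwarz bounds |G * u|^2 by the L^1 norm of G times |G| * |u|^2; Tonelli then
  yields the second factor. The estimate later serves as the bound on the resolvent.\<close>

lemma green_conv_young:
  assumes k: "Im k > 0" and u: "sq_integrable u"
  shows "sq_integrable (green_conv k u)"
    and "(LBINT y. (cmod (green_conv k u y))\<^sup>2) \<le>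
      ((LBINT y. norm (G_tilde k y)))\<^sup>2 * (LBINT y. (cmod (u y))\<^sup>2)"
proof -
  have [measurable]: "u \<in> borel_measurable borel" using u by (simp add: sq_integrable_def)
  note [measurable] = green_conv_measurable[OF u]
  define N where "N = (LBINT y. norm (G_tilde k y))"
  define U where "U = (LBINT y. (cmod (u y))\<^sup>2)"
  have NU: "N \<ge> 0" "U \<ge> 0" by (simp_all add: N_def U_def)
  have N: "(\<integral>\<^sup>+s. ennreal (norm (G_tilde k s)) \<partial>lborel) = ennreal N"
    unfolding N_def by (rule nn_integral_eq_integral) (auto intro: G_tilde_integrable k)
  have N': "(\<integral>\<^sup>+s. ennreal (norm (G_tilde k (y - s))) \<partial>lborel) = ennreal N" for y
    using lborel_nn_integral_affine[of "\<lambda>s. ennreal (norm (G_tilde k s))" "-1" y] N by simp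
  have N'': "(\<integral>\<^sup>+y. ennreal (norm (G_tilde k (y - s))) \<partial>lborel) = ennreal N" for s
    using lborel_nn_integral_affine[of "\<lambda>s. ennreal (norm (G_tilde k s))" 1 "- s"] N by simp
  have U: "(\<integral>\<^sup>+s. ennreal ((cmod (u s))\<^sup>2) \<partial>lborel) = ennreal U"
    unfolding U_def by (rule nn_integral_eq_integral) (use u in \<open>auto simp: sq_integrable_def\<close>)
  have point: "ennreal ((cmod (green_conv k u y))\<^sup>2) \<le>
      ennreal N * (\<integral>\<^sup>+s. ennreal (norm (G_tilde k (y - s)) * (cmod (u s))\<^sup>2) \<partial>lborel)" for y
  proof -
    let ?g = "\<lambda>s. norm (G_tilde k (y - s))"
    have "ennreal (cmod (green_conv k u y)) \<le> (\<integral>\<^sup>+s. ennreal (norm (G_tilde k (y - s) * u s)) \<partial>lborel)"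
      unfolding green_conv_def by (rule integral_norm_bound_ennreal) (rule integrable_green_conv[OF k u])
    also have "\<dots> = (\<integral>\<^sup>+s. ennreal (sqrt (?g s)) * ennreal (sqrt (?g s) * cmod (u s)) \<partial>lborel)"
      by (simp add: norm_mult ennreal_mult[symmetric] mult.assoc[symmetric])
    finally have "(ennreal (cmod (green_conv k u y)))\<^sup>2 \<le> (\<dots>)\<^sup>2"
      by (rule power_mono) simp
    also have "\<dots> \<le> (\<integral>\<^sup>+s. (ennreal (sqrt (?g s)))\<^sup>2 \<partial>lborel) * (\<integral>\<^sup>+s. (ennreal (sqrt (?g s) * cmod (u s)))\<^sup>2 \<partial>lborel)"
      by (rule Cauchy_Schwarz_nn_integral) simp_all
    also have "(\<integral>\<^sup>+s. (ennreal (sqrt (?g s)))\<^sup>2 \<partial>lborel) = ennreal N"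
      using N'[of y] by (simp add: ennreal_power)
    also have "(\<integral>\<^sup>+s. (ennreal (sqrt (?g s) * cmod (u s)))\<^sup>2 \<partial>lborel) = (\<integral>\<^sup>+s. ennreal (?g s * (cmod (u s))\<^sup>2) \<partial>lborel)"
      by (simp add: ennreal_power power_mult_distrib)
    finally show ?thesis by (simp add: ennreal_power)
  qed
  have "(\<integral>\<^sup>+y. ennreal ((cmod (green_conv k u y))\<^sup>2) \<partial>lborel) \<le>
      (\<integral>\<^sup>+y. ennreal N * (\<integral>\<^sup>+s. ennreal (norm (G_tilde k (y - s)) * (cmod (u s))\<^sup>2) \<partial>lborel) \<partial>lborel)"
    by (rule nn_integral_mono) (rule point)
  also have "\<dots> = ennreal N * (\<integral>\<^sup>+y. (\<integral>\<^sup>+s. ennreal (norm (G_tilde k (y - s)) * (cmod (u s))\<^sup>2) \<partial>lborel) \<partial>lborel)"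
    by (rule nn_integral_cmult) measurable
  also have "(\<integral>\<^sup>+y. (\<integral>\<^sup>+s. ennreal (norm (G_tilde k (y - s)) * (cmod (u s))\<^sup>2) \<partial>lborel) \<partial>lborel) =
     (\<integral>\<^sup>+s. (\<integral>\<^sup>+y. ennreal (norm (G_tilde k (y - s)) * (cmod (u s))\<^sup>2) \<partial>lborel) \<partial>lborel)"
    by (rule lborel_pair.Fubini') measurable
  also have "\<dots> = (\<integral>\<^sup>+s. ennreal N * ennreal ((cmod (u s))\<^sup>2) \<partial>lborel)"
    by (intro nn_integral_cong) (simp add: ennreal_mult nn_integral_multc N'')
  also have "\<dots> = ennreal N * ennreal U"
    by (simp add: nn_integral_cmult U)
  finally have main: "(\<integral>\<^sup>+y. ennreal ((cmod (green_conv k u y))\<^sup>2) \<partial>lborel) \<le> ennreal (N\<^sup>2 * U)"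
    using NU by (simp add: ennreal_mult[symmetric] power2_eq_square mult.assoc)
  then have int: "integrable lborel (\<lambda>y. (cmod (green_conv k u y))\<^sup>2)"
    by (intro integrableI_nonneg) (auto intro: le_less_trans)
  then show "sq_integrable (green_conv k u)"
    by (simp add: sq_integrable_def)
  show "(LBINT y. (cmod (green_conv k u y))\<^sup>2) \<le> N\<^sup>2 * U"
    using main NU by (simp add: nn_integral_eq_integral[OF int])
qed

text \<open>The singularity of the kernel moves with \<open>y\<close> and rules out a common
  dominating function. With |y| + epsilon in the denominator the kernel is continuous and bounded,
  so dominated convergence gives continuity. These kernels converge to \<open>G_tilde k\<close> in
  L^2, hence the convolutions converge uniformly in \<open>y\<close>.\<close>

lemma green_conv_continuous:
  assumes k: "Im k > 0" and u: "sq_integrable u"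
  shows "continuous_on UNIV (green_conv k u)"
proof -
  have um [measurable]: "u \<in> borel_measurable borel" using u by (simp add: sq_integrable_def)
  define c where "c = Im k"
  have c: "c > 0" using k by (simp add: c_def)
  define \<epsilon> where "\<epsilon> n = 1 / real (Suc n)" for n
  have \<epsilon>: "\<epsilon> n > 0" for n by (simp add: \<epsilon>_def)
  have \<epsilon>0: "\<epsilon> \<longlonglongrightarrow> 0" unfolding \<epsilon>_def by real_asymp
  define g where "g n y = exp (\<i> * k * of_real (norm y)) / (4 * of_real pi * of_real (norm y + \<epsilon> n))" for n and y :: "real^3"
  have gm [measurable]: "g n \<in> borel_measurable borel" for n unfolding g_def by measurable
  have norm_g: "norm (g n y) = exp (- c * norm y) / (4 * pi * (norm y + \<epsilon> n))" for n y
    unfolding g_def norm_divide norm_exp_ik c_def using \<epsilon>[of n] by (simp add: norm_mult flip: of_real_add)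
  have norm_g_le: "norm (g n y) \<le> exp (- c * norm y) / (4 * pi * \<epsilon> n)" for n y
    unfolding norm_g using \<epsilon>[of n] by (intro divide_left_mono mult_pos_pos) (auto intro: add_nonneg_pos)
  have exp_sq: "sq_integrable (\<lambda>s::real^3. of_real (exp (- c * norm s)))"
  proof -
    have "(cmod (of_real (exp (- c * norm s))))\<^sup>2 = exp (- (2 * c) * norm s)" for s :: "real^3"
      by (simp add: exp_double[symmetric])
    moreover have "integrable lborel (\<lambda>s::real^3. exp (- (2 * c) * norm s))"
      using c by (intro integrable_exp_norm) simp
    ultimately show ?thesis by (simp add: sq_integrable_def)
  qed
  have ne: "complex_of_real (norm y + \<epsilon> n) \<noteq> 0" for y :: "real^3" and n
    unfolding of_real_eq_0_iff using \<epsilon>[of n] norm_ge_zero[of y] by linarith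
  have cont_g: "continuous_on UNIV (\<lambda>y. (LBINT s. g n (y - s) * u s))" for n
  proof (rule continuous_at_imp_continuous_on, rule ballI)
    fix y0 :: "real^3"
    show "isCont (\<lambda>y. (LBINT s. g n (y - s) * u s)) y0"
    proof (rule continuous_at_sequentiallyI)
      fix Y assume Y: "Y \<longlonglongrightarrow> y0"
      then obtain B where B: "\<And>j. norm (Y j) \<le> B"
        by (metis convergentI convergent_imp_Bseq BseqE)
      show "(\<lambda>j. (LBINT s. g n (Y j - s) * u s)) \<longlonglongrightarrow> (LBINT s. g n (y0 - s) * u s)"
      proof (rule integral_dominated_convergence[where w="\<lambda>s. exp (c * B) / (4 * pi * \<epsilon> n) * norm (of_real (exp (- c * norm s)) * u s)"])
        show "integrable lborel (\<lambda>s. exp (c * B) / (4 * pi * \<epsilon> n) * norm (of_real (exp (- c * norm s)) * u s))"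
          by (intro integrable_mult_right integrable_norm sq_integrable_mult_integrable exp_sq u)
        have gc: "isCont (g n) y" for y
          unfolding g_def using ne[of y n] by (intro continuous_intros) (simp del: of_real_add)
        show "AE s in lborel. (\<lambda>j. g n (Y j - s) * u s) \<longlonglongrightarrow> g n (y0 - s) * u s"
          by (intro AE_I2 tendsto_intros isCont_tendsto_compose[OF gc] Y)
        show "AE s in lborel. norm (g n (Y j - s) * u s) \<le> exp (c * B) / (4 * pi * \<epsilon> n) * norm (of_real (exp (- c * norm s)) * u s)" for j
        proof (rule AE_I2)
          fix s
          \<comment> \<open>A convergent sequence is bounded by some \<open>B\<close>, so the decay
            in \<open>Y j - s\<close> can be replaced by decay in \<open>s\<close> at the cost of
            the factor \<open>exp (c * B)\<close>, which does not depend on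
            \<open>j\<close>.\<close>
          have "norm s \<le> norm (Y j - s) + B"
            using norm_triangle_sub[of s "Y j"] B[of j] by (simp add: norm_minus_commute)
          then have "c * norm s \<le> c * (norm (Y j - s) + B)"
            using c by (intro mult_left_mono) auto
          then have "exp (- c * norm (Y j - s)) \<le> exp (c * B) * exp (- c * norm s)"
            by (simp add: exp_add[symmetric] algebra_simps)
          then have "norm (g n (Y j - s)) \<le> exp (c * B) * exp (- c * norm s) / (4 * pi * \<epsilon> n)"
            using \<epsilon>[of n] by (intro order_trans[OF norm_g_le] divide_right_mono) auto
          then have "norm (g n (Y j - s)) * norm (u s) \<le> exp (c * B) * exp (- c * norm s) / (4 * pi * \<epsilon> n) * norm (u s)"
            by (rule mult_right_mono) simp
          then show "norm (g n (Y j - s) * u s) \<le> exp (c * B) / (4 * pi * \<epsilon> n) * norm (of_real (exp (- c * norm s)) * u s)"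
            by (simp add: norm_mult)
        qed
      qed auto
    qed
  qed
  have G_g: "G_tilde k y - g n y = G_tilde k y * of_real (\<epsilon> n / (norm y + \<epsilon> n))" if "y \<noteq> 0" for n y
  proof -
    have "complex_of_real (norm y) \<noteq> 0" "complex_of_real (norm y) + of_real (\<epsilon> n) \<noteq> 0"
      using that ne[of y n] by auto
    moreover have "E / (4 * p * a) - E / (4 * p * w) = E / (4 * p * a) * ((w - a) / w)"
      if "a \<noteq> 0" "w \<noteq> 0" "p \<noteq> 0" for E p a w :: complex
      using that by (simp add: field_simps)
    ultimately show ?thesis by (simp add: G_tilde_eq g_def)
  qed
  have nz: "AE y::real^3 in lborel. y \<noteq> 0" by (rule AE_lborel_singleton)
  define D where "D n = (LBINT y. (cmod (G_tilde k y - g n y))\<^sup>2)" for n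
  have G2: "integrable lborel (\<lambda>y. (cmod (G_tilde k y))\<^sup>2)"
    using G_tilde_sq_integrable[OF k] by (simp add: sq_integrable_def)
  have bnd: "AE y in lborel. norm ((cmod (G_tilde k y - g n y))\<^sup>2) \<le> (cmod (G_tilde k y))\<^sup>2" for n
    using nz
  proof eventually_elim
    case (elim y)
    have "\<bar>\<epsilon> n / (norm y + \<epsilon> n)\<bar> \<le> 1" using elim \<epsilon>[of n] by (simp add: divide_le_eq add_pos_pos)
    then have "cmod (G_tilde k y - g n y) \<le> cmod (G_tilde k y)"
      by (simp only: G_g[OF elim] norm_mult norm_of_real mult_left_le norm_ge_zero)
    then show ?case by simp
  qed
  have D_int: "integrable lborel (\<lambda>y. (cmod (G_tilde k y - g n y))\<^sup>2)" for n
    by (rule Bochner_Integration.integrable_bound[OF G2]) (use bnd in auto)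
  have D0: "D \<longlonglongrightarrow> 0"
  proof -
    have "D \<longlonglongrightarrow> integral\<^sup>L lborel (\<lambda>y::real^3. 0::real)"
      unfolding D_def
    proof (rule integral_dominated_convergence[OF _ _ G2])
      show "AE y in lborel. (\<lambda>n. (cmod (G_tilde k y - g n y))\<^sup>2) \<longlonglongrightarrow> 0"
        using nz
      proof eventually_elim
        case (elim y)
        have "(\<lambda>n. \<epsilon> n / (norm y + \<epsilon> n)) \<longlonglongrightarrow> 0 / (norm y + 0)"
          using elim by (intro tendsto_intros \<epsilon>0) auto
        then have "(\<lambda>n. (cmod (G_tilde k y * of_real (\<epsilon> n / (norm y + \<epsilon> n))))\<^sup>2) \<longlonglongrightarrow> (cmod (G_tilde k y * of_real (0 / (norm y + 0))))\<^sup>2"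
          by (intro tendsto_power tendsto_norm tendsto_mult tendsto_const tendsto_of_real)
        then show ?case by (simp only: G_g[OF elim]) simp
      qed
    qed (use bnd in auto)
    then show ?thesis by simp
  qed
  have diff_sq: "sq_integrable (\<lambda>y. G_tilde k y - g n y)" for n
    using D_int[of n] by (simp add: sq_integrable_def)
  have g_sq: "sq_integrable (g n)" for n
    using sq_integrable_diff[OF G_tilde_sq_integrable[OF k] diff_sq[of n]] by simp
  define U where "U = (LBINT y. (cmod (u y))\<^sup>2)"
  have U: "U \<ge> 0" by (simp add: U_def)
  have U2: "integrable lborel (\<lambda>y. (cmod (u y))\<^sup>2)" using u by (simp add: sq_integrable_def)
  \<comment> \<open>This is Cauchy-Schwarz in additive form. The free parameter
    \<open>\<delta>\<close> is fixed first to make the term with \<open>U\<close> small; then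
    \<open>n\<close> makes the other term small, independently of \<open>y\<close>.\<close>
  have close: "dist ((LBINT s. g n (y - s) * u s)) (green_conv k u y) \<le> D n / \<delta> + \<delta> * U"
    if \<delta>: "\<delta> > 0" for n y \<delta>
  proof -
    have i: "integrable lborel (\<lambda>s. g n (y - s) * u s)"
      by (intro sq_integrable_mult_integrable sq_integrable_reflect g_sq u)
    have D': "integrable lborel (\<lambda>s. (cmod (G_tilde k (y - s) - g n (y - s)))\<^sup>2)"
      using sq_integrable_reflect[OF diff_sq[of n], of y] by (simp add: sq_integrable_def)
    have "dist ((LBINT s. g n (y - s) * u s)) (green_conv k u y) =
        norm ((LBINT s. (G_tilde k (y - s) - g n (y - s)) * u s))"
      unfolding green_conv_def dist_norm norm_minus_commute[of "(LBINT s. g n (y - s) * u s)"]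
      using i integrable_green_conv[OF k u, of y] by (simp add: left_diff_distrib)
    also have "\<dots> \<le> (LBINT s. norm ((G_tilde k (y - s) - g n (y - s)) * u s))"
      by (rule integral_norm_bound)
    also have "\<dots> \<le> (LBINT s. (cmod (G_tilde k (y - s) - g n (y - s)))\<^sup>2 / \<delta> + \<delta> * (cmod (u s))\<^sup>2)"
    proof (rule integral_mono)
      show "integrable lborel (\<lambda>s. norm ((G_tilde k (y - s) - g n (y - s)) * u s))"
        by (intro integrable_norm sq_integrable_mult_integrable u sq_integrable_reflect[OF diff_sq])
      show "integrable lborel (\<lambda>s. (cmod (G_tilde k (y - s) - g n (y - s)))\<^sup>2 / \<delta> + \<delta> * (cmod (u s))\<^sup>2)"
        using D' U2 by simp
      have AMGM: "p * q \<le> p\<^sup>2 / \<delta> + \<delta> * q\<^sup>2" if "p \<ge> 0" "q \<ge> 0" for p q :: real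
      proof -
        have "0 \<le> (p - \<delta> * q)\<^sup>2 + \<delta> * (p * q)" using that \<delta> by simp
        then have "\<delta> * (p * q) \<le> p\<^sup>2 + \<delta> * (\<delta> * q\<^sup>2)"
          by (simp add: power2_eq_square algebra_simps)
        then show ?thesis using \<delta> by (simp add: field_simps)
      qed
      show "norm ((G_tilde k (y - s) - g n (y - s)) * u s) \<le>
          (cmod (G_tilde k (y - s) - g n (y - s)))\<^sup>2 / \<delta> + \<delta> * (cmod (u s))\<^sup>2" for s
        unfolding norm_mult by (rule AMGM) auto
    qed
    also have "\<dots> = (LBINT s. (cmod (G_tilde k (y - s) - g n (y - s)))\<^sup>2) / \<delta> + \<delta> * U"
      using D' U2 by (simp add: U_def)
    also have "(LBINT s. (cmod (G_tilde k (y - s) - g n (y - s)))\<^sup>2) = D n"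
      unfolding D_def by (subst lborel_integral_affine[where c="-1" and b=y]) simp_all
    finally show ?thesis .
  qed
  have "uniform_limit UNIV (\<lambda>n y. (LBINT s. g n (y - s) * u s)) (green_conv k u) sequentially"
  proof (rule uniform_limitI)
    fix e :: real assume e: "e > 0"
    \<comment> \<open>The summand 1 keeps the denominator positive when \<open>u\<close> vanishes
      almost everywhere.\<close>
    define \<delta> where "\<delta> = e / (2 * (U + 1))"
    have \<delta>: "\<delta> > 0" using e U by (simp add: \<delta>_def)
    have "\<delta> * U \<le> \<delta> * (U + 1)" using \<delta> by simp
    also have "\<dots> = e / 2" using U by (simp add: \<delta>_def field_simps)
    finally have dU: "\<delta> * U \<le> e / 2" .
    have "(\<lambda>n. D n / \<delta>) \<longlonglongrightarrow> 0 / \<delta>"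
      using \<delta> by (intro tendsto_intros D0) auto
    then have "\<forall>\<^sub>F n in sequentially. D n / \<delta> < e / 2"
      by (rule order_tendstoD) (use e in auto)
    then show "\<forall>\<^sub>F n in sequentially. \<forall>y\<in>UNIV. dist ((LBINT s. g n (y - s) * u s)) (green_conv k u y) < e"
    proof eventually_elim
      case (elim n)
      show ?case
      proof
        fix y
        show "dist ((LBINT s. g n (y - s) * u s)) (green_conv k u y) < e"
          using close[OF \<delta>, of n y] elim dU by linarith
      qed
    qed
  qed
  then show ?thesis
    by (rule uniform_limit_theorem[rotated]) (use cont_g in auto)
qed

section \<open>Weak derivatives commute with convolution\<close>

text \<open>This is the condition in \<open>weak_pderiv\<close> for one fixed pair of
  representatives; \<open>weak_pderiv_iff\<close> shows that the choice of the pair does not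
  matter.\<close>

definition weak_pderiv_fun :: "3 \<Rightarrow> (real^3 \<Rightarrow> complex) \<Rightarrow> (real^3 \<Rightarrow> complex) \<Rightarrow> bool" where
  "weak_pderiv_fun i u v \<longleftrightarrow> (\<forall>\<phi>. test_function \<phi> \<longrightarrow>
     (LBINT y. u y * pderiv_at i \<phi> y) = - (LBINT y. v y * \<phi> y))"

lemma weak_pderiv_fun_smooth:
  assumes "smooth_fun u" shows "weak_pderiv_fun i u (pderiv_at i u)"
  unfolding weak_pderiv_fun_def using assms
  by (auto intro!: integration_by_parts smooth_fun_differentiable smooth_fun_continuous smooth_fun_pderiv)

text \<open>Translates of test functions are test functions, so the weak identity for
  \<open>u\<close> and \<open>v\<close> holds against every translate of \<open>\<phi>\<close>.
  Averaging over the translations with weight \<open>G_tilde k\<close> gives the identity for the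
  convolutions.\<close>

lemma weak_pderiv_fun_green_conv:
  assumes k: "Im k > 0" and u: "sq_integrable u" and v: "sq_integrable v"
    and w: "weak_pderiv_fun i u v"
  shows "weak_pderiv_fun i (green_conv k u) (green_conv k v)"
  unfolding weak_pderiv_fun_def
proof (intro allI impI)
  fix \<phi> assume \<phi>: "test_function \<phi>"
  have \<phi>': "test_function (pderiv_at i \<phi>)" using \<phi> by (rule test_function_pderiv)
  have "(\<integral>y. u y * pderiv_at i \<phi> (y - s) \<partial>lborel) = - (\<integral>y. v y * \<phi> (y - s) \<partial>lborel)" for s
  proof -
    have "test_function (\<lambda>y. \<phi> (- s + 1 *\<^sub>R y))" using \<phi> by (intro test_function_affine_compose) auto
    moreover have "pderiv_at i (\<lambda>y. \<phi> (- s + 1 *\<^sub>R y)) y = 1 * pderiv_at i \<phi> (- s + 1 *\<^sub>R y)" for y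
      by (subst pderiv_at_affine_compose) (use \<phi> in \<open>auto intro: smooth_fun_differentiable test_function_smooth\<close>)
    ultimately show ?thesis
      using w[unfolded weak_pderiv_fun_def, rule_format, of "\<lambda>y. \<phi> (- s + 1 *\<^sub>R y)"] by simp
  qed
  then have "(\<integral>y. green_conv k u y * pderiv_at i \<phi> y \<partial>lborel) = - (\<integral>s. G_tilde k s * (\<integral>y. v y * \<phi> (y - s) \<partial>lborel) \<partial>lborel)"
    by (simp add: green_conv_symmetric[OF k u, symmetric] integral_mult_green_conv[OF k u] test_function_sq_integrable \<phi>')
  then show "(\<integral>y. green_conv k u y * pderiv_at i \<phi> y \<partial>lborel) = - (\<integral>y. green_conv k v y * \<phi> y \<partial>lborel)"
    by (simp add: green_conv_symmetric[OF k v, symmetric] integral_mult_green_conv[OF k v] test_function_sq_integrable \<phi>)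
qed

section \<open>The Green function inverts $-\Delta - k^2$ on test functions\<close>

definition lap :: "(real^3 \<Rightarrow> complex) \<Rightarrow> real^3 \<Rightarrow> complex" where
  "lap u y = (\<Sum>i\<in>UNIV. pderiv_at i (pderiv_at i u) y)"

lemma smooth_fun_sum:
  "(\<And>j. j \<in> J \<Longrightarrow> smooth_fun (u j)) \<Longrightarrow> smooth_fun (\<lambda>y. \<Sum>j\<in>J. u j y)"
  by (induction J rule: infinite_finite_induct) (auto intro: smooth_fun_add)

lemma test_function_sum:
  "(\<And>j. j \<in> J \<Longrightarrow> test_function (u j)) \<Longrightarrow> test_function (\<lambda>y. \<Sum>j\<in>J. u j y)"
proof (induction J rule: infinite_finite_induct)
  case (insert j J)
  then show ?case by (auto intro: test_function_add)
qed (auto simp: test_function_iff)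

lemma test_function_lap: "test_function \<phi> \<Longrightarrow> test_function (lap \<phi>)"
  unfolding lap_def by (intro test_function_sum test_function_pderiv)

lemma integral_lap_by_parts:
  assumes u: "smooth_fun u" and \<phi>: "test_function \<phi>"
  shows "(LBINT y. u y * lap \<phi> y) = (LBINT y. lap u y * \<phi> y)"
proof -
  have "(LBINT y. u y * pderiv_at i (pderiv_at i \<phi>) y) =
      (LBINT y. pderiv_at i (pderiv_at i u) y * \<phi> y)" for i
    using u \<phi>
    by (simp add: integration_by_parts smooth_fun_differentiable smooth_fun_pderiv smooth_fun_continuous test_function_pderiv)
  moreover have "integrable lborel (\<lambda>y. u y * pderiv_at i (pderiv_at i \<phi>) y)" for i
    by (intro test_function_integrable test_function_mult u test_function_pderiv \<phi>)
  moreover have "integrable lborel (\<lambda>y. pderiv_at i (pderiv_at i u) y * \<phi> y)" for i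
    by (intro test_function_integrable test_function_mult u smooth_fun_pderiv \<phi>)
  ultimately show ?thesis
    by (simp add: lap_def sum_distrib_left sum_distrib_right)
qed

lemma lap_affine_compose:
  assumes "smooth_fun u"
  shows "lap (\<lambda>y. u (b + c *\<^sub>R y)) y = of_real (c\<^sup>2) * lap u (b + c *\<^sub>R y)"
proof -
  have *: "pderiv_at i (\<lambda>y. v (b + c *\<^sub>R y)) = (\<lambda>y. of_real c * pderiv_at i v (b + c *\<^sub>R y))" if "smooth_fun v" for v i
    using that by (intro ext pderiv_at_affine_compose smooth_fun_differentiable)
  have "pderiv_at i (\<lambda>y. of_real c * pderiv_at i u (b + c *\<^sub>R y)) y =
      of_real c * (of_real c * pderiv_at i (pderiv_at i u) (b + c *\<^sub>R y))" for i
    using assms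
    by (subst pderiv_at_cmult)
      (simp_all add: * smooth_fun_pderiv smooth_fun_differentiable smooth_fun_affine_compose)
  then show ?thesis
    using assms by (simp add: lap_def * sum_distrib_left power2_eq_square mult.assoc)
qed

text \<open>\<open>reg_green k e 1\<close> is the Green function, up to the factor $4\pi$, with the singularity
  smoothed out by replacing $|y|$ by $\sqrt{|y|^2 + e^2}$.\<close>

definition reg_norm :: "real \<Rightarrow> real^3 \<Rightarrow> real" where
  "reg_norm e y = sqrt ((norm y)\<^sup>2 + e\<^sup>2)"

definition reg_green :: "complex \<Rightarrow> real \<Rightarrow> nat \<Rightarrow> real^3 \<Rightarrow> complex" where
  "reg_green k e n y = exp (\<i> * k * of_real (reg_norm e y)) / of_real (reg_norm e y) ^ n"

lemma reg_norm_pos: "e > 0 \<Longrightarrow> reg_norm e y > 0"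
  by (simp add: reg_norm_def add_nonneg_pos)

lemma reg_norm_sq: "(reg_norm e y)\<^sup>2 = (norm y)\<^sup>2 + e\<^sup>2"
  by (simp add: reg_norm_def)

lemma reg_norm_ge: "norm y \<le> reg_norm e y"
  unfolding reg_norm_def by (rule real_le_rsqrt) simp

lemma reg_norm_scale:
  assumes "e > 0" shows "reg_norm e (e *\<^sub>R y) = e * reg_norm 1 y"
proof -
  have "(norm (e *\<^sub>R y))\<^sup>2 + e\<^sup>2 = e\<^sup>2 * ((norm y)\<^sup>2 + 1\<^sup>2)"
    by (simp add: power_mult_distrib algebra_simps)
  then show ?thesis using assms by (simp only: reg_norm_def real_sqrt_mult real_sqrt_abs abs_of_pos)
qed

lemma has_derivative_reg_norm:
  assumes "e > 0"
  shows "(reg_norm e has_derivative (\<lambda>h. (y \<bullet> h) / reg_norm e y)) (at y)"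
proof -
  have pos: "y \<bullet> y + e\<^sup>2 > 0" using assms by (simp add: add_nonneg_pos)
  have "((\<lambda>y. y \<bullet> y + e\<^sup>2) has_derivative (\<lambda>h. 2 * (y \<bullet> h))) (at y)"
    by (auto intro!: derivative_eq_intros simp: inner_commute)
  from has_derivative_real_sqrt[OF pos this]
  have "((\<lambda>y. sqrt (y \<bullet> y + e\<^sup>2)) has_derivative (\<lambda>h. 2 * (y \<bullet> h) * (inverse (sqrt (y \<bullet> y + e\<^sup>2)) / 2))) (at y)"
    by (simp add: mult.commute)
  moreover have "(\<lambda>h. 2 * (y \<bullet> h) * (inverse (sqrt (y \<bullet> y + e\<^sup>2)) / 2)) = (\<lambda>h. (y \<bullet> h) / reg_norm e y)"
    by (simp add: fun_eq_iff reg_norm_def power2_norm_eq_inner inverse_eq_divide)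
  moreover have "reg_norm e = (\<lambda>y. sqrt (y \<bullet> y + e\<^sup>2))"
    by (simp add: fun_eq_iff reg_norm_def power2_norm_eq_inner)
  ultimately show ?thesis by simp
qed

text \<open>All exponents \<open>n\<close> are treated together because a derivative of one member
  is a coordinate times a combination of the members with exponents \<open>n + 1\<close> and
  \<open>n + 2\<close>. Smoothness then follows by \<open>smooth_fun_algebra\<close>.\<close>

lemma has_derivative_reg_green:
  assumes e: "e > 0"
  shows "(reg_green k e n has_derivative (\<lambda>h. of_real (y \<bullet> h) *
      (\<i> * k * reg_green k e (n + 1) y - of_nat n * reg_green k e (n + 2) y))) (at y)"
proof -
  define z where "z = complex_of_real (reg_norm e y)"
  have z: "z \<noteq> 0" using reg_norm_pos[OF e, of y] by (simp add: z_def)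
  have "((\<lambda>z. exp (\<i> * k * z) / z ^ n) has_field_derivative
      (\<i> * k * exp (\<i> * k * z) * z ^ n - exp (\<i> * k * z) * (of_nat n * z ^ (n - 1))) / (z ^ n * z ^ n)) (at z)"
    using z by (auto intro!: derivative_eq_intros)
  also have "(\<i> * k * exp (\<i> * k * z) * z ^ n - exp (\<i> * k * z) * (of_nat n * z ^ (n - 1))) / (z ^ n * z ^ n)
     = \<i> * k * (exp (\<i> * k * z) / z ^ n) - of_nat n * (exp (\<i> * k * z) / z ^ (n + 1))"
    using z by (cases n) (auto simp: field_simps)
  finally have D: "((\<lambda>z. exp (\<i> * k * z) / z ^ n) has_derivative
     (\<lambda>h. (\<i> * k * (exp (\<i> * k * z) / z ^ n) - of_nat n * (exp (\<i> * k * z) / z ^ (n + 1))) * h)) (at z)"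
    by (simp add: has_field_derivative_def)
  have "((\<lambda>y. complex_of_real (reg_norm e y)) has_derivative (\<lambda>h. of_real ((y \<bullet> h) / reg_norm e y))) (at y)"
    by (rule has_derivative_of_real[OF has_derivative_reg_norm[OF e]])
  from has_derivative_compose[OF this, of "\<lambda>z. exp (\<i> * k * z) / z ^ n", OF D[unfolded z_def]]
  have "(reg_green k e n has_derivative (\<lambda>h.
      (\<i> * k * (exp (\<i> * k * z) / z ^ n) - of_nat n * (exp (\<i> * k * z) / z ^ (n + 1))) * of_real ((y \<bullet> h) / reg_norm e y))) (at y)"
    by (simp add: reg_green_def[abs_def] z_def)
  moreover have "(\<i> * k * (exp (\<i> * k * z) / z ^ n) - of_nat n * (exp (\<i> * k * z) / z ^ (n + 1))) * of_real (a / reg_norm e y)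
     = of_real a * (\<i> * k * reg_green k e (n + 1) y - of_nat n * reg_green k e (n + 2) y)" for a
    using z by (simp add: reg_green_def z_def[symmetric] field_simps)
  ultimately show ?thesis by simp
qed

lemma pderiv_reg_green:
  assumes "e > 0"
  shows "pderiv_at i (reg_green k e n) =
    (\<lambda>y. of_real (1 * y $ i) * (\<i> * k * reg_green k e (n + 1) y + (- of_nat n) * reg_green k e (n + 2) y))"
  by (rule ext, subst pderiv_at_eqI[OF has_derivative_reg_green[OF assms]]) (simp add: inner_axis)

lemma smooth_fun_reg_green:
  assumes e: "e > 0"
  shows "smooth_fun (reg_green k e n)"
proof (rule smooth_fun_algebra[where A="Collect smooth_fun \<union> range (reg_green k e)"])
  let ?A = "Collect smooth_fun \<union> range (reg_green k e)"
  show "reg_green k e n \<in> fun_algebra ?A"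
    by (intro fun_algebra.base) auto
  show "a differentiable (at y)" if "a \<in> ?A" for a y
    using that by (auto intro: smooth_fun_differentiable differentiableI[OF has_derivative_reg_green[OF e]])
  have "pderiv_at i (reg_green k e n) \<in> fun_algebra ?A" for i n
    unfolding pderiv_reg_green[OF e]
    by (intro fun_algebra.add fun_algebra.mult) (auto intro!: fun_algebra.base smooth_fun_coord[of 1, simplified])
  then show "pderiv_at i a \<in> fun_algebra ?A" if "a \<in> ?A" for a i
    using that by (auto intro: fun_algebra.base smooth_fun_pderiv)
qed

lemma pderiv_coord: "pderiv_at i (\<lambda>y. of_real (1 * y $ i)) y = 1"
proof -
  have "((\<lambda>y::real^3. complex_of_real (1 * y $ i)) has_derivative (\<lambda>h. of_real (1 * h $ i))) (at y)"
    by (auto intro!: derivative_eq_intros has_derivative_coord)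
  from pderiv_at_eqI[OF this, of i] show ?thesis by simp
qed

text \<open>The sum of the squared coordinates is rho^2 - e^2. The part with rho^2 reproduces the
  cancellation that makes the unsmoothed kernel a solution away from 0, so every surviving term
  carries the factor e^2.\<close>

lemma lap_reg_green:
  assumes e: "e > 0"
  shows "- lap (reg_green k e 1) y - k\<^sup>2 * reg_green k e 1 y =
    of_real (e\<^sup>2) * (3 * reg_green k e 5 y - 3 * \<i> * k * reg_green k e 4 y - k\<^sup>2 * reg_green k e 3 y)"
proof -
  define \<rho> where "\<rho> = complex_of_real (reg_norm e y)"
  have \<rho>: "\<rho> \<noteq> 0" using reg_norm_pos[OF e, of y] by (simp add: \<rho>_def)
  define P where "P n = reg_green k e n y" for n
  \<comment> \<open>Writing every term as a power of \<open>\<rho>\<close> times \<open>P 5\<close>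
    leaves a polynomial identity at the end.\<close>
  have P: "P 4 = \<rho> * P 5" "P 3 = \<rho>\<^sup>2 * P 5" "P 2 = \<rho> ^ 3 * P 5" "P 1 = \<rho> ^ 4 * P 5"
  proof -
    have "P n = \<rho> ^ m * P (n + m)" for n m
      using \<rho> by (simp add: P_def reg_green_def \<rho>_def[symmetric] power_add)
    from this[of 4 1] this[of 3 2] this[of 2 3] this[of 1 4]
    show "P 4 = \<rho> * P 5" "P 3 = \<rho>\<^sup>2 * P 5" "P 2 = \<rho> ^ 3 * P 5" "P 1 = \<rho> ^ 4 * P 5" by simp_all
  qed
  have diff: "(\<lambda>y. \<i> * k * reg_green k e 2 y + - of_nat 1 * reg_green k e 3 y) differentiable (at y)"
    by (intro derivative_intros smooth_fun_differentiable smooth_fun_reg_green e)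
  have inner: "pderiv_at i (\<lambda>y. \<i> * k * reg_green k e 2 y + - of_nat 1 * reg_green k e 3 y) y =
     \<i> * k * (of_real (y $ i) * (\<i> * k * P 3 - 2 * P 4)) - of_real (y $ i) * (\<i> * k * P 4 - 3 * P 5)" for i
  proof -
    have d: "reg_green k e n differentiable (at y)" for n
      by (intro smooth_fun_differentiable smooth_fun_reg_green e)
    have "pderiv_at i (\<lambda>y. \<i> * k * reg_green k e 2 y + - of_nat 1 * reg_green k e 3 y) y =
        \<i> * k * pderiv_at i (reg_green k e 2) y + - of_nat 1 * pderiv_at i (reg_green k e 3) y"
      using d by (subst pderiv_at_add) (auto intro!: differentiable_mult simp only: pderiv_at_cmult differentiable_const)
    also have "pderiv_at i (reg_green k e 2) y = of_real (y $ i) * (\<i> * k * P 3 - 2 * P 4)"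
      by (simp add: pderiv_reg_green[OF e] P_def)
    also have "pderiv_at i (reg_green k e 3) y = of_real (y $ i) * (\<i> * k * P 4 - 3 * P 5)"
      by (simp add: pderiv_reg_green[OF e] P_def)
    finally show ?thesis by simp
  qed
  have "pderiv_at i (pderiv_at i (reg_green k e 1)) y =
     (of_real (y $ i))\<^sup>2 * (- k\<^sup>2 * P 3 - 3 * \<i> * k * P 4 + 3 * P 5) + (\<i> * k * P 2 - P 3)" for i
  proof -
    have "pderiv_at i (reg_green k e 1) =
      (\<lambda>y. of_real (1 * y $ i) * (\<i> * k * reg_green k e 2 y + - of_nat 1 * reg_green k e 3 y))"
    proof -
      have "(1::nat) + 1 = 2" "(1::nat) + 2 = 3" by simp_all
      then show ?thesis using pderiv_reg_green[OF e, of i k 1] by (simp only:)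
    qed
    then have "pderiv_at i (pderiv_at i (reg_green k e 1)) y =
       of_real (1 * y $ i) * pderiv_at i (\<lambda>y. \<i> * k * reg_green k e 2 y + - of_nat 1 * reg_green k e 3 y) y
       + pderiv_at i (\<lambda>y. of_real (1 * y $ i)) y * (\<i> * k * reg_green k e 2 y + - of_nat 1 * reg_green k e 3 y)"
      by (simp only:) (rule pderiv_at_mult[OF smooth_fun_differentiable[OF smooth_fun_coord] diff])
    then show ?thesis
      unfolding inner pderiv_coord by (simp add: P_def[symmetric] power2_eq_square algebra_simps)
  qed
  then have "lap (reg_green k e 1) y =
     (\<Sum>i\<in>UNIV. (of_real (y $ i))\<^sup>2) * (- k\<^sup>2 * P 3 - 3 * \<i> * k * P 4 + 3 * P 5) + 3 * (\<i> * k * P 2 - P 3)"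
    by (simp add: lap_def sum.distrib sum_distrib_right)
  also have "(\<Sum>i\<in>UNIV. (complex_of_real (y $ i))\<^sup>2) = \<rho>\<^sup>2 - of_real (e\<^sup>2)"
  proof -
    have "(norm y)\<^sup>2 = (\<Sum>i\<in>UNIV. (y $ i)\<^sup>2)"
      by (simp add: norm_vec_def L2_set_def sum_nonneg)
    then have "(\<Sum>i\<in>UNIV. (complex_of_real (y $ i))\<^sup>2) = of_real ((norm y)\<^sup>2)"
      by simp
    also have "(norm y)\<^sup>2 = (reg_norm e y)\<^sup>2 - e\<^sup>2" by (simp add: reg_norm_sq)
    finally show ?thesis by (simp add: \<rho>_def)
  qed
  finally have "lap (reg_green k e 1) y =
    (\<rho>\<^sup>2 - of_real (e\<^sup>2)) * (- k\<^sup>2 * P 3 - 3 * \<i> * k * P 4 + 3 * P 5) + 3 * (\<i> * k * P 2 - P 3)" .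
  then show ?thesis
    unfolding P_def[symmetric] P by (simp only:) (simp add: algebra_simps power_numeral_reduce)
qed

lemma norm_reg_green:
  assumes "e > 0"
  shows "norm (reg_green k e n y) = exp (- Im k * reg_norm e y) / reg_norm e y ^ n"
  unfolding reg_green_def norm_divide norm_exp_ik norm_power
  using reg_norm_pos[OF assms, of y] by simp

text \<open>The numbers \<open>I n\<close> have two limits. Pointwise convergence of the smoothed
  kernel gives 4 pi times the left-hand side. Integration by parts moves the operator onto the
  kernel, where only the error term of \<open>lap_reg_green\<close> remains, and rescaling shows
  that it concentrates at 0.\<close>

lemma G_tilde_fundamental:
  assumes k: "Im k > 0" and \<psi>: "test_function \<psi>"
  shows "(LBINT s. G_tilde k s * (- lap \<psi> s - k\<^sup>2 * \<psi> s)) = \<psi> 0"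
proof -
  define c where "c = Im k"
  have c: "c > 0" using k by (simp add: c_def)
  define \<epsilon> where "\<epsilon> n = 1 / real (Suc n)" for n
  have \<epsilon>: "\<epsilon> n > 0" "\<epsilon> n \<le> 1" for n by (simp_all add: \<epsilon>_def)
  have \<epsilon>0: "\<epsilon> \<longlonglongrightarrow> 0" unfolding \<epsilon>_def by real_asymp
  define g where "g s = - lap \<psi> s - k\<^sup>2 * \<psi> s" for s
  have g: "test_function g"
    using test_function_add[OF test_function_cmult[OF test_function_lap[OF \<psi>], of "-1"] test_function_cmult[OF \<psi>, of "- k\<^sup>2"]]
    by (simp add: g_def[abs_def])
  obtain B where B: "B \<ge> 0" "\<And>s. norm (g s) \<le> B" using test_function_bounded[OF g] by blast
  obtain C where C: "C \<ge> 0" "\<And>s. norm (\<psi> s) \<le> C" using test_function_bounded[OF \<psi>] by blast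
  note [measurable] = test_function_measurable[OF g] test_function_measurable[OF \<psi>]
  have rm [measurable]: "reg_green k e n \<in> borel_measurable borel" for e n
    unfolding reg_green_def[abs_def] reg_norm_def[abs_def] by measurable
  have nz: "AE y::real^3 in lborel. y \<noteq> 0" by (rule AE_lborel_singleton)
  define I where "I n = (LBINT s. reg_green k (\<epsilon> n) 1 s * g s)" for n
  have "I \<longlonglongrightarrow> (LBINT s. 4 * of_real pi * (G_tilde k s * g s))"
    unfolding I_def
  proof (rule integral_dominated_convergence[where w="\<lambda>s. exp (- c * norm s) / norm s * B"])
    show "integrable lborel (\<lambda>s::real^3. exp (- c * norm s) / norm s * B)"
      by (intro integrable_mult_left integrable_exp_div_norm c)
    show "AE s in lborel. (\<lambda>n. reg_green k (\<epsilon> n) 1 s * g s) \<longlonglongrightarrow> 4 * of_real pi * (G_tilde k s * g s)"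
      using nz
    proof eventually_elim
      case (elim s)
      have "(\<lambda>n. sqrt ((norm s)\<^sup>2 + (\<epsilon> n)\<^sup>2)) \<longlonglongrightarrow> sqrt ((norm s)\<^sup>2 + 0\<^sup>2)"
        by (intro tendsto_intros \<epsilon>0)
      then have r: "(\<lambda>n. reg_norm (\<epsilon> n) s) \<longlonglongrightarrow> norm s" by (simp add: reg_norm_def)
      have "(\<lambda>n. exp (\<i> * k * of_real (reg_norm (\<epsilon> n) s)) / of_real (reg_norm (\<epsilon> n) s) ^ 1 * g s) \<longlonglongrightarrow>
          exp (\<i> * k * of_real (norm s)) / of_real (norm s) ^ 1 * g s"
        using elim by (intro tendsto_intros r) auto
      then show ?case by (simp add: reg_green_def G_tilde_eq)
    qed
    show "AE s in lborel. norm (reg_green k (\<epsilon> n) 1 s * g s) \<le> exp (- c * norm s) / norm s * B" for n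
      using nz
    proof eventually_elim
      case (elim s)
      have "norm (reg_green k (\<epsilon> n) 1 s) = exp (- c * reg_norm (\<epsilon> n) s) / reg_norm (\<epsilon> n) s"
        by (simp add: norm_reg_green \<epsilon> c_def)
      also have "\<dots> \<le> exp (- c * norm s) / norm s"
        using elim c reg_norm_ge[of s "\<epsilon> n"] by (intro frac_le) (auto intro: mult_left_mono)
      finally show ?case unfolding norm_mult by (intro mult_mono B) auto
    qed
  qed auto
  moreover have "I \<longlonglongrightarrow> integral\<^sup>L lborel (\<lambda>s::real^3. of_real (3 * (1 / sqrt (1 + (norm s)\<^sup>2) ^ 5)) * \<psi> 0)"
  proof -
    let ?\<sigma> = "\<lambda>s::real^3. reg_norm 1 s"
    have \<sigma>: "?\<sigma> s > 0" for s by (simp add: reg_norm_pos)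
    \<comment> \<open>The integrand after the substitution of
      \<open>\<epsilon> n *\<^sub>R s\<close>. The Jacobian e^3 and the factor e^2 cancel e^-5 in
      the leading term, while the other two terms keep the factors e and e^2 and vanish in the
      limit.\<close>
    define J where "J n s = exp (\<i> * (k * of_real (\<epsilon> n)) * of_real (?\<sigma> s)) *
       (3 / of_real (?\<sigma> s) ^ 5 - 3 * \<i> * k * of_real (\<epsilon> n) / of_real (?\<sigma> s) ^ 4 - k\<^sup>2 * of_real ((\<epsilon> n)\<^sup>2) / of_real (?\<sigma> s) ^ 3)
       * \<psi> (\<epsilon> n *\<^sub>R s)" for n s
    have I: "I n = integral\<^sup>L lborel (J n)" for n
    proof -
      define e where "e = \<epsilon> n"
      have e: "e > 0" by (simp add: e_def \<epsilon>)
      define F where "F s = of_real (e\<^sup>2) * (3 * reg_green k e 5 s - 3 * \<i> * k * reg_green k e 4 s - k\<^sup>2 * reg_green k e 3 s) * \<psi> s" for s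
      have Fm [measurable]: "F \<in> borel_measurable borel" unfolding F_def by measurable
      have sm: "smooth_fun (reg_green k e 1)" by (rule smooth_fun_reg_green[OF e])
      have sm2: "smooth_fun (lap (reg_green k e 1))"
        unfolding lap_def by (intro smooth_fun_sum smooth_fun_pderiv sm)
      have i1: "integrable lborel (\<lambda>s. reg_green k e 1 s * lap \<psi> s)" "integrable lborel (\<lambda>s. reg_green k e 1 s * \<psi> s)"
        "integrable lborel (\<lambda>s. lap (reg_green k e 1) s * \<psi> s)"
        by (intro test_function_integrable test_function_mult sm sm2 test_function_lap \<psi>)+
      have "I n = (LBINT s. - (reg_green k e 1 s * lap \<psi> s) - k\<^sup>2 * (reg_green k e 1 s * \<psi> s))"
        unfolding I_def g_def e_def by (simp add: algebra_simps)
      also have "\<dots> = - (LBINT s. reg_green k e 1 s * lap \<psi> s) - k\<^sup>2 * (LBINT s. reg_green k e 1 s * \<psi> s)"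
        using i1 by simp
      also have "\<dots> = (LBINT s. - (lap (reg_green k e 1) s * \<psi> s) - k\<^sup>2 * (reg_green k e 1 s * \<psi> s))"
        unfolding integral_lap_by_parts[OF sm \<psi>] using i1 by simp
      also have "(\<lambda>s. - (lap (reg_green k e 1) s * \<psi> s) - k\<^sup>2 * (reg_green k e 1 s * \<psi> s)) = F"
        unfolding F_def lap_reg_green[OF e, symmetric] by (simp add: algebra_simps)
      also have "integral\<^sup>L lborel F = e ^ 3 *\<^sub>R (LBINT s. F (0 + e *\<^sub>R s))"
        using lborel_integral_affine[OF Fm, of e 0] e by simp
      also have "\<dots> = (LBINT s. e ^ 3 *\<^sub>R F (0 + e *\<^sub>R s))"
        by simp
      also have "(\<lambda>s. e ^ 3 *\<^sub>R F (0 + e *\<^sub>R s)) = J n"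
      proof
        fix s
        have alg: "w ^ 3 * (w\<^sup>2 * (3 * (E / (w * p) ^ 5) - 3 * \<i> * k * (E / (w * p) ^ 4) - k\<^sup>2 * (E / (w * p) ^ 3)) * q) =
           E * (3 / p ^ 5 - 3 * \<i> * k * w / p ^ 4 - k\<^sup>2 * w\<^sup>2 / p ^ 3) * q"
          if "w \<noteq> 0" "p \<noteq> 0" for w p E q :: complex
          using that by (simp add: power_mult_distrib divide_simps) (simp add: algebra_simps power_numeral_reduce)
        have "of_real e \<noteq> (0::complex)" "of_real (?\<sigma> s) \<noteq> (0::complex)" using e \<sigma>[of s] by auto
        moreover have "exp (\<i> * (k * of_real e) * of_real (?\<sigma> s)) = exp (\<i> * k * (of_real e * of_real (?\<sigma> s)))"
          by (simp add: mult.assoc)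
        ultimately show "e ^ 3 *\<^sub>R F (0 + e *\<^sub>R s) = J n s"
          by (simp only: F_def J_def reg_green_def reg_norm_scale[OF e] e_def[symmetric] add_0
              scaleR_conv_of_real[where 'a=complex] of_real_mult of_real_power alg not_False_eq_True)
      qed
      finally show ?thesis .
    qed
    show ?thesis
      unfolding I
    proof (rule integral_dominated_convergence[where w="\<lambda>s. (3 * (1 / sqrt (1 + (norm s)\<^sup>2) ^ 5) +
          (3 * norm k + (norm k)\<^sup>2 / c) * (1 / (1 + (norm s)\<^sup>2)\<^sup>2)) * C"])
      show "integrable lborel (\<lambda>s::real^3. (3 * (1 / sqrt (1 + (norm s)\<^sup>2) ^ 5) +
          (3 * norm k + (norm k)\<^sup>2 / c) * (1 / (1 + (norm s)\<^sup>2)\<^sup>2)) * C)"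
        by (intro integrable_mult_left Bochner_Integration.integrable_add integrable_mult_right
            integral_mollifier_kernel(1) integrable_inverse_quartic)
      show "J n \<in> borel_measurable lborel" for n
        unfolding J_def reg_norm_def by measurable
      show "AE s in lborel. (\<lambda>n. J n s) \<longlonglongrightarrow> of_real (3 * (1 / sqrt (1 + (norm s)\<^sup>2) ^ 5)) * \<psi> 0"
      proof (rule AE_I2)
        fix s :: "real^3"
        have c0: "isCont \<psi> 0" using test_function_continuous[OF \<psi>] by (simp add: continuous_on_eq_continuous_at)
        have "(\<lambda>n. \<epsilon> n *\<^sub>R s) \<longlonglongrightarrow> 0"
          using tendsto_scaleR[OF \<epsilon>0 tendsto_const[of s]] by simp
        then have p: "(\<lambda>n. \<psi> (\<epsilon> n *\<^sub>R s)) \<longlonglongrightarrow> \<psi> 0"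
          by (rule isCont_tendsto_compose[OF c0])
        have "(\<lambda>n. J n s) \<longlonglongrightarrow> exp (\<i> * (k * of_real 0) * of_real (?\<sigma> s)) *
           (3 / of_real (?\<sigma> s) ^ 5 - 3 * \<i> * k * of_real 0 / of_real (?\<sigma> s) ^ 4 - k\<^sup>2 * of_real (0\<^sup>2) / of_real (?\<sigma> s) ^ 3) * \<psi> 0"
          unfolding J_def using \<sigma>[of s] by (intro tendsto_intros \<epsilon>0 p) auto
        then show "(\<lambda>n. J n s) \<longlonglongrightarrow> of_real (3 * (1 / sqrt (1 + (norm s)\<^sup>2) ^ 5)) * \<psi> 0"
          by (simp add: reg_norm_def add.commute)
      qed
      show "AE s in lborel. norm (J n s) \<le> (3 * (1 / sqrt (1 + (norm s)\<^sup>2) ^ 5) +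
          (3 * norm k + (norm k)\<^sup>2 / c) * (1 / (1 + (norm s)\<^sup>2)\<^sup>2)) * C" for n
      proof (rule AE_I2)
        fix s :: "real^3"
        define p where "p = ?\<sigma> s"
        define e where "e = \<epsilon> n"
        have p: "p > 0" by (simp add: p_def \<sigma>)
        have e: "e > 0" "e \<le> 1" by (simp_all add: e_def \<epsilon>)
        have p5: "1 / p ^ 5 = 1 / sqrt (1 + (norm s)\<^sup>2) ^ 5" by (simp add: p_def reg_norm_def add.commute)
        have "p ^ 4 = (p\<^sup>2)\<^sup>2" by simp
        also have "p\<^sup>2 = 1 + (norm s)\<^sup>2" by (simp add: p_def reg_norm_sq)
        finally have p4: "1 / p ^ 4 = 1 / (1 + (norm s)\<^sup>2)\<^sup>2" by simp
        define E where "E = exp (- c * (e * p))"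
        have E: "E \<ge> 0" "E \<le> 1" using c e p by (simp_all add: E_def)
        have "norm (exp (\<i> * (k * of_real e) * of_real p)) = E"
          unfolding norm_exp_ik[of "k * of_real e"] E_def by (simp add: c_def mult.assoc)
        then have "norm (J n s) = E * norm (3 / of_real p ^ 5 - 3 * \<i> * k * of_real e / of_real p ^ 4 - k\<^sup>2 * of_real (e\<^sup>2) / of_real p ^ 3)
           * norm (\<psi> (e *\<^sub>R s))"
          by (simp only: J_def norm_mult p_def[symmetric] e_def[symmetric])
        also have "\<dots> \<le> E * (3 / p ^ 5 + 3 * norm k * e / p ^ 4 + (norm k)\<^sup>2 * e\<^sup>2 / p ^ 3) * C"
        proof -
          have "norm (3 / of_real p ^ 5 - 3 * \<i> * k * of_real e / of_real p ^ 4 - k\<^sup>2 * of_real (e\<^sup>2) / of_real p ^ 3 :: complex)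
             \<le> norm (3 / of_real p ^ 5 :: complex) + norm (3 * \<i> * k * of_real e / of_real p ^ 4) + norm (k\<^sup>2 * of_real (e\<^sup>2) / of_real p ^ 3)"
            by (intro order_trans[OF norm_triangle_ineq4] add_mono norm_triangle_ineq4) simp
          also have "\<dots> = 3 / p ^ 5 + 3 * norm k * e / p ^ 4 + (norm k)\<^sup>2 * e\<^sup>2 / p ^ 3"
            using p e by (simp add: norm_divide norm_mult norm_power)
          finally show ?thesis using E C p e
            by (intro mult_mono) (auto intro!: mult_nonneg_nonneg add_nonneg_nonneg divide_nonneg_nonneg)
        qed
        also have "E * (3 / p ^ 5 + 3 * norm k * e / p ^ 4 + (norm k)\<^sup>2 * e\<^sup>2 / p ^ 3) \<le>
           3 * (1 / p ^ 5) + (3 * norm k + (norm k)\<^sup>2 / c) * (1 / p ^ 4)"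
        proof -
          have "E * (3 / p ^ 5) \<le> 1 * (3 / p ^ 5)" using E p by (intro mult_right_mono) auto
          moreover have "E * (3 * norm k * e / p ^ 4) \<le> 1 * (3 * norm k * 1 / p ^ 4)"
            using E p e by (intro mult_mono divide_right_mono mult_left_mono) auto
          moreover have "E * ((norm k)\<^sup>2 * e\<^sup>2 / p ^ 3) \<le> (norm k)\<^sup>2 / c * (1 / p ^ 4)"
          proof -
            \<comment> \<open>The power p^-3 is not integrable at infinity. The missing power is
              taken from the exponential: e p exp(-c e p) is at most 1 / c, which uses up one of the
              two factors e.\<close>
            have "c * (e * p) \<le> exp (c * (e * p))"
              using exp_ge_add_one_self[of "c * (e * p)"] by linarith
            then have "E * (c * (e * p)) \<le> 1"
              by (simp add: E_def exp_minus field_simps)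
            then have "E * (e * p) \<le> 1 / c" using c by (simp add: field_simps)
            then have "e * (E * (e * p)) \<le> 1 * (1 / c)" using e E c p by (intro mult_mono) auto
            then have "(norm k)\<^sup>2 * (e * (E * (e * p))) / p ^ 4 \<le> (norm k)\<^sup>2 * (1 * (1 / c)) / p ^ 4"
              using p by (intro divide_right_mono mult_left_mono) auto
            moreover have "(norm k)\<^sup>2 * (e * (E * (e * p))) / p ^ 4 = E * ((norm k)\<^sup>2 * e\<^sup>2 / p ^ 3)"
              using p by (simp add: field_simps power_numeral_reduce)
            ultimately show ?thesis by simp
          qed
          ultimately show ?thesis by (simp add: distrib_left distrib_right add_divide_distrib)
        qed
        finally show "norm (J n s) \<le> (3 * (1 / sqrt (1 + (norm s)\<^sup>2) ^ 5) +
          (3 * norm k + (norm k)\<^sup>2 / c) * (1 / (1 + (norm s)\<^sup>2)\<^sup>2)) * C"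
          unfolding p5 p4 using C by (simp add: mult_right_mono)
      qed
    qed auto
  qed
  ultimately have "(LBINT s. 4 * of_real pi * (G_tilde k s * g s)) =
      integral\<^sup>L lborel (\<lambda>s::real^3. of_real (3 * (1 / sqrt (1 + (norm s)\<^sup>2) ^ 5)) * \<psi> 0)"
    by (rule LIMSEQ_unique)
  also have "\<dots> = of_real (integral\<^sup>L lborel (\<lambda>s::real^3. 3 * (1 / sqrt (1 + (norm s)\<^sup>2) ^ 5))) * \<psi> 0"
    by (simp only: integral_mult_left_zero integral_complex_of_real)
  also have "integral\<^sup>L lborel (\<lambda>s::real^3. 3 * (1 / sqrt (1 + (norm s)\<^sup>2) ^ 5)) = 4 * pi"
    by (simp only: integral_mult_right_zero integral_mollifier_kernel(2))
  finally show ?thesis by (simp add: g_def)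
qed

theorem green_conv_inverts:
  assumes k: "Im k > 0" and \<phi>: "test_function \<phi>"
  shows "green_conv k (\<lambda>y. - lap \<phi> y - k\<^sup>2 * \<phi> y) y = \<phi> y"
proof -
  define \<psi> where "\<psi> s = \<phi> (y + 1 *\<^sub>R s)" for s
  have \<psi>: "test_function \<psi>" unfolding \<psi>_def by (intro test_function_affine_compose \<phi>) simp
  note [measurable] = test_function_measurable[OF \<phi>] test_function_measurable[OF test_function_lap[OF \<phi>]]
  have "lap \<psi> s = lap \<phi> (y + s)" for s
    using lap_affine_compose[OF test_function_smooth[OF \<phi>], of y 1 s] by (simp add: \<psi>_def[abs_def])
  then have "\<phi> y = (LBINT s. G_tilde k s * (- lap \<phi> (y + s) - k\<^sup>2 * \<phi> (y + s)))"
    using G_tilde_fundamental[OF k \<psi>] by (simp add: \<psi>_def)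
  also have "\<dots> = (LBINT s. G_tilde k (y - (y + s)) * (- lap \<phi> (y + s) - k\<^sup>2 * \<phi> (y + s)))"
    by simp
  also have "\<dots> = green_conv k (\<lambda>y. - lap \<phi> y - k\<^sup>2 * \<phi> y) y"
    unfolding green_conv_def
    by (rule lborel_integral_translate[of "\<lambda>s. G_tilde k (y - s) * (- lap \<phi> s - k\<^sup>2 * \<phi> s)"]) measurable
  finally show ?thesis by simp
qed

section \<open>Representatives of $L^2$ classes\<close>

lemma represents_sq_integrable: "represents f u \<Longrightarrow> sq_integrable u"
  by transfer (simp add: ae_equal_def)

lemma represents_exists: "\<exists>u. represents f u"
  by transfer auto

lemma represents_AE: "represents f u \<Longrightarrow> represents f v \<Longrightarrow> AE y in lborel. u y = v y"
  by transfer (auto simp: ae_equal_def elim: eventually_elim2)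

lemma represents_eqI: "represents f u \<Longrightarrow> represents g v \<Longrightarrow> AE y in lborel. u y = v y \<Longrightarrow> f = g"
  by transfer (auto simp: ae_equal_def elim: eventually_elim2)

lemma represents_unique: "represents f u \<Longrightarrow> represents g u \<Longrightarrow> f = g"
  by (rule represents_eqI) auto

lemma represents_cong:
  "represents f u \<Longrightarrow> sq_integrable v \<Longrightarrow> AE y in lborel. u y = v y \<Longrightarrow> represents f v"
  by transfer (auto simp: ae_equal_def elim: eventually_elim2)

lemma represents_class: "sq_integrable u \<Longrightarrow> \<exists>f. represents f u"
  by transfer (auto simp: ae_equal_def)

lemma represents_0: "represents 0 (\<lambda>_. 0)"
  by transfer (simp add: ae_equal_def)

lemma represents_add: "represents f u \<Longrightarrow> represents g v \<Longrightarrow> represents (f + g) (\<lambda>y. u y + v y)"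
  by transfer (auto simp: ae_equal_def sq_integrable_add elim: eventually_elim2)

lemma represents_diff: "represents f u \<Longrightarrow> represents g v \<Longrightarrow> represents (f - g) (\<lambda>y. u y - v y)"
  by transfer (auto simp: ae_equal_def sq_integrable_diff elim: eventually_elim2)

lemma represents_uminus: "represents f u \<Longrightarrow> represents (- f) (\<lambda>y. - u y)"
  by transfer (auto simp: ae_equal_def sq_integrable_uminus)

lemma represents_scale: "represents f u \<Longrightarrow> represents (c *\<^sub>C f) (\<lambda>y. c * u y)"
  by transfer (auto simp: ae_equal_def sq_integrable_scale)

lemma represents_sum:
  "(\<And>i. i \<in> I \<Longrightarrow> represents (f i) (u i)) \<Longrightarrow> represents (\<Sum>i\<in>I. f i) (\<lambda>y. \<Sum>i\<in>I. u i y)"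
  by (induction I rule: infinite_finite_induct) (auto intro: represents_0 represents_add)

lemma sq_integrable_cnj: "sq_integrable u \<Longrightarrow> sq_integrable (\<lambda>y. cnj (u y))"
  by (auto simp: sq_integrable_def intro!: borel_measurable_continuous_on[of cnj] continuous_intros)

lemma sq_integrable_sum:
  "(\<And>i. i \<in> I \<Longrightarrow> sq_integrable (u i)) \<Longrightarrow> sq_integrable (\<lambda>y. \<Sum>i\<in>I. u i y)"
  by (induction I rule: infinite_finite_induct) (auto intro: sq_integrable_add)

lemma inner_l2_represents:
  assumes "represents f u" "represents g v"
  shows "inner_l2 f g = (LBINT y. u y * cnj (v y))"
proof -
  have m: "(\<lambda>y. u y * cnj (v y)) \<in> borel_measurable lborel" if "sq_integrable u" "sq_integrable v" for u v
    using that(1) sq_integrable_cnj[OF that(2)] by (auto simp: sq_integrable_def)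
  have "(LBINT y. a y * cnj (b y)) = (LBINT y. u y * cnj (v y))"
    if "ae_equal a u" "ae_equal b v" for a b u v
  proof (rule integral_cong_AE)
    have "AE y in lborel. a y = u y" "AE y in lborel. b y = v y"
      using that by (simp_all add: ae_equal_def)
    then show "AE y in lborel. a y * cnj (b y) = u y * cnj (v y)"
      by eventually_elim simp
  qed (rule m; use that in \<open>simp add: ae_equal_def\<close>)+
  then show ?thesis using assms by transfer
qed

lemma norm_l2_represents:
  assumes "represents f u"
  shows "norm_l2 f = sqrt ((LBINT y. (cmod (u y))\<^sup>2))"
proof -
  have "inner_l2 f f = (LBINT y. complex_of_real ((cmod (u y))\<^sup>2))"
    unfolding inner_l2_represents[OF assms assms] complex_norm_square ..
  then show ?thesis by (simp only: norm_l2_def integral_complex_of_real Re_complex_of_real)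
qed

section \<open>Weak derivatives of classes and W^{2,2}\<close>

lemma weak_pderiv_iff:
  assumes f: "represents f u" and g: "represents g v"
  shows "weak_pderiv i f g \<longleftrightarrow> weak_pderiv_fun i u v"
proof
  assume "weak_pderiv i f g"
  then show "weak_pderiv_fun i u v" using f g by (auto simp: weak_pderiv_def weak_pderiv_fun_def)
next
  assume uv: "weak_pderiv_fun i u v"
  have cong: "(LBINT y. u y * \<phi> y) = (LBINT y. u' y * \<phi> y)"
    if "represents f u" "represents f u'" "test_function \<phi>" for f u u' \<phi>
  proof (rule integral_cong_AE)
    note [measurable] = test_function_measurable[OF that(3)]
    have [measurable]: "u \<in> borel_measurable borel" "u' \<in> borel_measurable borel"
      using that represents_sq_integrable by (auto simp: sq_integrable_def)
    show "(\<lambda>y. u y * \<phi> y) \<in> borel_measurable lborel" "(\<lambda>y. u' y * \<phi> y) \<in> borel_measurable lborel" by measurable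
    show "AE y in lborel. u y * \<phi> y = u' y * \<phi> y"
      using represents_AE[OF that(1,2)] by eventually_elim simp
  qed
  show "weak_pderiv i f g"
    unfolding weak_pderiv_def
  proof (intro allI impI)
    fix u' v' \<phi> assume *: "represents f u'" "represents g v'" "test_function \<phi>"
    show "(LBINT y. u' y * pderiv_at i \<phi> y) = - (LBINT y. v' y * \<phi> y)"
      using uv[unfolded weak_pderiv_fun_def, rule_format, OF *(3)]
      by (simp add: cong[OF *(1) f test_function_pderiv[OF *(3)]] cong[OF *(2) g *(3)])
  qed
qed

lemma weak_D_eqI:
  assumes g: "weak_pderiv i f g"
  shows "weak_D i f = g"
  unfolding weak_D_def
proof (rule the_equality)
  show "weak_pderiv i f g" by (rule g)
next
  fix g' assume g': "weak_pderiv i f g'"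
  obtain u v v' where r: "represents f u" "represents g v" "represents g' v'"
    using represents_exists by blast
  have sq: "sq_integrable v" "sq_integrable v'" using r represents_sq_integrable by auto
  have "AE y in lborel. v' y - v y = 0"
  proof (rule fundamental_lemma_calculus_of_variations)
    show "sq_integrable (\<lambda>y. v' y - v y)" by (intro sq_integrable_diff sq)
    fix \<phi> assume \<phi>: "test_function \<phi>"
    have "(LBINT y. v' y * \<phi> y) = (LBINT y. v y * \<phi> y)"
      using g[unfolded weak_pderiv_iff[OF r(1,2)] weak_pderiv_fun_def, rule_format, OF \<phi>]
        g'[unfolded weak_pderiv_iff[OF r(1,3)] weak_pderiv_fun_def, rule_format, OF \<phi>]
      by simp
    then show "(LBINT y. (v' y - v y) * \<phi> y) = 0"
      using sq \<phi> by (simp add: left_diff_distrib sq_integrable_mult_integrable test_function_sq_integrable)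
  qed
  then have "AE y in lborel. v' y = v y" by eventually_elim simp
  then show "g' = g" using r represents_eqI by blast
qed

lemma W22_representatives:
  assumes f: "f \<in> W22" and u: "represents f u"
  shows "\<exists>v w. (\<forall>i. sq_integrable (v i) \<and> sq_integrable (w i) \<and>
      weak_pderiv_fun i u (v i) \<and> weak_pderiv_fun i (v i) (w i)) \<and>
    represents (laplacian f) (\<lambda>y. \<Sum>i\<in>UNIV. w i y)"
proof -
  have "\<forall>i. \<exists>g. weak_pderiv i f g \<and> (\<exists>h. weak_pderiv i g h)"
    using f unfolding W22_def by blast
  then obtain g where g: "\<forall>i. weak_pderiv i f (g i) \<and> (\<exists>h. weak_pderiv i (g i) h)"
    by (rule choice[THEN exE])
  then have "\<forall>i. \<exists>h. weak_pderiv i (g i) h" by blast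
  then obtain h where h: "\<forall>i. weak_pderiv i (g i) (h i)"
    by (rule choice[THEN exE])
  have "\<forall>i. \<exists>v. represents (g i) v" "\<forall>i. \<exists>w. represents (h i) w"
    using represents_exists by blast+
  then obtain v w where v: "\<forall>i. represents (g i) (v i)" and w: "\<forall>i. represents (h i) (w i)"
    by (elim choice[THEN exE])
  have gi: "weak_pderiv i f (g i)" and hi: "weak_pderiv i (g i) (h i)"
    and vi: "represents (g i) (v i)" and wi: "represents (h i) (w i)" for i
    using g h v w by simp_all
  have "laplacian f = (\<Sum>i\<in>UNIV. h i)"
    by (simp add: laplacian_def weak_D_eqI[OF gi] weak_D_eqI[OF hi])
  then have "represents (laplacian f) (\<lambda>y. \<Sum>i\<in>UNIV. w i y)"
    by (simp add: represents_sum wi)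
  moreover have "weak_pderiv_fun i u (v i)" "weak_pderiv_fun i (v i) (w i)" for i
    using gi[of i] hi[of i] by (simp_all add: weak_pderiv_iff[OF u vi] weak_pderiv_iff[OF vi wi])
  moreover have "sq_integrable (v i)" "sq_integrable (w i)" for i
    using represents_sq_integrable[OF vi] represents_sq_integrable[OF wi] by auto
  ultimately show ?thesis
    by (intro exI[of _ v] exI[of _ w]) simp
qed

lemma W22_I:
  assumes u: "represents f u" and sq: "\<And>i. sq_integrable (v i)" "\<And>i j. sq_integrable (w i j)"
    and weak: "\<And>i. weak_pderiv_fun i u (v i)" "\<And>i j. weak_pderiv_fun j (v i) (w i j)"
  shows "f \<in> W22" "represents (laplacian f) (\<lambda>y. \<Sum>i\<in>UNIV. w i i y)"
proof -
  define g where "g i = (SOME g. represents g (v i))" for i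
  have g: "represents (g i) (v i)" for i
    unfolding g_def by (rule someI_ex) (rule represents_class[OF sq(1)])
  define h where "h i j = (SOME h. represents h (w i j))" for i j
  have h: "represents (h i j) (w i j)" for i j
    unfolding h_def by (rule someI_ex) (rule represents_class[OF sq(2)])
  have fg: "weak_pderiv i f (g i)" and gh: "weak_pderiv j (g i) (h i j)" for i j
    using weak weak_pderiv_iff[OF u g] weak_pderiv_iff[OF g h] by auto
  then show "f \<in> W22" unfolding W22_def by blast
  have "laplacian f = (\<Sum>i\<in>UNIV. h i i)"
    by (simp add: laplacian_def weak_D_eqI[OF fg] weak_D_eqI[OF gh])
  then show "represents (laplacian f) (\<lambda>y. \<Sum>i\<in>UNIV. w i i y)"
    by (simp add: represents_sum h)
qed

lemma weak_lap:
  assumes sq: "sq_integrable u" "\<And>i. sq_integrable (w i)"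
    and weak: "\<And>i. weak_pderiv_fun i u (v i)" "\<And>i. weak_pderiv_fun i (v i) (w i)"
    and \<phi>: "test_function \<phi>"
  shows "(LBINT y. u y * lap \<phi> y) = (LBINT y. (\<Sum>i\<in>UNIV. w i y) * \<phi> y)"
proof -
  have "(LBINT y. u y * pderiv_at i (pderiv_at i \<phi>) y) = (LBINT y. w i y * \<phi> y)" for i
    using weak \<phi> test_function_pderiv[OF \<phi>] unfolding weak_pderiv_fun_def by simp
  moreover have "integrable lborel (\<lambda>y. u y * pderiv_at i (pderiv_at i \<phi>) y)" "integrable lborel (\<lambda>y. w i y * \<phi> y)" for i
    by (intro sq_integrable_mult_integrable sq test_function_sq_integrable test_function_pderiv \<phi>)+
  ultimately show ?thesis
    by (simp add: lap_def sum_distrib_left sum_distrib_right)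
qed

section \<open>The Green function inverts the operator on W^{2,2}\<close>

lemma green_conv_sum:
  assumes k: "Im k > 0" and sq: "\<And>i. i \<in> I \<Longrightarrow> sq_integrable (u i)" and "finite I"
  shows "green_conv k (\<lambda>y. \<Sum>i\<in>I. u i y) y = (\<Sum>i\<in>I. green_conv k (u i) y)"
  unfolding green_conv_def sum_distrib_left
  by (rule Bochner_Integration.integral_sum) (intro integrable_green_conv k sq)

text \<open>For test functions, \<open>green_conv_inverts\<close> says that convolution with the Green function is a
  left inverse of $-\Delta - k^2$; this carries over to $W^{2,2}$ by duality.\<close>

lemma green_conv_W22:
  assumes k: "Im k > 0" and f: "f \<in> W22" and u: "represents f u" and l: "represents (laplacian f) l"
  shows "AE y in lborel. green_conv k (\<lambda>y. - l y - k\<^sup>2 * u y) y = u y"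
proof -
  obtain v w where *: "\<forall>i. sq_integrable (v i) \<and> sq_integrable (w i) \<and>
      weak_pderiv_fun i u (v i) \<and> weak_pderiv_fun i (v i) (w i)"
    and lw: "represents (laplacian f) (\<lambda>y. \<Sum>i\<in>UNIV. w i y)"
    using W22_representatives[OF f u] by (elim exE conjE)
  then have vw: "sq_integrable (v i)" "sq_integrable (w i)"
    "weak_pderiv_fun i u (v i)" "weak_pderiv_fun i (v i) (w i)" for i
    by simp_all
  define l' where "l' y = (\<Sum>i\<in>UNIV. w i y)" for y
  have l': "represents (laplacian f) l'" using lw by (simp add: l'_def[abs_def])
  have sq: "sq_integrable u" "sq_integrable l" "sq_integrable l'"
    using u l l' represents_sq_integrable by auto
  let ?R = "green_conv k"
  have Rsq: "sq_integrable (?R w)" if "sq_integrable w" for w using green_conv_young(1)[OF k that] .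
  have Rl: "?R l = ?R l'" by (rule green_conv_cong_AE[OF sq(2,3) represents_AE[OF l l']])
  have RR: "?R (\<lambda>y. - l y - k\<^sup>2 * u y) y = - ?R l' y - k\<^sup>2 * ?R u y" for y
    using green_conv_lincomb[OF k sq(2,1), of "-1" "- k\<^sup>2" y] by (simp add: Rl)
  have "AE y in lborel. ?R (\<lambda>y. - l y - k\<^sup>2 * u y) y - u y = 0"
  proof (rule fundamental_lemma_calculus_of_variations)
    have "sq_integrable (\<lambda>y. - l y - k\<^sup>2 * u y)"
      by (intro sq_integrable_diff sq_integrable_uminus sq_integrable_scale sq)
    then show "sq_integrable (\<lambda>y. ?R (\<lambda>y. - l y - k\<^sup>2 * u y) y - u y)"
      by (rule sq_integrable_diff[OF Rsq sq(1)])
    fix \<phi> assume \<phi>: "test_function \<phi>"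
    have sq\<phi>: "sq_integrable \<phi>" "sq_integrable (lap \<phi>)"
      using \<phi> by (auto intro: test_function_sq_integrable test_function_lap)
    have int: "integrable lborel (\<lambda>y. ?R l' y * \<phi> y)" "integrable lborel (\<lambda>y. ?R u y * \<phi> y)"
      "integrable lborel (\<lambda>y. u y * \<phi> y)" "integrable lborel (\<lambda>y. ?R u y * lap \<phi> y)"
      by (intro sq_integrable_mult_integrable Rsq sq sq\<phi>)+
    \<comment> \<open>Weak derivatives commute with the convolution, so the convolution of
      \<open>l'\<close> is the weak Laplacian of the convolution of \<open>u\<close>.\<close>
    have "(LBINT y. ?R u y * lap \<phi> y) = (LBINT y. (\<Sum>i\<in>UNIV. ?R (w i) y) * \<phi> y)"
      by (rule weak_lap[OF Rsq[OF sq(1)] Rsq[OF vw(2)] weak_pderiv_fun_green_conv[OF k sq(1) vw(1,3)]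
          weak_pderiv_fun_green_conv[OF k vw(1,2,4)] \<phi>])
    also have "\<dots> = (LBINT y. ?R l' y * \<phi> y)"
      using vw by (simp add: l'_def[abs_def] green_conv_sum[OF k])
    finally have lap: "(LBINT y. ?R u y * lap \<phi> y) = (LBINT y. ?R l' y * \<phi> y)" .
    have "(LBINT y. u y * \<phi> y) = (LBINT y. u y * ?R (\<lambda>y. - lap \<phi> y - k\<^sup>2 * \<phi> y) y)"
      by (simp add: green_conv_inverts[OF k \<phi>])
    also have "\<dots> = (LBINT y. ?R u y * (- lap \<phi> y - k\<^sup>2 * \<phi> y))"
      by (rule green_conv_symmetric[OF k sq(1)]) (intro sq_integrable_diff sq_integrable_uminus sq_integrable_scale sq\<phi>)
    also have "\<dots> = (LBINT y. - (?R u y * lap \<phi> y) - k\<^sup>2 * (?R u y * \<phi> y))"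
      by (simp add: algebra_simps)
    also have "\<dots> = - (LBINT y. ?R l' y * \<phi> y) - k\<^sup>2 * (LBINT y. ?R u y * \<phi> y)"
      using int by (simp add: lap)
    also have "\<dots> = (LBINT y. - (?R l' y * \<phi> y) - k\<^sup>2 * (?R u y * \<phi> y))"
      using int by simp
    finally have "(LBINT y. (- (?R l' y * \<phi> y) - k\<^sup>2 * (?R u y * \<phi> y)) - u y * \<phi> y) = 0"
      using int by simp
    then show "(LBINT y. (?R (\<lambda>y. - l y - k\<^sup>2 * u y) y - u y) * \<phi> y) = 0"
      by (simp only: RR left_diff_distrib mult_minus_left mult.assoc)
  qed
  then show ?thesis by eventually_elim simp
qed

text \<open>This solves (-Laplace - k^2) F = phi within W^{2,2} and thereby supplies enough elements
  of the domain of H for \<open>H_adj_kernel\<close>. The Laplacian is moved onto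
  \<open>\<phi>\<close> and then evaluated by \<open>green_conv_inverts\<close>.\<close>

lemma green_conv_test_W22:
  assumes k: "Im k > 0" and \<phi>: "test_function \<phi>" and f: "represents f (green_conv k \<phi>)"
  shows "f \<in> W22" "represents (laplacian f) (\<lambda>y. - \<phi> y - k\<^sup>2 * green_conv k \<phi> y)"
proof -
  have sq: "sq_integrable \<phi>" "sq_integrable (lap \<phi>)"
    and sqd: "sq_integrable (pderiv_at i \<phi>)" "sq_integrable (pderiv_at i (pderiv_at j \<phi>))" for i j
    using \<phi> by (auto intro: test_function_sq_integrable test_function_lap test_function_pderiv)
  have d1: "weak_pderiv_fun i (green_conv k \<phi>) (green_conv k (pderiv_at i \<phi>))" for i
    by (rule weak_pderiv_fun_green_conv[OF k sq(1) sqd(1) weak_pderiv_fun_smooth[OF test_function_smooth[OF \<phi>]]])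
  have d2: "weak_pderiv_fun j (green_conv k (pderiv_at i \<phi>)) (green_conv k (pderiv_at j (pderiv_at i \<phi>)))" for i j
    by (rule weak_pderiv_fun_green_conv[OF k sqd weak_pderiv_fun_smooth[OF test_function_smooth[OF test_function_pderiv[OF \<phi>]]]])
  note W = W22_I[where v="\<lambda>i. green_conv k (pderiv_at i \<phi>)"
      and w="\<lambda>i j. green_conv k (pderiv_at j (pderiv_at i \<phi>))",
      OF f green_conv_young(1)[OF k sqd(1)] green_conv_young(1)[OF k sqd(2)] d1 d2]
  show "f \<in> W22" by (rule W(1))
  have "(\<Sum>i\<in>UNIV. green_conv k (pderiv_at i (pderiv_at i \<phi>)) y) = green_conv k (lap \<phi>) y" for y
    unfolding lap_def by (rule green_conv_sum[symmetric]) (use k sqd in auto)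
  moreover have "green_conv k (lap \<phi>) y = - \<phi> y - k\<^sup>2 * green_conv k \<phi> y" for y
  proof -
    have "green_conv k (\<lambda>y. - lap \<phi> y - k\<^sup>2 * \<phi> y) y = - green_conv k (lap \<phi>) y - k\<^sup>2 * green_conv k \<phi> y"
      using green_conv_lincomb[OF k sq(2,1), of "-1" "- k\<^sup>2" y] by simp
    then have e: "\<phi> y = - green_conv k (lap \<phi>) y - k\<^sup>2 * green_conv k \<phi> y"
      by (simp only: green_conv_inverts[OF k \<phi>])
    have "green_conv k (lap \<phi>) y = - (- green_conv k (lap \<phi>) y - k\<^sup>2 * green_conv k \<phi> y) - k\<^sup>2 * green_conv k \<phi> y"
      by simp
    then show ?thesis by (simp only: e[symmetric])
  qed
  ultimately show "represents (laplacian f) (\<lambda>y. - \<phi> y - k\<^sup>2 * green_conv k \<phi> y)"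
    using W(2) by simp
qed

section \<open>The adjoint of the minimal operator\<close>

text \<open>The set where the two functions differ is open and null, hence empty. With the
  complement of the points x_j as \<open>S\<close> this controls the representative chosen by
  \<open>cont_rep\<close>.\<close>

lemma open_AE_eq_continuous:
  fixes u v :: "real^3 \<Rightarrow> complex"
  assumes S: "open S" and u: "continuous_on S u" and v: "continuous_on S v"
    and AE: "AE y in lborel. u y = v y" and y: "y \<in> S"
  shows "u y = v y"
proof (rule ccontr)
  define N where "N = {y \<in> S. u y - v y \<in> - {0}}"
  assume "u y \<noteq> v y"
  then have "N \<noteq> {}" using y by (auto simp: N_def)
  moreover have oN: "open N"
  proof -
    have "open (S \<inter> (\<lambda>y. u y - v y) -` (- {0}))"
      by (intro continuous_open_preimage continuous_intros u v S)
    moreover have "S \<inter> (\<lambda>y. u y - v y) -` (- {0}) = N" by (auto simp: N_def)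
    ultimately show ?thesis by simp
  qed
  ultimately have "\<not> negligible N" by (rule open_not_negligible[rotated])
  moreover have "N \<in> null_sets lborel"
  proof -
    have "AE y in lborel. y \<notin> N" using AE by eventually_elim (simp add: N_def)
    then show ?thesis using oN by (subst AE_iff_null_sets) auto
  qed
  then have "negligible N"
    by (simp add: negligible_iff_null_sets null_sets_completionI)
  ultimately show False by simp
qed

text \<open>The number \<open>- cnj k\<close> is the square root of \<open>cnj (k\<^sup>2)\<close> in the upper half plane.\<close>

lemma cnj_G_tilde: "cnj (G_tilde k y) = G_tilde (- cnj k) y"
  by (simp add: G_tilde_eq exp_cnj)

lemma cnj_green_conv:
  assumes "sq_integrable w"
  shows "cnj (green_conv k w y) = green_conv (- cnj k) (\<lambda>y. cnj (w y)) y"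
  unfolding green_conv_def by (simp only: cnj_G_tilde[symmetric] complex_cnj_mult[symmetric] Bochner_Integration.integral_cnj)

section \<open>Elements of the adjoint\<close>

text \<open>The continuous representative in \<open>dom_H\<close> and the convolution agree almost
  everywhere, hence everywhere. So the conditions f(x_j) = 0 become statements about the convolution
  at the points x_j, which duality can use.\<close>

lemma dom_H_obtain:
  assumes f: "f \<in> dom_H x" and k: "Im k > 0"
  obtains u l where "represents f u" "represents (laplacian f) l"
    "green_conv k (\<lambda>y. - l y - k\<^sup>2 * u y) = u" "\<forall>j. u (x j) = 0"
proof -
  obtain u where u: "represents f u" "continuous_on UNIV u" "\<And>j. u (x j) = 0" and W: "f \<in> W22"
    using f by (auto simp: dom_H_def)
  obtain l where l: "represents (laplacian f) l" using represents_exists by blast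
  have "sq_integrable (\<lambda>y. - l y - k\<^sup>2 * u y)"
    by (intro sq_integrable_diff sq_integrable_uminus sq_integrable_scale represents_sq_integrable[OF u(1)] represents_sq_integrable[OF l])
  then have "green_conv k (\<lambda>y. - l y - k\<^sup>2 * u y) y = u y" for y
    using open_AE_eq_continuous[OF open_UNIV green_conv_continuous[OF k] u(2) green_conv_W22[OF k W u(1) l]] by simp
  then have "green_conv k (\<lambda>y. - l y - k\<^sup>2 * u y) = u" by (rule ext)
  then show ?thesis using that u l by blast
qed

lemma H_adj_iff: "(g, h) \<in> H_adj x \<longleftrightarrow> (\<forall>f\<in>dom_H x. inner_l2 (- laplacian f) g = inner_l2 f h)"
  by (auto simp: H_adj_def adjoint_op_def H_min_def)

lemma inner_l2_diff_right: "inner_l2 f (g - h) = inner_l2 f g - inner_l2 f h"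
proof -
  obtain u v w where r: "represents f u" "represents g v" "represents h w" using represents_exists by blast
  have "integrable lborel (\<lambda>y. u y * cnj (v y))" "integrable lborel (\<lambda>y. u y * cnj (w y))"
    by (intro sq_integrable_mult_integrable sq_integrable_cnj represents_sq_integrable[OF r(1)]
        represents_sq_integrable[OF r(2)] represents_sq_integrable[OF r(3)])+
  then show ?thesis
    by (simp add: inner_l2_represents[OF r(1) represents_diff[OF r(2,3)]] inner_l2_represents[OF r(1,2)]
        inner_l2_represents[OF r(1,3)] right_diff_distrib)
qed

lemma H_adj_diff: "(g, h) \<in> H_adj x \<Longrightarrow> (g', h') \<in> H_adj x \<Longrightarrow> (g - g', h - h') \<in> H_adj x"
  by (simp add: H_adj_iff inner_l2_diff_right)

text \<open>For $h = k^2 g + w$ the condition $\langle -\Delta f, g\rangle = \langle f, h\rangle$ amounts to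
  $\langle (-\Delta - \overline{k}^2) f, g\rangle = \langle f, w\rangle$.\<close>

lemma H_adjI:
  assumes r: "represents g v" "represents (h - k\<^sup>2 *\<^sub>C g) w"
    and *: "\<And>f u l. f \<in> dom_H x \<Longrightarrow> represents f u \<Longrightarrow> represents (laplacian f) l \<Longrightarrow>
      green_conv (- cnj k) (\<lambda>y. - l y - (- cnj k)\<^sup>2 * u y) = u \<Longrightarrow> \<forall>j. u (x j) = 0 \<Longrightarrow>
      (LBINT y. (- l y - (- cnj k)\<^sup>2 * u y) * cnj (v y)) = (LBINT y. u y * cnj (w y))"
    and k: "Im k > 0"
  shows "(g, h) \<in> H_adj x"
  unfolding H_adj_iff
proof
  fix f assume f: "f \<in> dom_H x"
  have k': "Im (- cnj k) > 0" using k by simp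
  obtain u l where ul: "represents f u" "represents (laplacian f) l"
    "green_conv (- cnj k) (\<lambda>y. - l y - (- cnj k)\<^sup>2 * u y) = u" "\<forall>j. u (x j) = 0"
    by (rule dom_H_obtain[OF f k'])
  have h: "represents h (\<lambda>y. w y + k\<^sup>2 * v y)"
    using represents_add[OF r(2) represents_scale[OF r(1), of "k\<^sup>2"]] by simp
  have sq: "sq_integrable u" "sq_integrable l" "sq_integrable v" "sq_integrable w"
    using ul r represents_sq_integrable by auto
  have int: "integrable lborel (\<lambda>y. l y * cnj (v y))" "integrable lborel (\<lambda>y. u y * cnj (v y))"
    "integrable lborel (\<lambda>y. u y * cnj (w y))"
    by (intro sq_integrable_mult_integrable sq_integrable_cnj sq)+
  have "- (LBINT y. l y * cnj (v y)) - (cnj k)\<^sup>2 * (LBINT y. u y * cnj (v y)) =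
     (LBINT y. - (l y * cnj (v y)) - (cnj k)\<^sup>2 * (u y * cnj (v y)))"
    using int by simp
  also have "\<dots> = (LBINT y. (- l y - (- cnj k)\<^sup>2 * u y) * cnj (v y))"
    by (simp add: left_diff_distrib mult.assoc)
  also have "\<dots> = (LBINT y. u y * cnj (w y))" by (rule *[OF f ul])
  finally have "- (LBINT y. l y * cnj (v y)) =
     (LBINT y. u y * cnj (w y)) + (cnj k)\<^sup>2 * (LBINT y. u y * cnj (v y))"
    by (simp add: algebra_simps)
  also have "\<dots> = (LBINT y. u y * cnj (w y) + (cnj k)\<^sup>2 * (u y * cnj (v y)))"
    using int by simp
  also have "\<dots> = (LBINT y. u y * cnj (w y + k\<^sup>2 * v y))"
    by (simp add: algebra_simps)
  finally show "inner_l2 (- laplacian f) g = inner_l2 f h"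
    by (simp add: inner_l2_represents[OF represents_uminus[OF ul(2)] r(1)] inner_l2_represents[OF ul(1) h])
qed

text \<open>An element of dom(H) is the convolution of s = (-Laplace - conj z) f with the conjugate
  kernel. Symmetry moves the convolution from \<open>w\<close> to s and turns the pairing of s with
  G * w into that of f with w.\<close>

lemma green_conv_in_H_adj:
  assumes k: "Im k > 0" and w: "represents (h - k\<^sup>2 *\<^sub>C g) w" and g: "represents g (green_conv k w)"
  shows "(g, h) \<in> H_adj x"
proof (rule H_adjI[OF g w _ k])
  fix f u l
  assume ul: "represents f u" "represents (laplacian f) l"
    and R: "green_conv (- cnj k) (\<lambda>y. - l y - (- cnj k)\<^sup>2 * u y) = u"
  have k': "Im (- cnj k) > 0" using k by simp
  have w': "sq_integrable w" using w by (rule represents_sq_integrable)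
  have sq: "sq_integrable (\<lambda>y. - l y - (- cnj k)\<^sup>2 * u y)"
    by (intro sq_integrable_diff sq_integrable_uminus sq_integrable_scale represents_sq_integrable[OF ul(1)] represents_sq_integrable[OF ul(2)])
  show "(LBINT y. (- l y - (- cnj k)\<^sup>2 * u y) * cnj (green_conv k w y)) = (LBINT y. u y * cnj (w y))"
    using green_conv_symmetric[OF k' sq sq_integrable_cnj[OF w']] unfolding cnj_green_conv[OF w'] R .
qed

lemma sq_integrable_G_translate: "Im k > 0 \<Longrightarrow> sq_integrable (\<lambda>y. G_tilde k (y - b))"
  by (intro sq_integrable_translate G_tilde_sq_integrable)

text \<open>Pairing (-Laplace - conj z) f with G_k(. - x_j) evaluates the convolution that
  reproduces f at x_j, and there f vanishes. This is where the point conditions enter.\<close>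

lemma G_tilde_in_H_adj:
  assumes k: "Im k > 0" and g: "represents g (\<lambda>y. \<Sum>j\<in>UNIV. a j * G_tilde k (y - x j))"
  shows "(g, k\<^sup>2 *\<^sub>C g) \<in> H_adj (x :: 'm::finite \<Rightarrow> real^3)"
proof (rule H_adjI[OF g _ _ k])
  show "represents (k\<^sup>2 *\<^sub>C g - k\<^sup>2 *\<^sub>C g) (\<lambda>_. 0)" using represents_0 by simp
  fix f u l
  assume ul: "represents f u" "represents (laplacian f) l"
    and R: "green_conv (- cnj k) (\<lambda>y. - l y - (- cnj k)\<^sup>2 * u y) = u" and 0: "\<forall>j. u (x j) = 0"
  have k': "Im (- cnj k) > 0" using k by simp
  have sq: "sq_integrable (\<lambda>y. - l y - (- cnj k)\<^sup>2 * u y)"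
    by (intro sq_integrable_diff sq_integrable_uminus sq_integrable_scale represents_sq_integrable[OF ul(1)] represents_sq_integrable[OF ul(2)])
  define s where "s y = - l y - (- cnj k)\<^sup>2 * u y" for y
  have i: "integrable lborel (\<lambda>y. G_tilde (- cnj k) (x j - y) * s y)" for j
    unfolding s_def by (rule integrable_green_conv[OF k' sq])
  have "(LBINT y. s y * cnj (\<Sum>j\<in>UNIV. a j * G_tilde k (y - x j))) =
     (LBINT y. \<Sum>j\<in>UNIV. cnj (a j) * (G_tilde (- cnj k) (x j - y) * s y))"
    by (simp add: cnj_G_tilde sum_distrib_left mult_ac G_tilde_commute[of _ _ "x _"])
  also have "\<dots> = (\<Sum>j\<in>UNIV. cnj (a j) * green_conv (- cnj k) s (x j))"
    using i by (simp add: green_conv_def)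
  also have "\<dots> = 0" by (simp add: R[folded s_def] 0)
  finally show "(LBINT y. (- l y - (- cnj k)\<^sup>2 * u y) * cnj (\<Sum>j\<in>UNIV. a j * G_tilde k (y - x j))) =
      (LBINT y. u y * cnj 0)"
    by (simp add: s_def)
qed

section \<open>The kernel of the adjoint minus z\<close>

text \<open>Induction on the number of functionals. If some \<open>\<phi>0\<close> is annihilated by
  the earlier ones but not by \<open>F j\<close>, a multiple of \<open>F j\<close> is split off from
  \<open>L\<close>; otherwise the condition on \<open>F j\<close> follows from the others. The
  linear structure is passed as the operation \<open>comb\<close>, since test functions form a set
  and not a type.\<close>

lemma functional_in_span:
  fixes L :: "'a \<Rightarrow> complex" and F :: "'i \<Rightarrow> 'a \<Rightarrow> complex"
  assumes "finite J"
    and comb: "\<And>\<phi> \<psi> c. \<phi> \<in> V \<Longrightarrow> \<psi> \<in> V \<Longrightarrow> comb \<phi> c \<psi> \<in> V"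
    and L: "\<And>\<phi> \<psi> c. \<phi> \<in> V \<Longrightarrow> \<psi> \<in> V \<Longrightarrow> L (comb \<phi> c \<psi>) = L \<phi> + c * L \<psi>"
    and F: "\<And>i \<phi> \<psi> c. \<phi> \<in> V \<Longrightarrow> \<psi> \<in> V \<Longrightarrow> F i (comb \<phi> c \<psi>) = F i \<phi> + c * F i \<psi>"
    and ker: "\<And>\<phi>. \<phi> \<in> V \<Longrightarrow> (\<And>i. i \<in> J \<Longrightarrow> F i \<phi> = 0) \<Longrightarrow> L \<phi> = 0"
  shows "\<exists>c. \<forall>\<phi>\<in>V. L \<phi> = (\<Sum>i\<in>J. c i * F i \<phi>)"
  using \<open>finite J\<close> L ker
proof (induction J arbitrary: L rule: finite_induct)
  case empty
  then show ?case by auto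
next
  case (insert j J)
  show ?case
  proof (cases "\<exists>\<phi>0\<in>V. (\<forall>i\<in>J. F i \<phi>0 = 0) \<and> F j \<phi>0 \<noteq> 0")
    case True
    then obtain \<phi>0 where \<phi>0: "\<phi>0 \<in> V" "\<And>i. i \<in> J \<Longrightarrow> F i \<phi>0 = 0" "F j \<phi>0 \<noteq> 0" by auto
    define b where "b = L \<phi>0 / F j \<phi>0"
    have "\<exists>c. \<forall>\<phi>\<in>V. L \<phi> - b * F j \<phi> = (\<Sum>i\<in>J. c i * F i \<phi>)"
    proof (rule insert.IH)
      fix \<phi> assume \<phi>: "\<phi> \<in> V" "\<And>i. i \<in> J \<Longrightarrow> F i \<phi> = 0"
      \<comment> \<open>The projection of \<open>\<phi>\<close> along \<open>\<phi>0\<close> into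
        the kernel of \<open>F j\<close>; it stays in the kernels of the other functionals.\<close>
      define \<psi> where "\<psi> = comb \<phi> (- (F j \<phi> / F j \<phi>0)) \<phi>0"
      have "\<psi> \<in> V" using \<phi> \<phi>0 comb by (simp add: \<psi>_def)
      moreover have "F i \<psi> = 0" if "i \<in> insert j J" for i
        using that \<phi> \<phi>0 by (auto simp: \<psi>_def F)
      ultimately have "L \<psi> = 0" by (rule insert.prems(2))
      then show "L \<phi> - b * F j \<phi> = 0" using \<phi> \<phi>0 by (simp add: \<psi>_def insert.prems(1) b_def)
    qed (simp add: insert.prems(1) F algebra_simps)
    then obtain c where "\<forall>\<phi>\<in>V. L \<phi> - b * F j \<phi> = (\<Sum>i\<in>J. c i * F i \<phi>)" by blast
    then have "\<forall>\<phi>\<in>V. L \<phi> = b * F j \<phi> + (\<Sum>i\<in>J. c i * F i \<phi>)" by (simp add: algebra_simps)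
    moreover have "(\<Sum>i\<in>J. c i * F i \<phi>) = (\<Sum>i\<in>J. (c(j := b)) i * F i \<phi>)" for \<phi>
      using insert.hyps by (intro sum.cong) auto
    ultimately show ?thesis using insert.hyps by (intro exI[of _ "c(j := b)"]) simp
  next
    case False
    have "\<exists>c. \<forall>\<phi>\<in>V. L \<phi> = (\<Sum>i\<in>J. c i * F i \<phi>)"
    proof (rule insert.IH)
      show "L \<phi> = 0" if "\<phi> \<in> V" "\<And>i. i \<in> J \<Longrightarrow> F i \<phi> = 0" for \<phi>
        using insert.prems(2) that False by blast
    qed (rule insert.prems(1))
    then obtain c where c: "\<forall>\<phi>\<in>V. L \<phi> = (\<Sum>i\<in>J. c i * F i \<phi>)" by blast
    moreover have "(\<Sum>i\<in>J. c i * F i \<phi>) = (\<Sum>i\<in>J. (c(j := 0)) i * F i \<phi>)" for \<phi>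
      using insert.hyps by (intro sum.cong) auto
    ultimately show ?thesis using insert.hyps by (intro exI[of _ "c(j := 0)"]) simp
  qed
qed

text \<open>The range of \<open>H - cnj (k\<^sup>2)\<close> contains every test function \<open>\<phi>\<close> whose convolution with the
  Green function vanishes at the points \<open>x j\<close>. So if \<open>f\<close> is in the kernel of the adjoint minus \<open>k\<^sup>2\<close>, then
  the functional defined by \<open>f\<close> vanishes on the common kernel of the functionals
  \<open>\<phi> \<mapsto> green_conv (- cnj k) \<phi> (x j)\<close>, hence is a linear combination of them.\<close>

lemma H_adj_kernel:
  fixes x :: "'m::finite \<Rightarrow> real^3"
  assumes k: "Im k > 0" and f: "(f, k\<^sup>2 *\<^sub>C f) \<in> H_adj x"
  obtains a where "represents f (\<lambda>y. \<Sum>j\<in>UNIV. a j * G_tilde k (y - x j))"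
proof -
  define k' where "k' = - cnj k"
  have k': "Im k' > 0" using k by (simp add: k'_def)
  have k'2: "k'\<^sup>2 = cnj (k\<^sup>2)" by (simp add: k'_def)
  obtain w where w: "represents f w" using represents_exists by blast
  have sqw: "sq_integrable w" "sq_integrable (\<lambda>y. cnj (w y))"
    using w by (auto intro: represents_sq_integrable sq_integrable_cnj)
  have "\<exists>c. \<forall>\<phi>\<in>Collect test_function.
      (LBINT y. \<phi> y * cnj (w y)) = (\<Sum>j\<in>UNIV. c j * green_conv k' \<phi> (x j))"
  proof (rule functional_in_span[where comb="\<lambda>\<phi> c \<psi> y. \<phi> y + c * \<psi> y"])
    fix \<phi> \<psi> :: "real^3 \<Rightarrow> complex" and c
    assume \<phi>: "\<phi> \<in> Collect test_function" and \<psi>: "\<psi> \<in> Collect test_function"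
    show "(\<lambda>y. \<phi> y + c * \<psi> y) \<in> Collect test_function"
      using \<phi> \<psi> by (auto intro: test_function_add test_function_cmult)
    have sq: "sq_integrable \<phi>" "sq_integrable \<psi>" using \<phi> \<psi> by (auto intro: test_function_sq_integrable)
    show "green_conv k' (\<lambda>y. \<phi> y + c * \<psi> y) (x j) = green_conv k' \<phi> (x j) + c * green_conv k' \<psi> (x j)" for j
      using green_conv_lincomb[OF k' sq, of 1 c] by simp
    have "integrable lborel (\<lambda>y. \<phi> y * cnj (w y))" "integrable lborel (\<lambda>y. \<psi> y * cnj (w y))"
      by (intro sq_integrable_mult_integrable sq sqw)+
    then show "(LBINT y. (\<phi> y + c * \<psi> y) * cnj (w y)) =
        (LBINT y. \<phi> y * cnj (w y)) + c * (LBINT y. \<psi> y * cnj (w y))"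
      by (simp add: distrib_right mult.assoc)
  next
    fix \<phi> assume "\<phi> \<in> Collect test_function" and 0: "\<And>j. j \<in> UNIV \<Longrightarrow> green_conv k' \<phi> (x j) = 0"
    then have \<phi>: "test_function \<phi>" by simp
    have sq: "sq_integrable \<phi>" "sq_integrable (green_conv k' \<phi>)"
      using \<phi> by (auto intro: test_function_sq_integrable green_conv_young k')
    obtain F where F: "represents F (green_conv k' \<phi>)" using represents_class[OF sq(2)] by blast
    note FW = green_conv_test_W22[OF k' \<phi> F]
    have "F \<in> dom_H x"
      unfolding dom_H_def using F FW(1) green_conv_continuous[OF k' sq(1)] 0 by auto
    then have "inner_l2 (- laplacian F) f = inner_l2 F (k\<^sup>2 *\<^sub>C f)"
      using f by (simp add: H_adj_iff)
    \<comment> \<open>Tested against \<open>F\<close>, the terms with \<open>k'\<^sup>2\<close> on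
      the two sides agree, and only the pairing of \<open>\<phi>\<close> with \<open>w\<close>
      remains.\<close>
    then have "(LBINT y. (\<phi> y + k'\<^sup>2 * green_conv k' \<phi> y) * cnj (w y)) =
        k'\<^sup>2 * (LBINT y. green_conv k' \<phi> y * cnj (w y))"
    proof -
      have "(LBINT y. - (- \<phi> y - k'\<^sup>2 * green_conv k' \<phi> y) * cnj (w y)) =
          (LBINT y. green_conv k' \<phi> y * cnj (k\<^sup>2 * w y))"
        using \<open>inner_l2 (- laplacian F) f = _\<close> 
        by (simp only: inner_l2_represents[OF represents_uminus[OF FW(2)] w]
            inner_l2_represents[OF F represents_scale[OF w, of "k\<^sup>2"]])
      also have "\<dots> = (LBINT y. k'\<^sup>2 * (green_conv k' \<phi> y * cnj (w y)))"
        by (simp only: complex_cnj_mult k'2 mult.left_commute)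
      finally show ?thesis by (simp add: add.commute)
    qed
    moreover have "integrable lborel (\<lambda>y. \<phi> y * cnj (w y))" "integrable lborel (\<lambda>y. green_conv k' \<phi> y * cnj (w y))"
      by (intro sq_integrable_mult_integrable sq sqw)+
    ultimately show "(LBINT y. \<phi> y * cnj (w y)) = 0"
      by (simp add: distrib_right mult.assoc)
  qed simp
  then obtain c where c: "\<And>\<phi>. test_function \<phi> \<Longrightarrow>
      (LBINT y. \<phi> y * cnj (w y)) = (\<Sum>j\<in>UNIV. c j * green_conv k' \<phi> (x j))"
    by auto
  \<comment> \<open>The functional pairs with \<open>cnj (w y)\<close>, so its coefficients are the
    conjugates of those of \<open>w\<close>.\<close>
  define a where "a j = cnj (c j)" for j
  define v where "v y = (\<Sum>j\<in>UNIV. a j * G_tilde k (y - x j))" for y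
  have sqv: "sq_integrable v"
    unfolding v_def by (intro sq_integrable_sum sq_integrable_scale sq_integrable_G_translate k)
  have "AE y in lborel. cnj (w y - v y) = 0"
  proof (rule fundamental_lemma_calculus_of_variations)
    show "sq_integrable (\<lambda>y. cnj (w y - v y))" by (intro sq_integrable_cnj sq_integrable_diff sqw sqv)
    fix \<phi> assume \<phi>: "test_function \<phi>"
    have sq: "sq_integrable \<phi>" using \<phi> by (rule test_function_sq_integrable)
    have "(LBINT y. \<phi> y * cnj (v y)) =
        (LBINT y. \<Sum>j\<in>UNIV. c j * (G_tilde k' (x j - y) * \<phi> y))"
      by (simp add: v_def a_def cnj_G_tilde k'_def sum_distrib_left mult_ac G_tilde_commute[of _ _ "x _"])
    also have "\<dots> = (\<Sum>j\<in>UNIV. c j * green_conv k' \<phi> (x j))"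
      using integrable_green_conv[OF k' sq] by (simp add: green_conv_def)
    finally have "(LBINT y. \<phi> y * cnj (v y)) = (LBINT y. \<phi> y * cnj (w y))"
      by (simp add: c[OF \<phi>])
    moreover have "integrable lborel (\<lambda>y. \<phi> y * cnj (w y))" "integrable lborel (\<lambda>y. \<phi> y * cnj (v y))"
      by (intro sq_integrable_mult_integrable sq sqw sq_integrable_cnj sqv)+
    ultimately show "(LBINT y. cnj (w y - v y) * \<phi> y) = 0"
      by (simp add: algebra_simps)
  qed
  then have "AE y in lborel. w y = v y" by eventually_elim simp
  then have "represents f v" using represents_cong[OF w sqv] by blast
  then show ?thesis using that unfolding v_def by blast
qed

text \<open>The convolution is a particular solution of (H^* - z) r = w; by linearity the difference
  from \<open>f\<close> lies in the kernel, which is known. Every element of the domain is thus a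
  continuous function plus explicit singular terms.\<close>

lemma H_adj_decomposition:
  fixes x :: "'m::finite \<Rightarrow> real^3"
  assumes k: "Im k > 0" and fh: "(f, h) \<in> H_adj x" and w: "represents (h - k\<^sup>2 *\<^sub>C f) w"
  obtains a where "represents f (\<lambda>y. green_conv k w y + (\<Sum>j\<in>UNIV. a j * G_tilde k (y - x j)))"
proof -
  have sqw: "sq_integrable w" using w by (rule represents_sq_integrable)
  obtain r where r: "represents r (green_conv k w)"
    using represents_class[OF green_conv_young(1)[OF k sqw]] by blast
  define h' where "h' = (h - k\<^sup>2 *\<^sub>C f) + k\<^sup>2 *\<^sub>C r"
  have "(r, h') \<in> H_adj x"
    by (rule green_conv_in_H_adj[OF k _ r]) (simp add: h'_def w)
  then have "(f - r, h - h') \<in> H_adj x" by (rule H_adj_diff[OF fh])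
  moreover have "h - h' = k\<^sup>2 *\<^sub>C (f - r)"
  proof -
    obtain u v where u: "represents f u" and v: "represents r v" using represents_exists by blast
    have "represents (k\<^sup>2 *\<^sub>C f - k\<^sup>2 *\<^sub>C r) (\<lambda>y. k\<^sup>2 * u y - k\<^sup>2 * v y)"
      by (intro represents_diff represents_scale u v)
    moreover have "represents (k\<^sup>2 *\<^sub>C (f - r)) (\<lambda>y. k\<^sup>2 * (u y - v y))"
      by (intro represents_diff represents_scale u v)
    ultimately have "k\<^sup>2 *\<^sub>C f - k\<^sup>2 *\<^sub>C r = k\<^sup>2 *\<^sub>C (f - r)"
      by (rule represents_eqI) (simp add: right_diff_distrib)
    then show ?thesis by (simp add: h'_def)
  qed
  ultimately have "(f - r, k\<^sup>2 *\<^sub>C (f - r)) \<in> H_adj x" by simp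
  then obtain a where "represents (f - r) (\<lambda>y. \<Sum>j\<in>UNIV. a j * G_tilde k (y - x j))"
    using H_adj_kernel[OF k] by blast
  from represents_add[OF r this] show ?thesis using that[of a] by simp
qed

section \<open>Boundary values\<close>

lemma sqrt_cut_power2: "(sqrt_cut z)\<^sup>2 = z"
proof -
  have "(sqrt_cut z)\<^sup>2 = of_real (cmod z) * exp (\<i> * of_real (Arg2pi z))"
    by (simp add: sqrt_cut_def power_mult_distrib exp_double[symmetric] flip: of_real_power)
  then show ?thesis using Arg2pi_eq[of z] by simp
qed

text \<open>Off the cut the argument in [0, 2 pi) is nonzero, so its half lies strictly between 0
  and pi.\<close>

lemma Im_sqrt_cut_pos:
  assumes "z \<notin> complex_of_real ` {0..}"
  shows "Im (sqrt_cut z) > 0"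
proof -
  have "Arg2pi z \<noteq> 0"
  proof
    assume "Arg2pi z = 0"
    then have "z \<in> \<real>" "0 \<le> Re z" by (simp_all add: Arg2pi_eq_0)
    then have "z = complex_of_real (Re z)" "Re z \<in> {0..}" by (simp_all add: of_real_Re)
    then show False using assms by blast
  qed
  then have "0 < Arg2pi z / 2" "Arg2pi z / 2 < pi"
    using Arg2pi_ge_0[of z] Arg2pi_lt_2pi[of z] by auto
  then have "sin (Arg2pi z / 2) > 0" by (intro sin_gt_zero)
  moreover have "z \<noteq> 0" using assms by force
  ultimately show ?thesis
    by (simp add: sqrt_cut_def Im_exp)
qed

text \<open>Near x_j only one summand is singular, and exp(i k r) / (4 pi r) = 1 / (4 pi r) + i k /
  (4 pi) + o(1). The first term is seen by \<open>Gamma0\<close>, the second by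
  \<open>Gamma1\<close>. The continuous part \<open>v\<close> is zero on defect spaces and a
  convolution in the study of \<open>H_zero\<close>.\<close>

lemma Gamma_values:
  fixes x :: "'m::finite \<Rightarrow> real^3" and a :: "complex^'m"
  assumes inj: "inj x" and v: "continuous_on UNIV v"
    and f: "represents f (\<lambda>y. v y + (\<Sum>j\<in>UNIV. a $ j * G_tilde k (y - x j)))"
  shows "Gamma0 x f = a"
    and "Gamma1 x f = (\<chi> j. v (x j) + (\<Sum>l\<in>UNIV.
      (\<i> * k / (4 * of_real pi) * (if j = l then 1 else 0) + G_tilde k (x j - x l)) * a $ l))"
proof -
  define u where "u y = v y + (\<Sum>j\<in>UNIV. a $ j * G_tilde k (y - x j))" for y
  have G: "isCont (\<lambda>y. G_tilde k (y - x j)) y" if "y \<noteq> x j" for y j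
    unfolding G_tilde_eq using that by (intro continuous_intros) auto
  have vc: "isCont v y" for y using v by (simp add: continuous_on_eq_continuous_at)
  have cu: "continuous_on (- range x) u"
    unfolding u_def
    by (intro continuous_at_imp_continuous_on ballI continuous_add vc continuous_sum continuous_mult continuous_const G) auto
  define p where "p = cont_rep x f"
  have p: "represents f p" "continuous_on (- range x) p"
    using someI_ex[of "\<lambda>u. represents f u \<and> continuous_on (- range x) u"] f cu
    unfolding p_def cont_rep_def u_def[abs_def] by blast+
  have op: "open (- range x)" by (intro open_Compl finite_imp_closed) simp
  \<comment> \<open>\<open>cont_rep\<close> is an arbitrary choice, but it differs from the explicit
    function \<open>u\<close> at most at the points x_j, where punctured limits do not see
    it.\<close>
  have pu: "p y = u y" if "y \<notin> range x" for y
    using that by (intro open_AE_eq_continuous[OF op p(2) cu]) (auto simp: u_def intro!: represents_AE[OF p(1) f])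
  have lims: "sing_coeff x f $ j = a $ j / (4 * of_real pi)"
    "Lim (at (x j)) (\<lambda>y. p y - a $ j / (4 * of_real pi) / of_real (norm (y - x j))) =
      v (x j) + (\<Sum>l\<in>UNIV. (\<i> * k / (4 * of_real pi) * (if j = l then 1 else 0) + G_tilde k (x j - x l)) * a $ l)" for j
  proof -
    define rest where "rest y = v y + (\<Sum>l\<in>UNIV - {j}. a $ l * G_tilde k (y - x l))" for y
    have "isCont rest (x j)"
      unfolding rest_def
      by (intro continuous_add vc continuous_sum continuous_mult continuous_const G) (use inj in \<open>auto dest: injD\<close>)
    then have rest: "(rest \<longlongrightarrow> rest (x j)) (at (x j))" by (simp add: isCont_def)
    have r0: "((\<lambda>y. norm (y - x j)) \<longlongrightarrow> norm (x j - x j)) (at (x j))"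
      by (intro tendsto_intros)
    have ev: "\<forall>\<^sub>F y in at (x j). y \<noteq> x j \<and> p y = rest y + a $ j * G_tilde k (y - x j)"
    proof -
      have "open (- (range x - {x j}))" by (intro open_Compl finite_imp_closed) simp
      then have "\<forall>\<^sub>F y in at (x j). y \<in> - (range x - {x j})"
        using eventually_nhds_in_open[of "- (range x - {x j})" "x j"]
        by (auto simp: eventually_at_filter elim: eventually_mono)
      moreover have "\<forall>\<^sub>F y in at (x j). y \<noteq> x j" by (simp add: eventually_at_filter)
      ultimately show ?thesis
      proof eventually_elim
        case (elim y)
        then have "p y = u y" by (intro pu) auto
        also have "\<dots> = rest y + a $ j * G_tilde k (y - x j)"
          by (simp add: u_def rest_def sum.remove[of UNIV j] add_ac)
        finally show ?case using elim by simp
      qed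
    qed
    have "((\<lambda>y. rest y * of_real (norm (y - x j)) + a $ j * exp (\<i> * k * of_real (norm (y - x j))) / (4 * of_real pi)) \<longlongrightarrow>
        rest (x j) * of_real (norm (x j - x j)) + a $ j * exp (\<i> * k * of_real (norm (x j - x j))) / (4 * of_real pi)) (at (x j))"
      by (intro tendsto_intros rest r0) simp
    then have "((\<lambda>y. rest y * of_real (norm (y - x j)) + a $ j * exp (\<i> * k * of_real (norm (y - x j))) / (4 * of_real pi)) \<longlongrightarrow>
        a $ j / (4 * of_real pi)) (at (x j))"
      by simp
    then have "((\<lambda>y. p y * of_real (norm (y - x j))) \<longlongrightarrow> a $ j / (4 * of_real pi)) (at (x j))"
    proof (rule Lim_transform_eventually)
      show "\<forall>\<^sub>F y in at (x j). rest y * of_real (norm (y - x j)) + a $ j * exp (\<i> * k * of_real (norm (y - x j))) / (4 * of_real pi)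
          = p y * of_real (norm (y - x j))"
        using ev by eventually_elim (simp add: G_tilde_eq distrib_right)
    qed
    then show "sing_coeff x f $ j = a $ j / (4 * of_real pi)"
      by (simp add: sing_coeff_def p_def[symmetric] tendsto_Lim)
    have exp_lim: "((\<lambda>y. (exp (\<i> * k * of_real (norm (y - x j))) - 1) / of_real (norm (y - x j))) \<longlongrightarrow> \<i> * k) (at (x j))"
    proof -
      have "((\<lambda>z. exp (\<i> * k * z)) has_field_derivative \<i> * k) (at 0)"
        by (auto intro!: derivative_eq_intros)
      then have "((\<lambda>h. (exp (\<i> * k * h) - 1) / h) \<longlongrightarrow> \<i> * k) (at 0)"
        by (simp add: DERIV_def)
      moreover have "filterlim (\<lambda>y. complex_of_real (norm (y - x j))) (at 0) (at (x j))"
      proof (rule filterlim_atI)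
        show "((\<lambda>y. complex_of_real (norm (y - x j))) \<longlongrightarrow> 0) (at (x j))"
          using tendsto_of_real[OF r0, where 'a=complex] by simp
        show "\<forall>\<^sub>F y in at (x j). complex_of_real (norm (y - x j)) \<noteq> 0"
          by (simp add: eventually_at_filter)
      qed
      ultimately show ?thesis by (rule filterlim_compose)
    qed
    have "((\<lambda>y. rest y + a $ j / (4 * of_real pi) * ((exp (\<i> * k * of_real (norm (y - x j))) - 1) / of_real (norm (y - x j)))) \<longlongrightarrow>
        rest (x j) + a $ j / (4 * of_real pi) * (\<i> * k)) (at (x j))"
      by (intro tendsto_add tendsto_mult tendsto_const rest exp_lim)
    then have "((\<lambda>y. p y - a $ j / (4 * of_real pi) / of_real (norm (y - x j))) \<longlongrightarrow>
        rest (x j) + a $ j / (4 * of_real pi) * (\<i> * k)) (at (x j))"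
    proof (rule Lim_transform_eventually)
      show "\<forall>\<^sub>F y in at (x j). rest y + a $ j / (4 * of_real pi) * ((exp (\<i> * k * of_real (norm (y - x j))) - 1) / of_real (norm (y - x j)))
          = p y - a $ j / (4 * of_real pi) / of_real (norm (y - x j))"
        using ev
      proof eventually_elim
        case (elim y)
        have "a $ j / (4 * of_real pi) * ((e - 1) / r) = a $ j * (e / (4 * of_real pi * r)) - a $ j / (4 * of_real pi) / r"
          for e r :: complex
          by (simp add: diff_divide_distrib right_diff_distrib)
        then show ?case using elim by (simp add: G_tilde_eq)
      qed
    qed
    then have "Lim (at (x j)) (\<lambda>y. p y - a $ j / (4 * of_real pi) / of_real (norm (y - x j))) =
        rest (x j) + a $ j / (4 * of_real pi) * (\<i> * k)"
      by (intro tendsto_Lim) auto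
    \<comment> \<open>Since \<open>G_tilde k 0 = 0\<close>, the summand \<open>l = j\<close>
      consists of the diagonal entry alone.\<close>
    also have "\<dots> = v (x j) + (\<Sum>l\<in>UNIV. (\<i> * k / (4 * of_real pi) * (if j = l then 1 else 0) + G_tilde k (x j - x l)) * a $ l)"
      by (simp add: rest_def sum.remove[of UNIV j] G_tilde_def mult_ac)
    finally show "Lim (at (x j)) (\<lambda>y. p y - a $ j / (4 * of_real pi) / of_real (norm (y - x j))) =
      v (x j) + (\<Sum>l\<in>UNIV. (\<i> * k / (4 * of_real pi) * (if j = l then 1 else 0) + G_tilde k (x j - x l)) * a $ l)" .
  qed
  show "Gamma0 x f = a"
    by (simp add: Gamma0_def vec_eq_iff lims(1) scaleR_conv_of_real[where 'a=complex])
  show "Gamma1 x f = (\<chi> j. v (x j) + (\<Sum>l\<in>UNIV.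
      (\<i> * k / (4 * of_real pi) * (if j = l then 1 else 0) + G_tilde k (x j - x l)) * a $ l))"
    unfolding Gamma1_def p_def[symmetric] lims ..
qed

section \<open>Defect spaces, Weyl function and gamma-field\<close>

lemma defect_space_H_adj:
  fixes x :: "'m::finite \<Rightarrow> real^3"
  assumes k: "Im k > 0"
  shows "f \<in> defect_space (H_adj x) (k\<^sup>2) \<longleftrightarrow>
    (\<exists>a :: complex^'m. represents f (\<lambda>y. \<Sum>j\<in>UNIV. a $ j * G_tilde k (y - x j)))"
proof
  assume "f \<in> defect_space (H_adj x) (k\<^sup>2)"
  then have "(f, k\<^sup>2 *\<^sub>C f) \<in> H_adj x" by (simp add: defect_space_def)
  then obtain a where "represents f (\<lambda>y. \<Sum>j\<in>UNIV. a j * G_tilde k (y - x j))"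
    by (rule H_adj_kernel[OF k])
  then show "\<exists>a :: complex^'m. represents f (\<lambda>y. \<Sum>j\<in>UNIV. a $ j * G_tilde k (y - x j))"
    by (intro exI[of _ "\<chi> j. a j"]) simp
next
  assume "\<exists>a :: complex^'m. represents f (\<lambda>y. \<Sum>j\<in>UNIV. a $ j * G_tilde k (y - x j))"
  then show "f \<in> defect_space (H_adj x) (k\<^sup>2)"
    using G_tilde_in_H_adj[OF k] by (auto simp: defect_space_def)
qed

lemma Gamma_defect_space:
  fixes x :: "'m::finite \<Rightarrow> real^3" and a :: "complex^'m"
  assumes inj: "inj x" and f: "represents f (\<lambda>y. \<Sum>j\<in>UNIV. a $ j * G_tilde k (y - x j))"
  shows "Gamma0 x f = a"
    and "Gamma1 x f = (\<chi> j l. \<i> * k / (4 * of_real pi) * (if j = l then 1 else 0) + G_tilde k (x j - x l)) *v a"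
  using Gamma_values[OF inj, of "\<lambda>_. 0" f a k] f by (simp_all add: matrix_vector_mult_def)

lemma represents_G_sum:
  fixes x :: "'m::finite \<Rightarrow> real^3" and a :: "complex^'m"
  assumes "Im k > 0"
  shows "\<exists>f. represents f (\<lambda>y. \<Sum>j\<in>UNIV. a $ j * G_tilde k (y - x j))"
  by (intro represents_class sq_integrable_sum sq_integrable_scale sq_integrable_G_translate assms)

text \<open>\<open>Gamma0\<close> recovers the coefficient vector, and every vector occurs. So it
  maps the defect space onto C^m, which makes the matrix unique.\<close>

lemma weyl_function_H_adj:
  fixes x :: "'m::finite \<Rightarrow> real^3"
  assumes inj: "inj x" and k: "Im k > 0"
  shows "weyl_function (H_adj x) (Gamma0 x) (Gamma1 x) (k\<^sup>2) =
    (\<chi> j l. \<i> * k / (4 * of_real pi) * (if j = l then 1 else 0) + G_tilde k (x j - x l))" (is "_ = ?M")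
  unfolding weyl_function_def
proof (rule the_equality)
  show "\<forall>f\<in>defect_space (H_adj x) (k\<^sup>2). ?M *v Gamma0 x f = Gamma1 x f"
    using Gamma_defect_space[OF inj] by (auto simp: defect_space_H_adj[OF k])
  fix M :: "complex^'m^'m" assume M: "\<forall>f\<in>defect_space (H_adj x) (k\<^sup>2). M *v Gamma0 x f = Gamma1 x f"
  have "M *v a = ?M *v a" for a
  proof -
    obtain f where f: "represents f (\<lambda>y. \<Sum>j\<in>UNIV. a $ j * G_tilde k (y - x j))"
      using represents_G_sum[OF k] by blast
    then have "f \<in> defect_space (H_adj x) (k\<^sup>2)" by (auto simp: defect_space_H_adj[OF k])
    with M have "M *v Gamma0 x f = Gamma1 x f" by blast
    then show ?thesis by (simp only: Gamma_defect_space[OF inj f])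
  qed
  then show "M = ?M" by (subst matrix_eq) blast
qed

lemma gamma_field_H_adj:
  fixes x :: "'m::finite \<Rightarrow> real^3" and a :: "complex^'m"
  assumes inj: "inj x" and k: "Im k > 0"
  shows "represents (gamma_field (H_adj x) (Gamma0 x) (k\<^sup>2) a) (\<lambda>y. \<Sum>j\<in>UNIV. a $ j * G_tilde k (y - x j))"
proof -
  obtain f where f: "represents f (\<lambda>y. \<Sum>j\<in>UNIV. a $ j * G_tilde k (y - x j))"
    using represents_G_sum[OF k] by blast
  have "inj_on (Gamma0 x) (defect_space (H_adj x) (k\<^sup>2))"
  proof (rule inj_onI)
    fix f g assume "f \<in> defect_space (H_adj x) (k\<^sup>2)" "g \<in> defect_space (H_adj x) (k\<^sup>2)" and eq: "Gamma0 x f = Gamma0 x g"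
    then obtain a b :: "complex^'m" where fa: "represents f (\<lambda>y. \<Sum>j\<in>UNIV. a $ j * G_tilde k (y - x j))"
      and gb: "represents g (\<lambda>y. \<Sum>j\<in>UNIV. b $ j * G_tilde k (y - x j))"
      by (auto simp: defect_space_H_adj[OF k])
    have "a = b" using eq by (simp only: Gamma_defect_space(1)[OF inj fa] Gamma_defect_space(1)[OF inj gb])
    then show "f = g" using represents_unique[OF fa] gb by simp
  qed
  then have "gamma_field (H_adj x) (Gamma0 x) (k\<^sup>2) a = f"
    unfolding gamma_field_def
    by (rule the_inv_into_f_eq) (use f Gamma_defect_space[OF inj f] in \<open>auto simp: defect_space_H_adj[OF k]\<close>)
  then show ?thesis using f by simp
qed

section \<open>The spectrum of the free Hamiltonian\<close>

text \<open>\<open>Gamma0\<close> reads off the coefficients of the singular part in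
  \<open>H_adj_decomposition\<close>, so it vanishes exactly on convolutions. This exhibits
  \<open>green_conv k\<close> as the resolvent at \<open>k\<^sup>2\<close>; the parameter
  \<open>k\<close> may be chosen to suit the application.\<close>

lemma H_zero_iff:
  fixes x :: "'m::finite \<Rightarrow> real^3"
  assumes inj: "inj x" and k: "Im k > 0"
  shows "(f, h) \<in> H_zero x \<longleftrightarrow> (\<exists>w. represents (h - k\<^sup>2 *\<^sub>C f) w \<and> represents f (green_conv k w))"
proof
  assume "(f, h) \<in> H_zero x"
  then have fh: "(f, h) \<in> H_adj x" "Gamma0 x f = 0" by (simp_all add: H_zero_def ker_restriction_def)
  obtain w where w: "represents (h - k\<^sup>2 *\<^sub>C f) w" using represents_exists by blast
  obtain a where a: "represents f (\<lambda>y. green_conv k w y + (\<Sum>j\<in>UNIV. a j * G_tilde k (y - x j)))"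
    by (rule H_adj_decomposition[OF k fh(1) w])
  have "Gamma0 x f = (\<chi> j. a j)"
    by (rule Gamma_values(1)[OF inj green_conv_continuous[OF k represents_sq_integrable[OF w]], where k=k]) (simp add: a)
  then have "a j = 0" for j using fh(2) by (simp add: vec_eq_iff)
  then show "\<exists>w. represents (h - k\<^sup>2 *\<^sub>C f) w \<and> represents f (green_conv k w)"
    using a w by auto
next
  assume "\<exists>w. represents (h - k\<^sup>2 *\<^sub>C f) w \<and> represents f (green_conv k w)"
  then obtain w where w: "represents (h - k\<^sup>2 *\<^sub>C f) w" and f: "represents f (green_conv k w)" by blast
  have "Gamma0 x f = 0"
    by (rule Gamma_values(1)[OF inj green_conv_continuous[OF k represents_sq_integrable[OF w]], where k=k]) (simp add: f)
  then show "(f, h) \<in> H_zero x"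
    using green_conv_in_H_adj[OF k w f] by (simp add: H_zero_def ker_restriction_def)
qed

lemma in_resolvent_set_H_zero:
  fixes x :: "'m::finite \<Rightarrow> real^3"
  assumes inj: "inj x" and k: "Im k > 0"
  shows "k\<^sup>2 \<in> resolvent_set (H_zero x)"
  unfolding resolvent_set_def mem_Collect_eq
proof (intro conjI allI)
  note H = H_zero_iff[OF inj k]
  fix g
  obtain w where w: "represents g w" using represents_exists by blast
  obtain f where f: "represents f (green_conv k w)"
    using represents_class[OF green_conv_young(1)[OF k represents_sq_integrable[OF w]]] by blast
  show "\<exists>!f. (f, g + k\<^sup>2 *\<^sub>C f) \<in> H_zero x"
  proof (rule ex1I[of _ f])
    show "(f, g + k\<^sup>2 *\<^sub>C f) \<in> H_zero x" unfolding H using w f by auto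
    fix f' assume "(f', g + k\<^sup>2 *\<^sub>C f') \<in> H_zero x"
    then obtain w' where w': "represents g w'" "represents f' (green_conv k w')" unfolding H by auto
    have "green_conv k w' = green_conv k w"
      by (rule green_conv_cong_AE[OF represents_sq_integrable[OF w'(1)] represents_sq_integrable[OF w] represents_AE[OF w'(1) w]])
    then show "f' = f" using f w'(2) represents_unique by simp
  qed
next
  note H = H_zero_iff[OF inj k]
  define N where "N = (LBINT y. norm (G_tilde k y))"
  have N: "N \<ge> 0" by (simp add: N_def)
  show "\<exists>C. \<forall>(f, h)\<in>H_zero x. norm_l2 f \<le> C * norm_l2 (h - k\<^sup>2 *\<^sub>C f)"
  proof (intro exI[of _ N] ballI, clarify)
    fix f h assume "(f, h) \<in> H_zero x"
    then obtain w where w: "represents (h - k\<^sup>2 *\<^sub>C f) w" "represents f (green_conv k w)" unfolding H by auto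
    have "sqrt ((LBINT y. (cmod (green_conv k w y))\<^sup>2)) \<le> sqrt (N\<^sup>2 * (LBINT y. (cmod (w y))\<^sup>2))"
      using green_conv_young(2)[OF k represents_sq_integrable[OF w(1)]] by (simp add: N_def)
    then show "norm_l2 f \<le> N * norm_l2 (h - k\<^sup>2 *\<^sub>C f)"
      using N by (simp add: norm_l2_represents[OF w(1)] norm_l2_represents[OF w(2)] real_sqrt_mult)
  qed
qed

section \<open>Approximate eigenfunctions on the half line\<close>

text \<open>The description of \<open>H_zero\<close> is applied at the auxiliary point z = -1, that
  is \<open>k = \<i>\<close>. The function \<open>\<psi>\<close> may be nonzero at the points x_j,
  in contrast to elements of dom(H).\<close>

lemma test_function_in_H_zero:
  fixes x :: "'m::finite \<Rightarrow> real^3"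
  assumes inj: "inj x" and \<psi>: "test_function \<psi>" and f: "represents f \<psi>" and h: "represents h (\<lambda>y. - lap \<psi> y)"
  shows "(f, h) \<in> H_zero x"
proof -
  have k: "Im \<i> > 0" by simp
  have "represents (h - \<i>\<^sup>2 *\<^sub>C f) (\<lambda>y. - lap \<psi> y - \<i>\<^sup>2 * \<psi> y)"
    by (intro represents_diff represents_scale f h)
  moreover have "green_conv \<i> (\<lambda>y. - lap \<psi> y - \<i>\<^sup>2 * \<psi> y) = \<psi>"
    by (rule ext) (rule green_conv_inverts[OF k \<psi>])
  with f have "represents f (green_conv \<i> (\<lambda>y. - lap \<psi> y - \<i>\<^sup>2 * \<psi> y))"
    by (simp only:)
  ultimately show ?thesis unfolding H_zero_iff[OF inj k] by blast
qed

text \<open>Passing the wave through \<open>pderiv_at i\<close> adds the constant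
  \<open>c i\<close>, which is nonzero at most in direction 1. For \<kappa>^2 = \<mu> the term of
  order zero cancels against \<open>\<mu>\<close>, so only derivatives of the cut-off
  remain.\<close>

lemma lap_mult_plane_wave:
  fixes \<kappa> :: real
  defines "E \<equiv> \<lambda>y::real^3. exp (\<i> * of_real (\<kappa> * y $ 1))"
  assumes u: "smooth_fun u"
  shows "lap (\<lambda>y. u y * E y) y = (lap u y + 2 * \<i> * of_real \<kappa> * pderiv_at 1 u y - of_real (\<kappa>\<^sup>2) * u y) * E y"
    and "smooth_fun E"
proof -
  show E: "smooth_fun E"
    unfolding E_def by (intro smooth_fun_exp smooth_fun_mult smooth_fun_const smooth_fun_coord)
  define c where "c i = \<i> * of_real (\<kappa> * axis i 1 $ (1::3))" for i :: 3
  have pE: "pderiv_at i E y = c i * E y" for i y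
  proof -
    have "((\<lambda>y::real^3. \<i> * complex_of_real (\<kappa> * y $ 1)) has_derivative (\<lambda>h. \<i> * of_real (\<kappa> * h $ 1))) (at y)"
      by (auto intro!: derivative_eq_intros has_derivative_coord)
    from pderiv_at_eqI[OF has_derivative_exp_complex[OF this], of i] show ?thesis
      by (simp add: E_def c_def mult.commute)
  qed
  have p: "pderiv_at i (\<lambda>y. w y * E y) = (\<lambda>y. (c i * w y + pderiv_at i w y) * E y)" if "smooth_fun w" for w i
    using that E
    by (intro ext, subst pderiv_at_mult) (simp_all add: smooth_fun_differentiable pE algebra_simps)
  have q: "pderiv_at i (pderiv_at i (\<lambda>y. u y * E y)) y =
      ((c i)\<^sup>2 * u y + 2 * c i * pderiv_at i u y + pderiv_at i (pderiv_at i u) y) * E y" for i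
  proof -
    have cu: "smooth_fun (\<lambda>y. c i * u y)" by (intro smooth_fun_mult smooth_fun_const u)
    have su: "smooth_fun (\<lambda>y. c i * u y + pderiv_at i u y)"
      by (intro smooth_fun_add cu smooth_fun_pderiv u)
    have "pderiv_at i (\<lambda>y. c i * u y + pderiv_at i u y) y = c i * pderiv_at i u y + pderiv_at i (pderiv_at i u) y"
      using u cu
      by (subst pderiv_at_add) (simp_all add: pderiv_at_cmult smooth_fun_differentiable smooth_fun_pderiv)
    then show ?thesis
      unfolding p[OF u] p[OF su] by (simp add: algebra_simps power2_eq_square)
  qed
  have "c 1 = \<i> * of_real \<kappa>" "c 2 = 0" "c 3 = 0" by (simp_all add: c_def axis_def)
  then show "lap (\<lambda>y. u y * E y) y = (lap u y + 2 * \<i> * of_real \<kappa> * pderiv_at 1 u y - of_real (\<kappa>\<^sup>2) * u y) * E y"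
    unfolding lap_def q by (simp add: sum_3 algebra_simps power2_eq_square)
qed

text \<open>For \<open>\<mu> \<ge> 0\<close> the plane waves \<open>exp (\<i> \<surd>\<mu> y\<^sub>1)\<close>, cut off at distance $1/t$ from the origin, are
  approximate eigenfunctions as $t \to 0$.\<close>

lemma nonneg_notin_resolvent_set:
  fixes x :: "'m::finite \<Rightarrow> real^3"
  assumes inj: "inj x" and \<mu>: "\<mu> \<ge> 0"
  shows "complex_of_real \<mu> \<notin> resolvent_set (H_zero x)"
proof
  assume "complex_of_real \<mu> \<in> resolvent_set (H_zero x)"
  then obtain C where "\<forall>(f, h)\<in>H_zero x. norm_l2 f \<le> C * norm_l2 (h - of_real \<mu> *\<^sub>C f)"
    by (auto simp: resolvent_set_def)
  then have C: "norm_l2 f \<le> C * norm_l2 (h - of_real \<mu> *\<^sub>C f)" if "(f, h) \<in> H_zero x" for f h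
    using that by auto
  define \<kappa> where "\<kappa> = sqrt \<mu>"
  have \<kappa>: "\<kappa>\<^sup>2 = \<mu>" using \<mu> by (simp add: \<kappa>_def)
  define E where "E y = exp (\<i> * of_real (\<kappa> * y $ 1))" for y :: "real^3"
  have E1: "cmod (E y) = 1" for y by (simp add: E_def norm_exp_eq_Re)
  have bound: "(LBINT y. (cmod (\<psi> y))\<^sup>2) \<le> C\<^sup>2 * (LBINT y. (cmod (- lap \<psi> y - of_real \<mu> * \<psi> y))\<^sup>2)"
    if \<psi>: "test_function \<psi>" for \<psi>
  proof -
    obtain f where f: "represents f \<psi>" using represents_class[OF test_function_sq_integrable[OF \<psi>]] by blast
    obtain h where h: "represents h (\<lambda>y. - lap \<psi> y)"
      using represents_class[OF sq_integrable_uminus[OF test_function_sq_integrable[OF test_function_lap[OF \<psi>]]]] by blast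
    have "(norm_l2 f)\<^sup>2 \<le> (C * norm_l2 (h - of_real \<mu> *\<^sub>C f))\<^sup>2"
      by (intro power_mono C test_function_in_H_zero[OF inj \<psi> f h]) (simp add: norm_l2_represents[OF f])
    then show ?thesis
      by (simp add: norm_l2_represents[OF f] norm_l2_represents[OF represents_diff[OF h represents_scale[OF f]]] power_mult_distrib)
  qed
  define \<eta> where "\<eta> y = complex_of_real (box_bump (- 1) 1 y)" for y
  have \<eta>: "test_function \<eta>" unfolding \<eta>_def by (rule test_function_box_bump)
  define A where "A = lap \<eta>"
  define B where "B = pderiv_at 1 \<eta>"
  have AB: "test_function A" "test_function B"
    unfolding A_def B_def by (intro test_function_lap test_function_pderiv \<eta>)+
  note [measurable] = test_function_measurable[OF \<eta>] test_function_measurable[OF AB(1)] test_function_measurable[OF AB(2)]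
  define X where "X = (LBINT y. (cmod (\<eta> y))\<^sup>2)"
  \<comment> \<open>The coefficients come from (a + b)^2 \<le> 2 a^2 + 2 b^2 with b = 2 \<kappa>
    |B|, where \<kappa>^2 = \<mu>.\<close>
  define K where "K = (LBINT y. 2 * (cmod (A y))\<^sup>2 + 8 * \<mu> * (cmod (B y))\<^sup>2)"
  have sqi: "integrable lborel (\<lambda>y. (cmod (w y))\<^sup>2)" if "test_function w" for w
    using test_function_sq_integrable[OF that] by (simp add: sq_integrable_def)
  \<comment> \<open>Rescaling gives both sides of \<open>bound\<close> the same factor t^-3. What
    remains of the residual contains a derivative of the dilated cut-off in each term, hence is of
    order \<open>t\<close>, and its square of order \<open>t\<^sup>2\<close>.\<close>
  have XK: "X \<le> C\<^sup>2 * K * t\<^sup>2" if t: "0 < t" "t \<le> 1" for t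
  proof -
    define u where "u y = \<eta> (0 + t *\<^sub>R y)" for y
    have u: "test_function u" unfolding u_def by (intro test_function_affine_compose \<eta> t)
    have us: "smooth_fun u" using u by (rule test_function_smooth)
    have lap_u: "lap u y = of_real (t\<^sup>2) * A (0 + t *\<^sub>R y)" for y
      unfolding u_def A_def by (rule lap_affine_compose[OF test_function_smooth[OF \<eta>]])
    have p_u: "pderiv_at 1 u y = of_real t * B (0 + t *\<^sub>R y)" for y
      unfolding u_def B_def by (rule pderiv_at_affine_compose) (rule smooth_fun_differentiable[OF test_function_smooth[OF \<eta>]])
    note W = lap_mult_plane_wave[OF us, of \<kappa>, folded E_def]
    have \<psi>: "test_function (\<lambda>y. u y * E y)"
      using test_function_mult[OF W(2) u] by (simp add: mult.commute E_def[abs_def])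
    define D where "D y = (cmod (of_real (t\<^sup>2) * A y + 2 * \<i> * of_real \<kappa> * (of_real t * B y)))\<^sup>2" for y
    have Dm [measurable]: "D \<in> borel_measurable borel" unfolding D_def by measurable
    have "X / t ^ 3 = (LBINT y. (cmod (u y * E y))\<^sup>2)"
      using lborel_integral_affine[of "\<lambda>y. (cmod (\<eta> y))\<^sup>2" t 0] t by (simp add: X_def norm_mult E1 u_def)
    also have "\<dots> \<le> C\<^sup>2 * (LBINT y. (cmod (- lap (\<lambda>y. u y * E y) y - of_real \<mu> * (u y * E y)))\<^sup>2)"
      by (rule bound[OF \<psi>])
    also have "(\<lambda>y. (cmod (- lap (\<lambda>y. u y * E y) y - of_real \<mu> * (u y * E y)))\<^sup>2) = (\<lambda>y. D (0 + t *\<^sub>R y))"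
    proof
      fix y
      have "- lap (\<lambda>y. u y * E y) y - of_real \<mu> * (u y * E y) =
          - (of_real (t\<^sup>2) * A (0 + t *\<^sub>R y) + 2 * \<i> * of_real \<kappa> * (of_real t * B (0 + t *\<^sub>R y))) * E y"
        unfolding W(1) lap_u p_u \<kappa> by (simp add: algebra_simps)
      then show "(cmod (- lap (\<lambda>y. u y * E y) y - of_real \<mu> * (u y * E y)))\<^sup>2 = D (0 + t *\<^sub>R y)"
        unfolding D_def by (simp only: norm_mult E1 norm_minus_cancel mult_1_right)
    qed
    also have "(LBINT y. D (0 + t *\<^sub>R y)) = integral\<^sup>L lborel D / t ^ 3"
      using lborel_integral_affine[OF Dm, of t 0] t by simp
    finally have "X \<le> C\<^sup>2 * integral\<^sup>L lborel D"
      using t by (simp add: field_simps)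
    also have "C\<^sup>2 * integral\<^sup>L lborel D \<le> C\<^sup>2 * (t\<^sup>2 * K)"
    proof (rule mult_left_mono)
      show "integral\<^sup>L lborel D \<le> t\<^sup>2 * K"
    proof -
      have le: "D y \<le> t\<^sup>2 * (2 * (cmod (A y))\<^sup>2 + 8 * \<mu> * (cmod (B y))\<^sup>2)" for y
      proof -
        have "cmod (of_real (t\<^sup>2) * A y + 2 * \<i> * of_real \<kappa> * (of_real t * B y)) \<le> t * (cmod (A y) + 2 * \<kappa> * cmod (B y))"
        proof -
          have "cmod (of_real (t\<^sup>2) * A y + 2 * \<i> * of_real \<kappa> * (of_real t * B y)) \<le>
              t\<^sup>2 * cmod (A y) + 2 * \<kappa> * (t * cmod (B y))"
            using t \<mu> by (intro order_trans[OF norm_triangle_ineq]) (simp add: norm_mult norm_power \<kappa>_def)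
          also have "t\<^sup>2 * cmod (A y) \<le> t * cmod (A y)"
            using t by (intro mult_right_mono) (auto simp: power2_eq_square mult_left_le)
          finally show ?thesis by (simp add: algebra_simps)
        qed
        then have "D y \<le> (t * (cmod (A y) + 2 * \<kappa> * cmod (B y)))\<^sup>2"
          unfolding D_def by (rule power_mono) simp
        also have "\<dots> = t\<^sup>2 * (cmod (A y) + 2 * \<kappa> * cmod (B y))\<^sup>2" by (rule power_mult_distrib)
        also have "(cmod (A y) + 2 * \<kappa> * cmod (B y))\<^sup>2 \<le> 2 * (cmod (A y))\<^sup>2 + 2 * (2 * \<kappa> * cmod (B y))\<^sup>2"
          using sum_squares_bound[of "cmod (A y)" "2 * \<kappa> * cmod (B y)"] by (simp add: power2_sum)
        finally show ?thesis by (simp add: power_mult_distrib \<kappa> mult_left_mono mult.assoc)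
      qed
      have i: "integrable lborel (\<lambda>y. t\<^sup>2 * (2 * (cmod (A y))\<^sup>2 + 8 * \<mu> * (cmod (B y))\<^sup>2))"
        using sqi[OF AB(1)] sqi[OF AB(2)] by simp
      have "integrable lborel D"
      proof (rule Bochner_Integration.integrable_bound[OF i])
        have "norm (D y) \<le> norm (t\<^sup>2 * (2 * (cmod (A y))\<^sup>2 + 8 * \<mu> * (cmod (B y))\<^sup>2))" for y
        proof -
          have "0 \<le> D y" by (simp add: D_def)
          then show ?thesis using le[of y] unfolding real_norm_def by linarith
        qed
        then show "AE y in lborel. norm (D y) \<le> norm (t\<^sup>2 * (2 * (cmod (A y))\<^sup>2 + 8 * \<mu> * (cmod (B y))\<^sup>2))"
          by (intro AE_I2)
      qed simp
      then have "integral\<^sup>L lborel D \<le> (LBINT y. t\<^sup>2 * (2 * (cmod (A y))\<^sup>2 + 8 * \<mu> * (cmod (B y))\<^sup>2))"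
        using i by (rule integral_mono) (rule le)
      then show ?thesis by (simp add: K_def)
    qed
    qed simp
    finally show ?thesis by (simp add: mult_ac)
  qed
  have "X \<le> 0"
  proof (rule tendsto_lowerbound)
    show "((\<lambda>t. C\<^sup>2 * K * t\<^sup>2) \<longlongrightarrow> 0) (at_right 0)"
      by (auto intro!: tendsto_eq_intros)
    show "\<forall>\<^sub>F t in at_right 0. X \<le> C\<^sup>2 * K * t\<^sup>2"
      using eventually_at_right_real[OF zero_less_one] by eventually_elim (auto intro: XK)
  qed simp
  moreover have "X \<ge> 0" by (simp add: X_def)
  ultimately have "X = 0" by linarith
  then have "(LBINT y. (cmod (\<eta> y))\<^sup>2) = 0" by (simp add: X_def)
  then have "AE y in lborel. (cmod (\<eta> y))\<^sup>2 = 0"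
    using sqi[OF \<eta>] by (subst (asm) integral_nonneg_eq_0_iff_AE) auto
  then have "AE y in lborel. \<eta> y = 0" by eventually_elim simp
  \<comment> \<open>A continuous function that vanishes almost everywhere vanishes at 0, yet 0 lies
    in the box on which the bump is positive.\<close>
  then have "\<eta> 0 = 0"
    by (intro open_AE_eq_continuous[OF open_UNIV test_function_continuous[OF \<eta>] continuous_on_const]) auto
  then show False
    using box_bump_pos_iff[of "-1" 1 0] by (simp add: \<eta>_def mem_box_cart)
qed

theorem proposition4p4:
  fixes x :: "'m::finite \<Rightarrow> real^3"
  assumes "inj x"
  shows
    "(\<forall>z. Im z > 0 \<longrightarrow>
        weyl_function (H_adj x) (Gamma0 x) (Gamma1 x) z =
          (\<chi> j k. \<i> * sqrt_cut z / (4 * of_real pi) * (if j = k then 1 else 0)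
                  + G_tilde (sqrt_cut z) (x j - x k))) \<and>
     resolvent_set (H_zero x) = - (complex_of_real ` {0..}) \<and>
     (\<forall>z \<in> resolvent_set (H_zero x). \<forall>a :: complex^'m.
        represents (gamma_field (H_adj x) (Gamma0 x) z a)
          (\<lambda>y. \<Sum>j\<in>UNIV. a $ j * (exp (\<i> * sqrt_cut z * of_real (norm (y - x j)))
                                  / (4 * of_real pi * of_real (norm (y - x j))))))"
proof (intro conjI)
  show "\<forall>z. Im z > 0 \<longrightarrow>
        weyl_function (H_adj x) (Gamma0 x) (Gamma1 x) z =
          (\<chi> j k. \<i> * sqrt_cut z / (4 * of_real pi) * (if j = k then 1 else 0)
                  + G_tilde (sqrt_cut z) (x j - x k))"
  proof (intro allI impI)
    fix z :: complex assume "Im z > 0"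
    then have "Im (sqrt_cut z) > 0" by (intro Im_sqrt_cut_pos) auto
    from weyl_function_H_adj[OF assms this] show "weyl_function (H_adj x) (Gamma0 x) (Gamma1 x) z =
          (\<chi> j k. \<i> * sqrt_cut z / (4 * of_real pi) * (if j = k then 1 else 0)
                  + G_tilde (sqrt_cut z) (x j - x k))"
      by (simp only: sqrt_cut_power2)
  qed
  show R: "resolvent_set (H_zero x) = - (complex_of_real ` {0..})"
  proof (rule set_eqI)
    fix z
    show "z \<in> resolvent_set (H_zero x) \<longleftrightarrow> z \<in> - (complex_of_real ` {0..})"
    proof (cases "z \<in> complex_of_real ` {0..}")
      case True
      then show ?thesis using nonneg_notin_resolvent_set[OF assms] by auto
    next
      case False
      then show ?thesis using in_resolvent_set_H_zero[OF assms Im_sqrt_cut_pos] by (simp add: sqrt_cut_power2)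
    qed
  qed
  show "\<forall>z \<in> resolvent_set (H_zero x). \<forall>a :: complex^'m.
        represents (gamma_field (H_adj x) (Gamma0 x) z a)
          (\<lambda>y. \<Sum>j\<in>UNIV. a $ j * (exp (\<i> * sqrt_cut z * of_real (norm (y - x j)))
                                  / (4 * of_real pi * of_real (norm (y - x j)))))"
  proof (intro ballI allI)
    fix z and a :: "complex^'m" assume "z \<in> resolvent_set (H_zero x)"
    then have "Im (sqrt_cut z) > 0" by (intro Im_sqrt_cut_pos) (simp add: R)
    from gamma_field_H_adj[OF assms this, of a]
    show "represents (gamma_field (H_adj x) (Gamma0 x) z a)
          (\<lambda>y. \<Sum>j\<in>UNIV. a $ j * (exp (\<i> * sqrt_cut z * of_real (norm (y - x j)))
                                  / (4 * of_real pi * of_real (norm (y - x j)))))"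
      by (simp only: sqrt_cut_power2 G_tilde_eq)
  qed
qed

end
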